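(* Let $p>1$, $\gamma\in[0,1]$ and $s\in(0,1]$ (with $s\in(0,1)$ if $\gamma\in[0,1)$, and $s=1$ if $\gamma=1$) be such that $1/p<s<N/p$. Let $\alpha>-sp$ and $\beta>-sp$. Then, for all $q>p^{*}_{\gamma,s,\alpha}$, the problem $$\mathcal{L}_{s,p,\gamma}\,u+|x|^\beta|u|^{p-2}u=|x|^\alpha|u|^{q-2}u\ \text{ in }\mathbb{R}^N,\qquad u>0,$$ has no (weak) solutions $u\in\tilde{\mathcal{X}}(\mathbb{R}^N)$, where $$\tilde{\mathcal{X}}(\mathbb{R}^N)=\{u\in\mathcal{W}^{s,p}_\beta(\mathbb{R}^N)\cap L^\infty(\mathbb{R}^N)\ \text{such that}\ |\nabla u(x)||x|\in L^r(\mathbb{R}^N)\ \text{for some } r>1\}.$$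
   Context: Here $N$ is the dimension of the space $\mathbb{R}^N$. Weighted Lebesgue norms: $\|u\|_{p,\beta}=\left(\int_{\mathbb{R}^N}|x|^\beta|u|^p\,dx\right)^{1/p}$, and $L^p_\beta(\mathbb{R}^N)$ is the space of functions $u:\mathbb{R}^N\to\mathbb{R}$ with $\|u\|_{p,\beta}<\infty$. Seminorms: for $s\in(0,1)$, $[u]_{s,p}=\left(\int_{\mathbb{R}^N}\int_{\mathbb{R}^N}\frac{|u(x)-u(y)|^p}{|x-y|^{N+sp}}\,dx\,dy\right)^{1/p}$; for $s=1$, $[u]_{1,p}=\left(\int_{\mathbb{R}^N}|\nabla u|^p\,dx\right)^{1/p}$. Set $W^{s,p}_\beta(\mathbb{R}^N)=\{u\in L^p_\beta(\mathbb{R}^N):[u]_{s,p}<\infty\}$ with norm $\|u\|_{s,p,\beta}=\|u\|_{p,\beta}+[u]_{s,p}$, and let $W^{s,p}_{rad,\beta}(\mathbb{R}^N)$ be its subset of radial functions. The solution space is $\mathcal{W}^{s,p}_\beta(\mathbb{R}^N)=W^{s,p}_{rad,\beta}(\mathbb{R}^N)$ if $\gamma=0$ (with norm $\|\cdot\|_{s,p,\beta}$), and $\mathcal{W}^{s,p}_\beta(\mathbb{R}^N)=W^{1,p}_{rad,\beta}(\mathbb{R}^N)$ if $\gamma\in(0,1]$ (with norm $\|\cdot\|_{1,p,\beta}$). The operator is $\mathcal{L}_{s,p,\gamma}u=\gamma(-\Delta_p)u+(1-\gamma)(-\Delta_p)^s u$, where $-\Delta_p u=-\mathrm{div}(|\nabla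 u|^{p-2}\nabla u)$ and, for $s\in(0,1)$, $(-\Delta_p)^s u(x)=\text{p.v.}\int_{\mathbb{R}^N}\frac{|u(x)-u(y)|^{p-2}(u(x)-u(y))}{|x-y|^{N+sp}}\,dy$. The case $\gamma=1$ is the purely local operator $-\Delta_p$ and is identified with $s=1$; when $\gamma=0$ or $\gamma\in(0,1)$ one takes $s\in(0,1)$. With $\Phi_r(t)=|t|^{r-2}t$ (for scalars and vectors), its weak form is $$\langle\mathcal{L}_{s,p,\gamma}u,v\rangle=\gamma\int_{\mathbb{R}^N}\Phi_p(\nabla u)\cdot\nabla v\,dx+(1-\gamma)\int_{\mathbb{R}^N}\int_{\mathbb{R}^N}\frac{\Phi_p(u(x)-u(y))(v(x)-v(y))}{|x-y|^{N+sp}}\,dx\,dy,$$ the first (second) term being absent if $\gamma=0$ ($\gamma=1$). Weak solution: $u\in\mathcal{W}^{s,p}_\beta(\mathbb{R}^N)$ (and $u>0$) such that $\langle\mathcal{L}_{s,p,\gamma}u,v\rangle+\int_{\mathbb{R}^N}|x|^\beta\Phi_p(u)v\,dx=\int_{\mathbb{R}^N}|x|^\alpha\Phi_q(u)v\,dx$ for all $v\in\mathcal{W}^{s,p}_\beta(\mathbb{R}^N)$. Critical exponent: $p^{*}_{\gamma,s,\alpha}=\frac{p(N+\alpha)}{N-sp}$ if $\gamma=0$, and $p^{*}_{\gamma,s,\alpha}=\frac{p(N+\alpha)}{N-p}$ if $\gamma\in(0,1]$. In the definition of $\tilde{\mathcal{X}}(\mathbb{R}^N)$, $\nabla u$ is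 the weak gradient.
   Formalization: For 0<γ<1 and p≥N, where p(N+α)/(N−p) is undefined or negative and the claim is meaningless or false, the critical exponent is taken to be infinity, so nothing is claimed in that range. *)

theory Defs
  imports "HOL-Analysis.Analysis"
begin

text \<open>
  The space R^N is a type \<open>'a::euclidean_space\<close> with N = \<open>DIM('a)\<close>. Elements of Lebesgue and
  Sobolev spaces are classes of functions modulo equality almost everywhere; they are represented
  by Borel functions, and every condition below is invariant under changes on null sets. In
  particular the value \<open>0 powr \<beta> = 0\<close> of the weight at the origin is irrelevant.
\<close>

definition Phi :: "real \<Rightarrow> 'b::real_normed_vector \<Rightarrow> 'b" where
  "Phi r t = (norm t powr (r - 2)) *\<^sub>R t"


subsection \<open>Weak gradient\<close>

primrec C_k :: "nat \<Rightarrow> ('a::euclidean_space \<Rightarrow> real) \<Rightarrow> bool" where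
  "C_k 0 f \<longleftrightarrow> continuous_on UNIV f"
| "C_k (Suc k) f \<longleftrightarrow> f differentiable_on UNIV \<and>
     (\<forall>b\<in>Basis. C_k k (\<lambda>x. frechet_derivative f (at x) b))"

definition test_fun :: "('a::euclidean_space \<Rightarrow> real) \<Rightarrow> bool" where
  "test_fun \<phi> \<longleftrightarrow> (\<forall>k. C_k k \<phi>) \<and> (\<exists>K. compact K \<and> (\<forall>x. x \<notin> K \<longrightarrow> \<phi> x = 0))"

definition L1_loc :: "('a::euclidean_space \<Rightarrow> 'b::euclidean_space) \<Rightarrow> bool" where
  "L1_loc f \<longleftrightarrow> f \<in> borel_measurable borel \<and>
     (\<forall>K. compact K \<longrightarrow> set_integrable lborel K f)"

definition has_weak_gradient :: "('a::euclidean_space \<Rightarrow> real) \<Rightarrow> ('a \<Rightarrow> 'a) \<Rightarrow> bool" where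
  "has_weak_gradient u g \<longleftrightarrow> L1_loc u \<and> L1_loc g \<and>
     (\<forall>\<phi>. test_fun \<phi> \<longrightarrow> (\<forall>b\<in>Basis.
        (\<integral>x. u x * frechet_derivative \<phi> (at x) b \<partial>lborel) = - (\<integral>x. (g x \<bullet> b) * \<phi> x \<partial>lborel)))"

definition weakly_differentiable :: "('a::euclidean_space \<Rightarrow> real) \<Rightarrow> bool" where
  "weakly_differentiable u \<longleftrightarrow> (\<exists>g. has_weak_gradient u g)"

text \<open>The weak gradient is unique up to null sets; \<open>weak_grad\<close> chooses a representative. It is
  meaningful only for weakly differentiable functions.\<close>

definition weak_grad :: "('a::euclidean_space \<Rightarrow> real) \<Rightarrow> 'a \<Rightarrow> 'a" where
  "weak_grad u = (SOME g. has_weak_gradient u g)"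


subsection \<open>Weighted function spaces\<close>

text \<open>The norms and seminorms are only needed through their finiteness, so their p-th powers are
  used, with values in [0, \<open>\<infinity>\<close>].\<close>

definition weighted_norm_pow :: "real \<Rightarrow> real \<Rightarrow> ('a::euclidean_space \<Rightarrow> real) \<Rightarrow> ennreal" where
  "weighted_norm_pow p \<beta> u = (\<integral>\<^sup>+x. ennreal (norm x powr \<beta> * \<bar>u x\<bar> powr p) \<partial>lborel)"

definition L_weighted :: "real \<Rightarrow> real \<Rightarrow> ('a::euclidean_space \<Rightarrow> real) set" where
  "L_weighted p \<beta> = {u \<in> borel_measurable borel. weighted_norm_pow p \<beta> u < \<infinity>}"

definition seminorm_pow :: "real \<Rightarrow> real \<Rightarrow> ('a::euclidean_space \<Rightarrow> real) \<Rightarrow> ennreal" where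
  "seminorm_pow s p u =
     (if s = 1 then
        (if weakly_differentiable u
         then \<integral>\<^sup>+x. ennreal (norm (weak_grad u x) powr p) \<partial>lborel
         else \<infinity>)
      else \<integral>\<^sup>+(x, y). ennreal (\<bar>u x - u y\<bar> powr p / norm (x - y) powr (real DIM('a) + s * p))
             \<partial>(lborel \<Otimes>\<^sub>M lborel))"

definition W_space :: "real \<Rightarrow> real \<Rightarrow> real \<Rightarrow> ('a::euclidean_space \<Rightarrow> real) set" where
  "W_space s p \<beta> = {u \<in> L_weighted p \<beta>. seminorm_pow s p u < \<infinity>}"

definition radial :: "('a::euclidean_space \<Rightarrow> real) \<Rightarrow> bool" where
  "radial u \<longleftrightarrow> (\<exists>f \<in> borel_measurable borel. AE x in lborel. u x = f (norm x))"

definition W_rad :: "real \<Rightarrow> real \<Rightarrow> real \<Rightarrow> ('a::euclidean_space \<Rightarrow> real) set" where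
  "W_rad s p \<beta> = {u \<in> W_space s p \<beta>. radial u}"

definition sol_space :: "real \<Rightarrow> real \<Rightarrow> real \<Rightarrow> real \<Rightarrow> ('a::euclidean_space \<Rightarrow> real) set" where
  "sol_space \<gamma> s p \<beta> = (if \<gamma> = 0 then W_rad s p \<beta> else W_rad 1 p \<beta>)"

definition X_tilde :: "real \<Rightarrow> real \<Rightarrow> real \<Rightarrow> real \<Rightarrow> ('a::euclidean_space \<Rightarrow> real) set" where
  "X_tilde \<gamma> s p \<beta> = {u \<in> sol_space \<gamma> s p \<beta>.
     (\<exists>C. AE x in lborel. \<bar>u x\<bar> \<le> C) \<and>
     weakly_differentiable u \<and>
     (\<exists>r>1. (\<integral>\<^sup>+x. ennreal ((norm (weak_grad u x) * norm x) powr r) \<partial>lborel) < \<infinity>)}"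


subsection \<open>Weak solutions\<close>

definition local_integrand ::
    "real \<Rightarrow> ('a::euclidean_space \<Rightarrow> real) \<Rightarrow> ('a \<Rightarrow> real) \<Rightarrow> 'a \<Rightarrow> real" where
  "local_integrand p u v x = Phi p (weak_grad u x) \<bullet> weak_grad v x"

definition nonlocal_integrand ::
    "real \<Rightarrow> real \<Rightarrow> ('a::euclidean_space \<Rightarrow> real) \<Rightarrow> ('a \<Rightarrow> real) \<Rightarrow> 'a \<times> 'a \<Rightarrow> real" where
  "nonlocal_integrand s p u v = (\<lambda>(x, y).
     Phi p (u x - u y) * (v x - v y) / norm (x - y) powr (real DIM('a) + s * p))"

definition power_integrand ::
    "real \<Rightarrow> real \<Rightarrow> ('a::euclidean_space \<Rightarrow> real) \<Rightarrow> ('a \<Rightarrow> real) \<Rightarrow> 'a \<Rightarrow> real" where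
  "power_integrand \<alpha> q u v x = norm x powr \<alpha> * Phi q (u x) * v x"

definition L_form ::
    "real \<Rightarrow> real \<Rightarrow> real \<Rightarrow> ('a::euclidean_space \<Rightarrow> real) \<Rightarrow> ('a \<Rightarrow> real) \<Rightarrow> real" where
  "L_form \<gamma> s p u v =
     (if \<gamma> = 0 then 0 else \<gamma> * (\<integral>x. local_integrand p u v x \<partial>lborel)) +
     (if \<gamma> = 1 then 0
      else (1 - \<gamma>) * (\<integral>z. nonlocal_integrand s p u v z \<partial>(lborel \<Otimes>\<^sub>M lborel)))"

text \<open>The Bochner integral of a non-integrable function is 0 by convention, so the convergence of
  the integrals in the weak formulation has to be stated. For most terms on the left-hand side it
  is automatic by Hoelder's inequality; it is not for the right-hand side with supercritical q,
  nor for the nonlocal term if \<open>0 < \<gamma> < 1\<close>, where \<open>sol_space\<close> only controls the gradient and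
  the weighted norm.\<close>

definition weak_form_defined ::
    "real \<Rightarrow> real \<Rightarrow> real \<Rightarrow> real \<Rightarrow> real \<Rightarrow> real
      \<Rightarrow> ('a::euclidean_space \<Rightarrow> real) \<Rightarrow> ('a \<Rightarrow> real) \<Rightarrow> bool" where
  "weak_form_defined \<gamma> s p q \<alpha> \<beta> u v \<longleftrightarrow>
     (\<gamma> \<noteq> 0 \<longrightarrow> integrable lborel (local_integrand p u v)) \<and>
     (\<gamma> \<noteq> 1 \<longrightarrow> integrable (lborel \<Otimes>\<^sub>M lborel) (nonlocal_integrand s p u v)) \<and>
     integrable lborel (power_integrand \<beta> p u v) \<and>
     integrable lborel (power_integrand \<alpha> q u v)"

definition positive_weak_solution ::
    "real \<Rightarrow> real \<Rightarrow> real \<Rightarrow> real \<Rightarrow> real \<Rightarrow> real \<Rightarrow> ('a::euclidean_space \<Rightarrow> real) \<Rightarrow> bool" where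
  "positive_weak_solution \<gamma> s p q \<alpha> \<beta> u \<longleftrightarrow>
     u \<in> sol_space \<gamma> s p \<beta> \<and>
     (AE x in lborel. u x > 0) \<and>
     (\<forall>v \<in> sol_space \<gamma> s p \<beta>.
        weak_form_defined \<gamma> s p q \<alpha> \<beta> u v \<and>
        L_form \<gamma> s p u v + (\<integral>x. power_integrand \<beta> p u v x \<partial>lborel)
          = (\<integral>x. power_integrand \<alpha> q u v x \<partial>lborel))"


subsection \<open>Critical exponent\<close>

text \<open>As usual for Sobolev exponents, \<open>p\<^sup>* = \<infinity>\<close> when the denominator is not positive. Under
  \<open>s < N / p\<close> this only concerns \<open>0 < \<gamma> < 1\<close> and \<open>p \<ge> N\<close>.\<close>

definition critical_exponent :: "real \<Rightarrow> real \<Rightarrow> real \<Rightarrow> real \<Rightarrow> real \<Rightarrow> ereal" where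
  "critical_exponent N \<gamma> s p \<alpha> =
     (let d = (if \<gamma> = 0 then N - s * p else N - p)
      in if d > 0 then ereal (p * (N + \<alpha>) / d) else \<infinity>)"

end

theory Submission
  imports Defs
begin

text \<open>
  The proof is a Pohozaev argument that never differentiates the energy. Let \<open>E\<close> be the energy
  \<open>\<gamma> \<integral> |\<nabla>u|^p + (1 - \<gamma>) [u]^p\<close> of a solution \<open>u\<close>, and let \<open>A = \<integral> |x|^\<alpha> u^q\<close> and
  \<open>B = \<integral> |x|^\<beta> u^p\<close>; the equation tested with \<open>u\<close> says \<open>A = E + B\<close>. Now the equation is tested with a
  deformation \<open>v = u \<circ> \<phi>\<close>, where \<open>\<phi>\<close> is close to the dilation \<open>x \<mapsto> (1 + \<epsilon>) x\<close>. Young's inequality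
  bounds the left-hand side from above by the energies of \<open>u\<close> and \<open>v\<close>, and the convexity of \<open>t^q\<close>
  bounds the right-hand side from below (\<open>test_inequality\<close>):
  \<open>(A(v) - A(u)) / q - remainder \<le> (E(v) - E(u)) / p + (B(v) - B(u)) / p\<close>,
  where the remainder is \<open>\<integral> |x|^\<alpha> (v^(q-1) - u^(q-1)) (v - u)\<close>. Under dilations, \<open>A\<close> and \<open>B\<close> are
  homogeneous of degrees \<open>- (N + \<alpha>)\<close> and \<open>- (N + \<beta>)\<close>; the energy has degree \<open>- d\<close> with
  \<open>d = N - s p\<close> if \<open>\<gamma> = 0\<close>, and decays at least that fast with \<open>d = N - p\<close> if \<open>\<gamma> > 0\<close>. If the
  remainder is \<open>o(\<epsilon>)\<close>, then dividing by \<open>\<epsilon>\<close> and letting \<open>\<epsilon> \<rightarrow> 0\<close> gives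
  \<open>(d / p - (N + \<alpha>) / q) A + ((N + \<beta> - d) / p) B \<le> 0\<close>. For supercritical \<open>q\<close> both coefficients are
  positive, whereas \<open>A\<close> and \<open>B\<close> are positive because \<open>u\<close> is; this is absurd.

  The work lies in the remainder. A radial weakly differentiable function is almost everywhere
  \<open>f(|x|)\<close> with \<open>f\<close> locally absolutely continuous on \<open>(0, \<infinity>)\<close> (\<open>radial_profile\<close>). Hence the factor
  \<open>v^(q-1) - u^(q-1)\<close> tends to 0 locally uniformly away from the origin, while the integral of
  \<open>|v - u|\<close> over an annulus is \<open>O(\<epsilon>)\<close>, since \<open>|v - u|\<close> is at most the integral of \<open>|f'|\<close> over an
  interval of relative length \<open>\<epsilon>\<close>. The remainder is therefore \<open>o(\<epsilon>)\<close> as soon as a weighted integral of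
  \<open>|f'|\<close> converges (\<open>bregman_little_o\<close>). What makes it converge depends on \<open>\<gamma>\<close>.

  If \<open>\<gamma> > 0\<close>, pure dilations work: the gradient is in \<open>L^p\<close>, which gives the decay
  \<open>f(r) = O(r^(-(N-p)/p))\<close> (\<open>profile_decay\<close>) and then, by Young's inequality and exactly because \<open>q\<close> is
  supercritical, the convergence at the origin and at infinity (\<open>gradient_weight_finite\<close>).

  If \<open>\<gamma> = 0\<close>, nothing controls the gradient strongly enough at the origin and at infinity, and the
  dilation is cut off there: \<open>\<phi>\<close> is the identity near 0 and near infinity, and \<open>(1 + \<epsilon>) x\<close> on a large
  annulus. Such a map and its inverse have Lipschitz constants \<open>1 + O(\<epsilon>)\<close> uniformly in the radii of
  the annulus, so it distorts Lebesgue measure by factors \<open>1 + O(\<epsilon>)\<close> (\<open>nn_integral_phi\<close>, by a Vitali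
  covering). The part of the integrals outside the annulus thus changes by \<open>O(\<epsilon>)\<close> times itself, and
  this error disappears when the annuli exhaust the space.
\<close>

section \<open>Smooth bump functions and the fundamental lemma\<close>

text \<open>
  Any family of derivatives witnesses \<^const>\<open>C_k\<close>, which spares the computation of
  \<^const>\<open>frechet_derivative\<close> in the closure properties below.
\<close>

lemma C_k_SucI:
  assumes "\<And>x. (f has_derivative f' x) (at x)" and "\<And>b. b \<in> Basis \<Longrightarrow> C_k k (\<lambda>x. f' x b)"
  shows "C_k (Suc k) f"
proof -
  have "frechet_derivative f (at x) = f' x" for x
    using frechet_derivative_at[OF assms(1)] by simp
  then show ?thesis
    using assms by (auto simp: differentiable_on_def differentiable_def intro: has_derivative_at_withinI)
qed

lemma C_k_SucD:
  assumes "C_k (Suc k) f"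
  shows "(f has_derivative frechet_derivative f (at x)) (at x)"
    and "b \<in> Basis \<Longrightarrow> C_k k (\<lambda>x. frechet_derivative f (at x) b)"
  using assms by (auto simp: differentiable_on_def frechet_derivative_works[symmetric])

lemma C_k_Suc_imp: "C_k (Suc k) f \<Longrightarrow> C_k k f"
proof (induction k arbitrary: f)
  case 0
  then show ?case by (simp add: differentiable_imp_continuous_on)
next
  case (Suc k)
  then show ?case using C_k.simps(2) by metis
qed

lemma C_k_const: "C_k k (\<lambda>x::'a::euclidean_space. c::real)"
proof (induction k arbitrary: c)
  case 0 then show ?case by simp
next
  case (Suc k)
  show ?case by (rule C_k_SucI[where f' = "\<lambda>_ _. 0"]) (auto intro: Suc)
qed

lemma C_k_inner: "C_k k (\<lambda>x::'a::euclidean_space. x \<bullet> b)"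
proof (cases k)
  case 0 then show ?thesis by (simp add: continuous_intros)
next
  case (Suc j)
  show ?thesis unfolding Suc
    by (rule C_k_SucI[where f' = "\<lambda>_ h. h \<bullet> b"])
       (auto intro!: C_k_const derivative_eq_intros)
qed

lemma C_k_add: "C_k k f \<Longrightarrow> C_k k g \<Longrightarrow> C_k k (\<lambda>x. f x + g x)"
proof (induction k arbitrary: f g)
  case 0 then show ?case by (simp add: continuous_intros)
next
  case (Suc k)
  show ?case
    by (rule C_k_SucI[OF has_derivative_add[OF C_k_SucD(1)[OF Suc(2)] C_k_SucD(1)[OF Suc(3)]]])
       (intro Suc.IH C_k_SucD(2)[OF Suc(2)] C_k_SucD(2)[OF Suc(3)])
qed

lemma C_k_mult: "C_k k f \<Longrightarrow> C_k k g \<Longrightarrow> C_k k (\<lambda>x. f x * g x)"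
proof (induction k arbitrary: f g)
  case 0 then show ?case by (simp add: continuous_intros)
next
  case (Suc k)
  show ?case
    by (rule C_k_SucI[OF has_derivative_mult[OF C_k_SucD(1)[OF Suc(2)] C_k_SucD(1)[OF Suc(3)]]])
       (intro C_k_add Suc.IH C_k_SucD(2)[OF Suc(2)] C_k_SucD(2)[OF Suc(3)] 
         C_k_Suc_imp[OF Suc(2)] C_k_Suc_imp[OF Suc(3)])
qed

lemma C_k_prod:
  assumes "finite I" "\<And>i. i \<in> I \<Longrightarrow> C_k k (f i)"
  shows "C_k k (\<lambda>x. \<Prod>i\<in>I. f i x)"
  using assms by (induction I rule: finite_induct) (auto intro!: C_k_const C_k_mult)

lemma C_k_scale: "C_k k f \<Longrightarrow> C_k k (\<lambda>x. f (c *\<^sub>R x))"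
proof (induction k arbitrary: f)
  case 0 then show ?case
    by (auto intro!: continuous_intros continuous_on_compose2[of UNIV f])
next
  case (Suc k)
  have "((\<lambda>x. c *\<^sub>R x) has_derivative (\<lambda>h. c *\<^sub>R h)) (at x)" for x :: 'a
    by (auto intro!: derivative_eq_intros)
  from has_derivative_compose[OF this C_k_SucD(1)[OF Suc(2)]]
  have d: "((\<lambda>x. f (c *\<^sub>R x)) has_derivative (\<lambda>h. frechet_derivative f (at (c *\<^sub>R x)) (c *\<^sub>R h))) (at x)" for x
    by simp
  have lin: "linear (frechet_derivative f (at y))" for y
    using C_k_SucD(1)[OF Suc(2)] by (rule has_derivative_linear)
  show ?case
  proof (rule C_k_SucI[OF d])
    fix b :: 'a assume b: "b \<in> Basis"
    have "C_k k (\<lambda>x. c * frechet_derivative f (at (c *\<^sub>R x)) b)"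
      by (intro C_k_mult C_k_const Suc.IH C_k_SucD(2)[OF Suc(2) b])
    then show "C_k k (\<lambda>x. frechet_derivative f (at (c *\<^sub>R x)) (c *\<^sub>R b))"
      using linear_scale[OF lin] by simp
  qed
qed

text \<open>
  The functions \<open>P(1/t) exp(-1/t)\<close>, extended by 0 to \<open>t \<le> 0\<close>. For \<open>P = 1\<close> this is the classical
  smooth function that is flat at 0; the family is closed under differentiation, so that smoothness
  is proved by one induction.
\<close>

definition bump_poly :: "real poly \<Rightarrow> real \<Rightarrow> real" where
  "bump_poly P t = (if t > 0 then poly P (1 / t) * exp (- (1 / t)) else 0)"


lemma power_le_fact_exp:
  fixes y :: real assumes "y \<ge> 0" shows "y ^ n \<le> fact n * exp y"
proof -
  have "(\<Sum>i\<in>{n}. y ^ i /\<^sub>R fact i) \<le> (\<Sum>i. y ^ i /\<^sub>R fact i)"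
    using assms by (intro sum_le_suminf summable_exp_generic) auto
  then show ?thesis by (simp add: exp_def field_simps)
qed

lemma poly_exp_bound:
  obtains C where "C \<ge> 0" "\<And>y::real. y \<ge> 0 \<Longrightarrow> \<bar>poly P y\<bar> * exp (- y) \<le> C"
proof
  fix y :: real assume y: "y \<ge> 0"
  have "\<bar>poly P y\<bar> \<le> (\<Sum>i\<le>degree P. \<bar>coeff P i\<bar> * y ^ i)"
    unfolding poly_altdef using y by (intro order_trans[OF sum_abs]) (simp add: abs_mult)
  also have "\<dots> \<le> (\<Sum>i\<le>degree P. \<bar>coeff P i\<bar> * (fact i * exp y))"
    by (intro sum_mono mult_left_mono power_le_fact_exp y) auto
  also have "\<dots> = (\<Sum>i\<le>degree P. \<bar>coeff P i\<bar> * fact i) * exp y"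
    by (simp add: sum_distrib_right mult.assoc)
  finally show "\<bar>poly P y\<bar> * exp (- y) \<le> (\<Sum>i\<le>degree P. \<bar>coeff P i\<bar> * fact i)"
    by (simp add: exp_minus field_simps)
qed (auto intro: sum_nonneg)

text \<open>
  With \<open>y = 1/t\<close>, the derivative of \<open>P(y) exp(-y)\<close> is \<open>y^2 (P - P')(y) exp(-y)\<close>. At the origin the
  difference quotient is \<open>O(|h|)\<close>, because \<open>y^2 P(y) exp(-y)\<close> is bounded.
\<close>

lemma bump_poly_derivative:
  "(bump_poly P has_real_derivative bump_poly ([:0, 0, 1:] * (P - pderiv P)) t) (at t)"
proof -
  consider "t > 0" | "t < 0" | "t = 0" by linarith
  then show ?thesis
  proof cases
    case 1
    have d: "((\<lambda>t. poly P (1 / t) * exp (- (1 / t))) has_real_derivative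
        poly ([:0, 0, 1:] * (P - pderiv P)) (1 / t) * exp (- (1 / t))) (at t)"
      using 1 by (auto intro!: derivative_eq_intros simp: field_simps power2_eq_square)
    show ?thesis
      by (rule DERIV_cong_ev[THEN iffD1, OF refl _ _ d])
         (use 1 in \<open>auto simp: bump_poly_def intro!: eventually_nhds_in_open[of "{0<..}", THEN eventually_mono]\<close>)
  next
    case 2
    show ?thesis
      by (rule DERIV_cong_ev[THEN iffD1, OF refl _ _ DERIV_const[of 0]])
         (use 2 in \<open>auto simp: bump_poly_def intro!: eventually_nhds_in_open[of "{..<0}", THEN eventually_mono]\<close>)
  next
    case 3
    obtain C where C: "C \<ge> 0" "\<And>y::real. y \<ge> 0 \<Longrightarrow> \<bar>poly ([:0, 0, 1:] * P) y\<bar> * exp (- y) \<le> C"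
      using poly_exp_bound[of "[:0, 0, 1:] * P"] by blast
    have b: "\<bar>bump_poly P h / h\<bar> \<le> C * \<bar>h\<bar>" for h
    proof (cases "h > 0")
      case True
      then show ?thesis using C(2)[of "1 / h"]
        by (simp add: bump_poly_def abs_mult field_simps)
    qed (use C(1) in \<open>simp add: bump_poly_def mult_nonneg_nonpos\<close>)
    have "((\<lambda>h. bump_poly P h / h) \<longlongrightarrow> 0) (at 0)"
      by (rule Lim_null_comparison[where g = "\<lambda>h. C * \<bar>h\<bar>"])
         (use b in \<open>auto intro!: tendsto_eq_intros\<close>)
    then show ?thesis unfolding 3 by (simp add: DERIV_def bump_poly_def)
  qed
qed

lemma C_k_bump_poly: "C_k k (\<lambda>x::'a::euclidean_space. bump_poly P (c + x \<bullet> a))"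
proof (induction k arbitrary: P)
  case 0
  have "continuous_on UNIV (bump_poly P)"
    using bump_poly_derivative by (rule DERIV_continuous_on[OF has_field_derivative_at_within])
  then show ?case
    by (auto intro!: continuous_intros continuous_on_compose2[of UNIV "bump_poly P"])
next
  case (Suc k)
  let ?Q = "[:0, 0, 1:] * (P - pderiv P)"
  have "((\<lambda>x. c + x \<bullet> a) has_derivative (\<lambda>h. h \<bullet> a)) (at x)" for x :: 'a
    by (auto intro!: derivative_eq_intros)
  from has_derivative_compose[OF this bump_poly_derivative[unfolded has_field_derivative_def]]
  have "((\<lambda>x. bump_poly P (c + x \<bullet> a)) has_derivative
      (\<lambda>h. bump_poly ?Q (c + x \<bullet> a) * (h \<bullet> a))) (at x)" for x :: 'a .
  then show ?case
    by (rule C_k_SucI) (intro C_k_mult Suc.IH C_k_const)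
qed

text \<open>
  Smooth functions with support in the closed box that increase to its indicator function: each
  factor is \<open>exp(-1/(n d))\<close>, where \<open>d\<close> is the distance to one of the faces.
\<close>

definition box_bump :: "nat \<Rightarrow> 'a::euclidean_space \<Rightarrow> 'a \<Rightarrow> 'a \<Rightarrow> real" where
  "box_bump n l r x = (\<Prod>b\<in>Basis. bump_poly 1 (- real n * (l \<bullet> b) + x \<bullet> (real n *\<^sub>R b))
                                * bump_poly 1 (real n * (r \<bullet> b) + x \<bullet> (- real n *\<^sub>R b)))"

lemma bump_poly_1: "0 \<le> bump_poly 1 t" "bump_poly 1 t \<le> 1" "t \<le> 0 \<Longrightarrow> bump_poly 1 t = 0"
  by (auto simp: bump_poly_def)

lemma box_bump_eq_0: "x \<notin> box l r \<Longrightarrow> box_bump n l r x = 0"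
proof -
  assume "x \<notin> box l r"
  then obtain b where b: "b \<in> Basis" "x \<bullet> b \<le> l \<bullet> b \<or> r \<bullet> b \<le> x \<bullet> b"
    by (auto simp: mem_box not_less)
  then have "- real n * (l \<bullet> b) + x \<bullet> (real n *\<^sub>R b) \<le> 0 \<or> real n * (r \<bullet> b) + x \<bullet> (- real n *\<^sub>R b) \<le> 0"
    by (auto simp: mult_left_mono)
  then show ?thesis
    unfolding box_bump_def using b(1) bump_poly_1(3)
    by (intro prod_zero bexI[of _ b]) (auto simp del: scaleR_minus_left inner_scaleR_right)
qed

lemma box_bump_bounds: "0 \<le> box_bump n l r x" "box_bump n l r x \<le> 1"
  unfolding box_bump_def
  by (intro prod_nonneg prod_le_1 ballI conjI mult_nonneg_nonneg mult_le_one bump_poly_1)+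

lemma test_fun_box_bump: "test_fun (box_bump n l r)"
  unfolding test_fun_def
proof (intro conjI allI exI)
  fix k show "C_k k (box_bump n l r)"
    unfolding box_bump_def by (intro C_k_prod C_k_mult C_k_bump_poly finite_Basis)
next
  show "compact (cbox l r)" by (rule compact_cbox)
  fix x show "x \<notin> cbox l r \<longrightarrow> box_bump n l r x = 0"
    using box_bump_eq_0[of x l r n] box_subset_cbox[of l r] by auto
qed

lemma box_bump_tendsto: "(\<lambda>n. box_bump n l r x) \<longlonglongrightarrow> indicator (box l r) x"
proof (cases "x \<in> box l r")
  case True
  have lim: "(\<lambda>n. bump_poly 1 (real n * d)) \<longlonglongrightarrow> 1" if "d > 0" for d
  proof -
    have "(\<lambda>n. exp (- (1 / (real n * d)))) \<longlonglongrightarrow> exp (- (0 * (1 / d)))"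
      by (intro tendsto_intros) (use lim_1_over_n tendsto_mult_right[OF lim_1_over_n, of "1 / d"] in simp)
    moreover have "\<forall>\<^sub>F n in sequentially. exp (- (1 / (real n * d))) = bump_poly 1 (real n * d)"
      using eventually_gt_at_top[of 0] by eventually_elim (use that in \<open>simp add: bump_poly_def\<close>)
    ultimately show ?thesis by (simp add: tendsto_cong)
  qed
  have "(\<lambda>n. box_bump n l r x) \<longlonglongrightarrow> (\<Prod>b\<in>(Basis::'a set). 1 * 1)"
    unfolding box_bump_def
  proof (intro tendsto_prod tendsto_mult)
    fix b :: 'a assume b: "b \<in> Basis"
    have "- real n * (l \<bullet> b) + x \<bullet> (real n *\<^sub>R b) = real n * ((x - l) \<bullet> b)"
      "real n * (r \<bullet> b) + x \<bullet> (- real n *\<^sub>R b) = real n * ((r - x) \<bullet> b)" for n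
      by (simp_all add: inner_simps algebra_simps)
    then show "(\<lambda>n. bump_poly 1 (- real n * (l \<bullet> b) + x \<bullet> (real n *\<^sub>R b))) \<longlonglongrightarrow> 1"
      "(\<lambda>n. bump_poly 1 (real n * (r \<bullet> b) + x \<bullet> (- real n *\<^sub>R b))) \<longlonglongrightarrow> 1"
      using b True by (auto intro!: lim simp: mem_box inner_diff_left)
  qed
  then show ?thesis using True by simp
qed (simp add: box_bump_eq_0)

lemma L1_locD:
  assumes "L1_loc f"
  shows "f \<in> borel_measurable borel" "compact K \<Longrightarrow> set_integrable lborel K f"
  using assms by (auto simp: L1_loc_def)

lemma L1_loc_integrable_mult:
  fixes h :: "'a::euclidean_space \<Rightarrow> real"
  assumes h: "L1_loc h" and g[measurable]: "g \<in> borel_measurable borel"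
    and K: "compact K" "\<And>x. x \<notin> K \<Longrightarrow> g x = 0" and B: "\<And>x. \<bar>g x\<bar> \<le> B"
  shows "integrable lborel (\<lambda>x. h x * g x)"
proof (rule Bochner_Integration.integrable_bound)
  have [measurable]: "h \<in> borel_measurable borel" using h by (rule L1_locD)
  have "integrable lborel (\<lambda>x. indicator K x *\<^sub>R h x)"
    using L1_locD(2)[OF h K(1)] by (simp add: set_integrable_def)
  then show "integrable lborel (\<lambda>x. B * (indicator K x *\<^sub>R h x))" by simp
  show "(\<lambda>x. h x * g x) \<in> borel_measurable lborel" by measurable
  show "AE x in lborel. norm (h x * g x) \<le> norm (B * (indicator K x *\<^sub>R h x))"
  proof (rule AE_I2)
    fix x
    have "\<bar>h x\<bar> * \<bar>g x\<bar> \<le> \<bar>h x\<bar> * \<bar>B\<bar>" using B[of x] by (intro mult_left_mono) auto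
    then show "norm (h x * g x) \<le> norm (B * (indicator K x *\<^sub>R h x))"
      using K(2)[of x] by (cases "x \<in> K") (auto simp: abs_mult mult.commute)
  qed
qed

text \<open>
  The fundamental lemma of the calculus of variations. Testing with \<open>box_bump n\<close> and \<open>n \<rightarrow> \<infinity>\<close> shows
  that \<open>h\<close> has integral 0 over every box; hence the measures with densities the positive and the
  negative part of \<open>h\<close> agree on boxes, and so everywhere.
\<close>

theorem fundamental_lemma:
  fixes h :: "'a::euclidean_space \<Rightarrow> real"
  assumes h: "L1_loc h" and z: "\<And>\<phi>. test_fun \<phi> \<Longrightarrow> (\<integral>x. h x * \<phi> x \<partial>lborel) = 0"
  shows "AE x in lborel. h x = 0"
proof -
  have [measurable]: "h \<in> borel_measurable borel" using h by (rule L1_locD)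
  have [measurable]: "box_bump n l r \<in> borel_measurable borel" for n and l r :: 'a
    using test_fun_box_bump[of n l r] unfolding test_fun_def
    by (intro borel_measurable_continuous_onI) (metis C_k.simps(1))
  have int: "integrable lborel (\<lambda>x. h x * indicator (box l r) x)" for l r :: 'a
    by (rule L1_loc_integrable_mult[OF h _ compact_cbox[of l r], where B = 1])
       (use box_subset_cbox[of l r] in \<open>auto simp: indicator_def\<close>)
  have box0: "(\<integral>x. h x * indicator (box l r) x \<partial>lborel) = 0" for l r :: 'a
  proof -
    have "(\<lambda>n. \<integral>x. h x * box_bump n l r x \<partial>lborel) \<longlonglongrightarrow> (\<integral>x. h x * indicator (box l r) x \<partial>lborel)"
    proof (rule integral_dominated_convergence[where w = "\<lambda>x. \<bar>h x * indicator (box l r) x\<bar>"])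
      show "AE x in lborel. (\<lambda>n. h x * box_bump n l r x) \<longlonglongrightarrow> h x * indicator (box l r) x"
        by (intro AE_I2 tendsto_intros box_bump_tendsto)
      show "AE x in lborel. norm (h x * box_bump n l r x) \<le> \<bar>h x * indicator (box l r) x\<bar>" for n
        using box_bump_bounds[of n l r] box_bump_eq_0[of _ l r n]
        by (intro AE_I2) (auto simp: abs_mult indicator_def intro!: mult_left_le)
    qed (use int in auto)
    then show ?thesis using z[OF test_fun_box_bump] by (simp add: LIMSEQ_const_iff)
  qed
  let ?E = "range (\<lambda>(a, b). box a b :: 'a set)"
  let ?p = "density lborel (\<lambda>x. ennreal (h x))" and ?m = "density lborel (\<lambda>x. ennreal (- h x))"
  have em: "emeasure (density lborel (\<lambda>x. ennreal (s * h x))) (box l r) = 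
      ennreal (\<integral>x. max 0 (s * h x) * indicator (box l r) x \<partial>lborel)" 
    and intm: "integrable lborel (\<lambda>x. max 0 (s * h x) * indicator (box l r) x)" 
    if "s \<in> {1, -1}" for s l r
  proof -
    show i: "integrable lborel (\<lambda>x. max 0 (s * h x) * indicator (box l r) x)"
      by (rule Bochner_Integration.integrable_bound[OF int[of l r]]) 
         (use that in \<open>auto simp: abs_mult intro!: mult_right_mono AE_I2\<close>)
    show "emeasure (density lborel (\<lambda>x. ennreal (s * h x))) (box l r) = 
      ennreal (\<integral>x. max 0 (s * h x) * indicator (box l r) x \<partial>lborel)"
      by (subst nn_integral_eq_integral[OF i, symmetric])
         (auto simp: emeasure_density indicator_def ennreal_max_0 intro!: nn_integral_cong)
  qed
  have "?p = ?m"
  proof (rule measure_eqI_generator_eq[where E = ?E and \<Omega> = UNIV and A = "\<lambda>n. box (- (real n *\<^sub>R One)) (real n *\<^sub>R One)"])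
    show "Int_stable ?E" by (auto simp: Int_stable_def box_Int_box)
    fix X assume "X \<in> ?E"
    then obtain l r where X: "X = box l r" by auto
    have "(\<integral>x. max 0 (1 * h x) * indicator (box l r) x \<partial>lborel) 
        - (\<integral>x. max 0 (- 1 * h x) * indicator (box l r) x \<partial>lborel) = (\<integral>x. h x * indicator (box l r) x \<partial>lborel)"
      by (subst Bochner_Integration.integral_diff[symmetric, OF intm intm])
         (auto simp: indicator_def intro!: Bochner_Integration.integral_cong)
    then show "emeasure ?p X = emeasure ?m X"
      unfolding X using em[of 1 l r] em[of "-1" l r] box0[of l r] by simp
  next
    fix i show "emeasure ?p (box (- (real i *\<^sub>R One)) (real i *\<^sub>R One)) \<noteq> \<infinity>"
      using em[of 1] by simp
  qed (auto simp: borel_eq_box UN_box_eq_UNIV)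
  then have "AE x in lborel. ennreal (h x) = ennreal (- h x)"
    by (intro sigma_finite_measure.density_unique[OF lborel.sigma_finite_measure_axioms]) auto
  then show ?thesis
    by eventually_elim (metis ennreal_eq_0_iff ennreal_neg linear neg_0_le_iff_le neg_le_0_iff_le order_antisym)
qed

section \<open>Dilations, test functions and weak gradients\<close>

lemma distr_lborel_scale:
  fixes c :: real assumes c: "c > 0"
  shows "distr lborel borel (\<lambda>x::'a::euclidean_space. c *\<^sub>R x) = density lborel (\<lambda>_. ennreal (c powr - real DIM('a)))"
proof -
  have "distr lborel borel (\<lambda>x::'a. c *\<^sub>R x)
      = density (density (distr lborel borel (\<lambda>x::'a. c *\<^sub>R x)) (\<lambda>_. ennreal (\<bar>c\<bar> ^ DIM('a)))) (\<lambda>_. ennreal (c powr - real DIM('a)))"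
    using c by (subst density_density_eq)
      (auto simp: ennreal_mult[symmetric] powr_minus powr_realpow density_1)
  also have "density (distr lborel borel (\<lambda>x::'a. c *\<^sub>R x)) (\<lambda>_. ennreal (\<bar>c\<bar> ^ DIM('a))) = lborel"
    using lborel_affine[of c "0::'a"] c by simp
  finally show ?thesis .
qed

lemma nn_integral_scale:
  fixes f :: "'a::euclidean_space \<Rightarrow> ennreal"
  assumes [measurable]: "f \<in> borel_measurable borel" and c: "c > 0"
  shows "(\<integral>\<^sup>+x. f (c *\<^sub>R x) \<partial>lborel) = ennreal (c powr - real DIM('a)) * (\<integral>\<^sup>+x. f x \<partial>lborel)"
proof -
  have "(\<integral>\<^sup>+x. f (c *\<^sub>R x) \<partial>lborel) = (\<integral>\<^sup>+x. f x \<partial>distr lborel borel (\<lambda>x::'a. c *\<^sub>R x))"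
    by (subst nn_integral_distr) auto
  then show ?thesis by (simp add: distr_lborel_scale[OF c] nn_integral_density nn_integral_cmult)
qed

lemma AE_scale:
  fixes P :: "'a::euclidean_space \<Rightarrow> bool"
  assumes P: "AE x in lborel. P x" and c: "c > 0"
  shows "AE x in lborel. P (c *\<^sub>R x)"
proof -
  obtain S where S: "S \<in> sets lborel" "{x \<in> space lborel. \<not> P x} \<subseteq> S" "emeasure lborel S = 0"
    using P by (auto elim!: AE_E)
  have [measurable]: "S \<in> sets borel" using S by simp
  have "(\<integral>\<^sup>+x. indicator S (c *\<^sub>R x) \<partial>lborel) = 0"
    using S by (subst nn_integral_scale[OF _ c]) auto
  then have "AE x in lborel. (indicator S (c *\<^sub>R x) :: ennreal) = 0"
    by (subst (asm) nn_integral_0_iff_AE) auto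
  then show ?thesis by eventually_elim (use S in \<open>auto simp: indicator_def split: if_splits\<close>)
qed

lemma integrable_scale:
  fixes f :: "'a::euclidean_space \<Rightarrow> 'b::{banach, second_countable_topology}"
  assumes f: "integrable lborel f" and c: "c > 0"
  shows "integrable lborel (\<lambda>x. f (c *\<^sub>R x))"
proof -
  have [measurable]: "f \<in> borel_measurable borel" using f by auto
  have "(\<integral>\<^sup>+x. ennreal (norm (f (c *\<^sub>R x))) \<partial>lborel) = ennreal (c powr - real DIM('a)) * (\<integral>\<^sup>+x. ennreal (norm (f x)) \<partial>lborel)"
    by (rule nn_integral_scale[OF _ c]) measurable
  also have "\<dots> < \<infinity>" using f by (auto simp: integrable_iff_bounded ennreal_mult_less_top)
  finally show ?thesis by (auto simp: integrable_iff_bounded)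
qed

lemma integrable_scale_iff:
  fixes f :: "'a::euclidean_space \<Rightarrow> 'b::{banach, second_countable_topology}"
  assumes c: "c > 0"
  shows "integrable lborel (\<lambda>x. f (c *\<^sub>R x)) \<longleftrightarrow> integrable lborel f"
  using integrable_scale[of f c] integrable_scale[of "\<lambda>x. f (c *\<^sub>R x)" "1 / c"] c by auto

lemma integral_scale:
  fixes f :: "'a::euclidean_space \<Rightarrow> 'b::{banach, second_countable_topology}"
  assumes c: "c > 0"
  shows "(\<integral>x. f (c *\<^sub>R x) \<partial>lborel) = (c powr - real DIM('a)) *\<^sub>R (\<integral>x. f x \<partial>lborel)"
proof (cases "integrable lborel f")
  case True
  then have [measurable]: "f \<in> borel_measurable borel" by auto
  have "(\<integral>x. f (c *\<^sub>R x) \<partial>lborel) = (\<integral>x. f x \<partial>distr lborel borel (\<lambda>x::'a. c *\<^sub>R x))"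
    by (subst integral_distr) auto
  then show ?thesis by (simp add: distr_lborel_scale[OF c] integral_density)
qed (use c in \<open>simp add: integrable_scale_iff not_integrable_integral_eq\<close>)

lemma L1_loc_scale:
  assumes h: "L1_loc h" and c: "c > 0"
  shows "L1_loc (\<lambda>x. h (c *\<^sub>R x))"
  unfolding L1_loc_def
proof (intro conjI allI impI)
  have [measurable]: "h \<in> borel_measurable borel" using h by (rule L1_locD)
  show "(\<lambda>x. h (c *\<^sub>R x)) \<in> borel_measurable borel" by measurable
  fix K :: "'a set" assume "compact K"
  then have "set_integrable lborel ((*\<^sub>R) c ` K) h" by (intro L1_locD[OF h] compact_scaling)
  from integrable_scale[OF this[unfolded set_integrable_def] c]
  show "set_integrable lborel K (\<lambda>x. h (c *\<^sub>R x))"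
    unfolding set_integrable_def
    by (rule Bochner_Integration.integrable_cong[THEN iffD1, rotated -1]) (use c in \<open>auto simp: indicator_def\<close>)
qed

lemma L1_loc_diff: "L1_loc f \<Longrightarrow> L1_loc g \<Longrightarrow> L1_loc (\<lambda>x. f x - g x)"
  by (auto simp: L1_loc_def)

lemma L1_loc_scaleR: "L1_loc f \<Longrightarrow> L1_loc (\<lambda>x. c *\<^sub>R f x)"
  by (auto simp: L1_loc_def)

lemma L1_loc_inner:
  assumes "L1_loc g" shows "L1_loc (\<lambda>x. g x \<bullet> b)"
  unfolding L1_loc_def
proof (intro conjI allI impI)
  show "(\<lambda>x. g x \<bullet> b) \<in> borel_measurable borel" using L1_locD(1)[OF assms] by simp
  fix K :: "'a set" assume "compact K"
  from integrable_inner_left[OF L1_locD(2)[OF assms this, unfolded set_integrable_def], of b]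
  show "set_integrable lborel K (\<lambda>x. g x \<bullet> b)" by (simp add: set_integrable_def)
qed


text \<open>
  A test function and its partial derivatives vanish outside a common ball and have a common
  bound.
\<close>

lemma test_funE:
  fixes \<phi> :: "'a::euclidean_space \<Rightarrow> real"
  assumes "test_fun \<phi>"
  obtains R B where "R > 0" "B \<ge> 0"
    "\<And>x. norm x > R \<Longrightarrow> \<phi> x = 0" "\<And>x b. norm x > R \<Longrightarrow> frechet_derivative \<phi> (at x) b = 0"
    "\<And>x. \<bar>\<phi> x\<bar> \<le> B" "\<And>x b. b \<in> Basis \<Longrightarrow> \<bar>frechet_derivative \<phi> (at x) b\<bar> \<le> B"
proof -
  obtain K where K: "compact K" "\<And>x. x \<notin> K \<Longrightarrow> \<phi> x = 0" and C: "\<And>k. C_k k \<phi>"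
    using assms by (auto simp: test_fun_def)
  obtain R where R: "R > 0" "\<And>x. x \<in> K \<Longrightarrow> norm x \<le> R"
    using compact_imp_bounded[OF K(1)] unfolding bounded_pos by blast
  have z: "\<phi> x = 0" if "norm x > R" for x using that K R by force
  have dz: "frechet_derivative \<phi> (at x) = (\<lambda>_. 0)" if "norm x > R" for x
  proof -
    have "open {x::'a. norm x > R}" by (intro open_Collect_less continuous_intros)
    then have "(\<phi> has_derivative (\<lambda>_. 0)) (at x)"
      using that z by (intro has_derivative_transform_within_open[OF has_derivative_const[of 0], of "{x. norm x > R}"]) auto
    then show ?thesis by (rule frechet_derivative_at[symmetric])
  qed
  have bd: "\<exists>B. \<forall>x. \<bar>f x\<bar> \<le> B" if "continuous_on UNIV f" "\<And>x. norm x > R \<Longrightarrow> f x = 0" for f :: "'a \<Rightarrow> real"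
  proof -
    have "bounded (f ` cball 0 R)"
      using that(1) by (intro compact_imp_bounded compact_continuous_image compact_cball) (rule continuous_on_subset, auto)
    then obtain B where B: "B > 0" "\<forall>x\<in>cball 0 R. \<bar>f x\<bar> \<le> B"
      unfolding bounded_pos by auto
    then have "\<bar>f x\<bar> \<le> B" for x using that(2)[of x] by (cases "norm x > R") auto
    then show ?thesis by blast
  qed
  obtain B0 where B0: "\<And>x. \<bar>\<phi> x\<bar> \<le> B0" using bd[of \<phi>] z C[of 0] by auto
  have "\<forall>b\<in>Basis. \<exists>B. \<forall>x. \<bar>frechet_derivative \<phi> (at x) b\<bar> \<le> B"
    using C[of 1] dz by (auto intro!: bd)
  then obtain Bf where Bf: "\<And>b x. b \<in> Basis \<Longrightarrow> \<bar>frechet_derivative \<phi> (at x) b\<bar> \<le> Bf b" by metis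
  define B where "B = \<bar>B0\<bar> + (\<Sum>b\<in>(Basis::'a set). \<bar>Bf b\<bar>)"
  have B1: "\<bar>Bf b\<bar> \<le> (\<Sum>b\<in>(Basis::'a set). \<bar>Bf b\<bar>)" if "b \<in> Basis" for b
    by (rule member_le_sum) (use that in auto)
  have S0: "0 \<le> (\<Sum>b\<in>(Basis::'a set). \<bar>Bf b\<bar>)" by (intro sum_nonneg) auto
  show ?thesis
  proof (rule that[of R B])
    fix x show "\<bar>\<phi> x\<bar> \<le> B" unfolding B_def using B0[of x] S0 by linarith
    fix b :: 'a assume "b \<in> Basis"
    then show "\<bar>frechet_derivative \<phi> (at x) b\<bar> \<le> B" unfolding B_def using Bf[of b x] B1[of b] by linarith
  qed (use R z dz S0 in \<open>auto simp: B_def\<close>)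
qed

lemma test_fun_derivative:
  assumes "test_fun \<phi>"
  shows "(\<phi> has_derivative frechet_derivative \<phi> (at x)) (at x)"
    and "linear (frechet_derivative \<phi> (at x))"
    and "continuous_on UNIV \<phi>"
    and "b \<in> Basis \<Longrightarrow> continuous_on UNIV (\<lambda>x. frechet_derivative \<phi> (at x) b)"
    and "\<phi> \<in> borel_measurable borel"
    and "b \<in> Basis \<Longrightarrow> (\<lambda>x. frechet_derivative \<phi> (at x) b) \<in> borel_measurable borel"
proof -
  have C: "C_k k \<phi>" for k using assms by (simp add: test_fun_def)
  show 1: "(\<phi> has_derivative frechet_derivative \<phi> (at x)) (at x)"
    using C[of "Suc 0"] by (rule C_k_SucD)
  show "linear (frechet_derivative \<phi> (at x))" by (rule has_derivative_linear[OF 1])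
  show 2: "continuous_on UNIV \<phi>" using C[of 0] by simp
  show 3: "b \<in> Basis \<Longrightarrow> continuous_on UNIV (\<lambda>x. frechet_derivative \<phi> (at x) b)"
    using C[of "Suc 0"] by simp
  show "\<phi> \<in> borel_measurable borel" using 2 by (rule borel_measurable_continuous_onI)
  show "b \<in> Basis \<Longrightarrow> (\<lambda>x. frechet_derivative \<phi> (at x) b) \<in> borel_measurable borel"
    using 3 by (rule borel_measurable_continuous_onI)
qed

lemma test_fun_scale:
  fixes \<phi> :: "'a::euclidean_space \<Rightarrow> real"
  assumes \<phi>: "test_fun \<phi>" and c: "c \<noteq> 0"
  shows "test_fun (\<lambda>x. \<phi> (c *\<^sub>R x))"
    and "frechet_derivative (\<lambda>x. \<phi> (c *\<^sub>R x)) (at x) b = c * frechet_derivative \<phi> (at (c *\<^sub>R x)) b"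
proof -
  obtain K where K: "compact K" "\<And>x. x \<notin> K \<Longrightarrow> \<phi> x = 0" 
    using \<phi> by (auto simp: test_fun_def)
  show "test_fun (\<lambda>x. \<phi> (c *\<^sub>R x))"
    unfolding test_fun_def
  proof (intro conjI allI exI impI)
    show "C_k k (\<lambda>x. \<phi> (c *\<^sub>R x))" for k using \<phi> by (intro C_k_scale) (simp add: test_fun_def)
    show "compact ((*\<^sub>R) (1 / c) ` K)" using K(1) by (rule compact_scaling)
    fix x assume x: "x \<notin> (*\<^sub>R) (1 / c) ` K"
    have "c *\<^sub>R x \<notin> K"
    proof
      assume "c *\<^sub>R x \<in> K"
      then have "(1 / c) *\<^sub>R (c *\<^sub>R x) \<in> (*\<^sub>R) (1 / c) ` K" by blast
      then show False using x c by simp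
    qed
    then show "\<phi> (c *\<^sub>R x) = 0" by (rule K(2))
  qed
  have "((\<lambda>x. c *\<^sub>R x) has_derivative (\<lambda>h. c *\<^sub>R h)) (at x)"
    by (auto intro!: derivative_eq_intros)
  from has_derivative_compose[OF this test_fun_derivative(1)[OF \<phi>]]
  have "frechet_derivative (\<lambda>x. \<phi> (c *\<^sub>R x)) (at x) = (\<lambda>h. frechet_derivative \<phi> (at (c *\<^sub>R x)) (c *\<^sub>R h))"
    by (rule frechet_derivative_at[symmetric])
  then show "frechet_derivative (\<lambda>x. \<phi> (c *\<^sub>R x)) (at x) b = c * frechet_derivative \<phi> (at (c *\<^sub>R x)) b"
    using linear_scale[OF test_fun_derivative(2)[OF \<phi>]] by simp
qed

lemma test_fun_coordinate:
  fixes \<phi> :: "'a::euclidean_space \<Rightarrow> real"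
  assumes \<phi>: "test_fun \<phi>"
  shows "test_fun (\<lambda>x. (x \<bullet> b) * \<phi> x)"
    and "frechet_derivative (\<lambda>x. (x \<bullet> b) * \<phi> x) (at x) h = (h \<bullet> b) * \<phi> x + (x \<bullet> b) * frechet_derivative \<phi> (at x) h"
proof -
  show "test_fun (\<lambda>x. (x \<bullet> b) * \<phi> x)"
    using \<phi> by (auto simp: test_fun_def intro!: C_k_mult C_k_inner)
  have "((\<lambda>x. x \<bullet> b) has_derivative (\<lambda>h. h \<bullet> b)) (at x)" by (auto intro!: derivative_eq_intros)
  from frechet_derivative_at[symmetric, OF has_derivative_mult[OF this test_fun_derivative(1)[OF \<phi>]]]
  show "frechet_derivative (\<lambda>x. (x \<bullet> b) * \<phi> x) (at x) h = (h \<bullet> b) * \<phi> x + (x \<bullet> b) * frechet_derivative \<phi> (at x) h"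
    by (simp add: algebra_simps)
qed

lemma L1_loc_integrable_test:
  fixes h :: "'a::euclidean_space \<Rightarrow> real"
  assumes "L1_loc h" "test_fun \<phi>"
  shows "integrable lborel (\<lambda>x. h x * \<phi> x)"
    and "b \<in> Basis \<Longrightarrow> integrable lborel (\<lambda>x. h x * frechet_derivative \<phi> (at x) b)"
proof -
  obtain R B where B: "R > 0" "B \<ge> 0"
    "\<And>x. norm x > R \<Longrightarrow> \<phi> x = 0" "\<And>x b. norm x > R \<Longrightarrow> frechet_derivative \<phi> (at x) b = 0"
    "\<And>x. \<bar>\<phi> x\<bar> \<le> B" "\<And>x b. b \<in> Basis \<Longrightarrow> \<bar>frechet_derivative \<phi> (at x) b\<bar> \<le> B"
    using test_funE[OF assms(2)] by blast
  show "integrable lborel (\<lambda>x. h x * \<phi> x)"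
    by (rule L1_loc_integrable_mult[OF assms(1) test_fun_derivative(5)[OF assms(2)] compact_cball[of 0 R] _ B(5)])
       (use B(3) in auto)
  show "integrable lborel (\<lambda>x. h x * frechet_derivative \<phi> (at x) b)" if b: "b \<in> Basis"
    by (rule L1_loc_integrable_mult[OF assms(1) test_fun_derivative(6)[OF assms(2) b] compact_cball[of 0 R] _ B(6)[OF b]])
       (use B(4) in auto)
qed


lemma has_weak_gradientD:
  assumes "has_weak_gradient u g"
  shows "L1_loc u" "L1_loc g"
    "test_fun \<phi> \<Longrightarrow> b \<in> Basis \<Longrightarrow>
      (\<integral>x. u x * frechet_derivative \<phi> (at x) b \<partial>lborel) = - (\<integral>x. (g x \<bullet> b) * \<phi> x \<partial>lborel)"
  using assms by (auto simp: has_weak_gradient_def)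

lemma weak_gradient_unique:
  fixes u :: "'a::euclidean_space \<Rightarrow> real"
  assumes g: "has_weak_gradient u g" and g': "has_weak_gradient u g'"
  shows "AE x in lborel. g x = g' x"
proof -
  have "AE x in lborel. g x \<bullet> b - g' x \<bullet> b = 0" if b: "b \<in> Basis" for b
  proof (rule fundamental_lemma)
    note L = has_weak_gradientD(2)[OF g] has_weak_gradientD(2)[OF g']
    show "L1_loc (\<lambda>x. g x \<bullet> b - g' x \<bullet> b)" using L by (intro L1_loc_diff L1_loc_inner)
    fix \<phi> :: "'a \<Rightarrow> real" assume \<phi>: "test_fun \<phi>"
    show "(\<integral>x. (g x \<bullet> b - g' x \<bullet> b) * \<phi> x \<partial>lborel) = 0"
      using has_weak_gradientD(3)[OF g \<phi> b] has_weak_gradientD(3)[OF g' \<phi> b]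
        L1_loc_integrable_test(1)[OF L1_loc_inner[OF L(1)] \<phi>, of b]
        L1_loc_integrable_test(1)[OF L1_loc_inner[OF L(2)] \<phi>, of b]
      by (simp add: left_diff_distrib)
  qed
  then have "AE x in lborel. \<forall>b\<in>Basis. g x \<bullet> b - g' x \<bullet> b = 0"
    by (subst AE_finite_all) auto
  then show ?thesis by eventually_elim (auto intro: euclidean_eqI)
qed

lemma weak_grad_works: "weakly_differentiable u \<Longrightarrow> has_weak_gradient u (weak_grad u)"
  unfolding weakly_differentiable_def weak_grad_def by (rule someI_ex[of "has_weak_gradient u"])

lemma has_weak_gradient_scale:
  fixes u :: "'a::euclidean_space \<Rightarrow> real"
  assumes g: "has_weak_gradient u g" and c: "c > 0"
  shows "has_weak_gradient (\<lambda>x. u (c *\<^sub>R x)) (\<lambda>x. c *\<^sub>R g (c *\<^sub>R x))"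
  unfolding has_weak_gradient_def
proof (intro conjI allI impI ballI)
  show "L1_loc (\<lambda>x. u (c *\<^sub>R x))" "L1_loc (\<lambda>x. c *\<^sub>R g (c *\<^sub>R x))"
    using has_weak_gradientD[OF g] c by (auto intro!: L1_loc_scale L1_loc_scaleR)
  fix \<phi> :: "'a \<Rightarrow> real" and b :: 'a assume \<phi>: "test_fun \<phi>" and b: "b \<in> Basis"
  let ?\<psi> = "\<lambda>x. \<phi> ((1 / c) *\<^sub>R x)"
  have \<psi>: "test_fun ?\<psi>" and d: "frechet_derivative ?\<psi> (at (c *\<^sub>R x)) b = (1 / c) * frechet_derivative \<phi> (at x) b" for x
    using test_fun_scale[OF \<phi>, of "1 / c"] c by auto
  have "(\<integral>x. u (c *\<^sub>R x) * frechet_derivative ?\<psi> (at (c *\<^sub>R x)) b \<partial>lborel)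
      = - (\<integral>x. (g (c *\<^sub>R x) \<bullet> b) * ?\<psi> (c *\<^sub>R x) \<partial>lborel)"
    using has_weak_gradientD(3)[OF g \<psi> b] 
      integral_scale[OF c, of "\<lambda>x. u x * frechet_derivative ?\<psi> (at x) b"]
      integral_scale[OF c, of "\<lambda>x. (g x \<bullet> b) * ?\<psi> x"] by simp
  then show "(\<integral>x. u (c *\<^sub>R x) * frechet_derivative \<phi> (at x) b \<partial>lborel) 
      = - (\<integral>x. (c *\<^sub>R g (c *\<^sub>R x) \<bullet> b) * \<phi> x \<partial>lborel)"
    unfolding d using c by (simp add: field_simps)
qed

lemma weak_grad_scale:
  fixes u :: "'a::euclidean_space \<Rightarrow> real"
  assumes "weakly_differentiable u" and c: "c > 0"
  shows "weakly_differentiable (\<lambda>x. u (c *\<^sub>R x))"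
    and "AE x in lborel. weak_grad (\<lambda>x. u (c *\<^sub>R x)) x = c *\<^sub>R weak_grad u (c *\<^sub>R x)"
proof -
  note g = has_weak_gradient_scale[OF weak_grad_works[OF assms(1)] c]
  then show "weakly_differentiable (\<lambda>x. u (c *\<^sub>R x))" unfolding weakly_differentiable_def by blast
  from weak_gradient_unique[OF weak_grad_works[OF this] g]
  show "AE x in lborel. weak_grad (\<lambda>x. u (c *\<^sub>R x)) x = c *\<^sub>R weak_grad u (c *\<^sub>R x)" .
qed

section \<open>Weak gradients along rays\<close>

lemma measurable_lborel_pair_iff:
  fixes f :: "'a::euclidean_space \<times> 'b::euclidean_space \<Rightarrow> 'c"
  shows "f \<in> measurable (lborel \<Otimes>\<^sub>M lborel) N \<longleftrightarrow> f \<in> measurable (borel \<Otimes>\<^sub>M borel) N"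
proof -
  have "sets (lborel \<Otimes>\<^sub>M lborel :: ('a \<times> 'b) measure) = sets (borel \<Otimes>\<^sub>M borel)" by (intro sets_pair_measure_cong) auto
  then show ?thesis by (metis measurable_cong_sets)
qed

text \<open>
  The integral of the derivative of \<open>t \<mapsto> u (t x)\<close> over \<open>{1..c}\<close>, if \<open>g\<close> is the gradient of \<open>u\<close>.
\<close>

definition ray_integral :: "('a::euclidean_space \<Rightarrow> 'a) \<Rightarrow> real \<Rightarrow> 'a \<Rightarrow> real" where
  "ray_integral g c x = (\<integral>t. indicator {1..c} t * (x \<bullet> g (t *\<^sub>R x)) \<partial>lborel)"

lemma ray_integrable:
  fixes g :: "'a::euclidean_space \<Rightarrow> 'a"
  assumes g: "L1_loc g" and R: "R > 0"
  shows "integrable (lborel \<Otimes>\<^sub>M lborel)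
    (\<lambda>(x, t). indicator (cball 0 R) x * (indicator {1..c} t * (x \<bullet> g (t *\<^sub>R x))))"
  (is "integrable _ ?H")
proof -
  have [measurable]: "g \<in> borel_measurable borel" using g by (rule L1_locD)
  have [measurable]: "cball (0::'a) r \<in> sets borel" for r by auto
  have "integrable lborel (\<lambda>x. indicator (cball 0 (R * c)) x *\<^sub>R g x)"
    using L1_locD(2)[OF g compact_cball[of 0 "R * c"]] by (simp add: set_integrable_def)
  then obtain M where M: "(\<integral>\<^sup>+x. ennreal (norm (indicator (cball 0 (R * c)) x *\<^sub>R g x)) \<partial>lborel) = ennreal M"
    unfolding integrable_iff_bounded by (auto simp: less_top_ennreal)
  have H[measurable]: "?H \<in> borel_measurable (lborel \<Otimes>\<^sub>M lborel)"
  proof -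
    have [measurable]: "cball (0::'a) R \<in> sets borel" "{1..c} \<in> sets borel" by auto
    show ?thesis unfolding measurable_lborel_pair_iff case_prod_beta by measurable
  qed
  have "(\<integral>\<^sup>+z. ennreal (norm (?H z)) \<partial>(lborel \<Otimes>\<^sub>M lborel)) 
      = (\<integral>\<^sup>+t. (\<integral>\<^sup>+x. ennreal (norm (?H (x, t))) \<partial>lborel) \<partial>lborel)"
    by (subst lborel_pair.nn_integral_snd[symmetric]) auto
  also have "\<dots> \<le> (\<integral>\<^sup>+t. ennreal (R * M) * indicator {1..c} t \<partial>lborel)"
  proof (rule nn_integral_mono)
    fix t :: real
    show "(\<integral>\<^sup>+x. ennreal (norm (?H (x, t))) \<partial>lborel) \<le> ennreal (R * M) * indicator {1..c} t"
    proof (cases "t \<in> {1..c}")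
      case True
      have "(\<integral>\<^sup>+x. ennreal (norm (?H (x, t))) \<partial>lborel) 
          \<le> (\<integral>\<^sup>+x. ennreal R * ennreal (norm (indicator (cball 0 (R * c)) (t *\<^sub>R x) *\<^sub>R g (t *\<^sub>R x))) \<partial>lborel)"
      proof (rule nn_integral_mono)
        fix x :: 'a
        show "ennreal (norm (?H (x, t))) \<le> ennreal R * ennreal (norm (indicator (cball 0 (R * c)) (t *\<^sub>R x) *\<^sub>R g (t *\<^sub>R x)))"
        proof (cases "norm x \<le> R")
          case True
          have "t * norm x \<le> c * R" using True \<open>t \<in> {1..c}\<close> R by (intro mult_mono) auto
          moreover have "\<bar>x \<bullet> g (t *\<^sub>R x)\<bar> \<le> R * norm (g (t *\<^sub>R x))"
            using Cauchy_Schwarz_ineq2[of x "g (t *\<^sub>R x)"] True 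
            by (meson mult_right_mono norm_ge_zero order_trans)
          ultimately show ?thesis using True \<open>t \<in> {1..c}\<close> R
            by (simp add: ennreal_mult[symmetric] mult.commute)
        qed simp
      qed
      also have "\<dots> = ennreal R * (ennreal (t powr - real DIM('a)) * ennreal M)"
      proof -
        have "(\<lambda>x. ennreal (norm (indicator (cball 0 (R * c)) x *\<^sub>R g x))) \<in> borel_measurable borel"
          using \<open>g \<in> borel_measurable borel\<close>
          by measurable
        from nn_integral_scale[OF this, of t] True M
        show ?thesis by (subst nn_integral_cmult) auto
      qed
      also have "\<dots> \<le> ennreal R * (1 * ennreal M)"
      proof -
        have "t powr - real DIM('a) \<le> 1"
          using True powr_mono[of "- real DIM('a)" 0 t] by auto
        then show ?thesis by (intro mult_left_mono mult_right_mono) (simp_all add: ennreal_le_1)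
      qed
      also have "\<dots> = ennreal (R * M) * indicator {1..c} t"
        using True R by (simp add: ennreal_mult')
      finally show ?thesis .
    qed simp
  qed
  also have "\<dots> < \<infinity>"
    by (simp add: nn_integral_cmult ennreal_mult_less_top emeasure_lborel_Icc_eq)
  finally show ?thesis by (subst integrable_iff_bounded) auto
qed

lemma ray_integral_measurable[measurable]:
  assumes [measurable]: "g \<in> borel_measurable borel"
  shows "(\<lambda>(c, x). ray_integral g c x) \<in> borel_measurable (borel \<Otimes>\<^sub>M borel)"
    "ray_integral g c \<in> borel_measurable borel"
proof -
  have "(\<lambda>p. if 1 \<le> snd p \<and> snd p \<le> fst (fst p) then snd (fst p) \<bullet> g (snd p *\<^sub>R snd (fst p)) else 0)
      \<in> borel_measurable ((borel \<Otimes>\<^sub>M borel) \<Otimes>\<^sub>M lborel)"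
    by measurable
  also have "(\<lambda>p. if 1 \<le> snd p \<and> snd p \<le> fst (fst p) then snd (fst p) \<bullet> g (snd p *\<^sub>R snd (fst p)) else 0)
      = (\<lambda>(p, t). indicator {1..fst p} t * (snd p \<bullet> g (t *\<^sub>R snd p)))"
    by (auto simp: indicator_def)
  finally have "(\<lambda>(p, t). indicator {1..fst p} t * (snd p \<bullet> g (t *\<^sub>R snd p)))
      \<in> borel_measurable ((borel \<Otimes>\<^sub>M borel) \<Otimes>\<^sub>M lborel)" .
  from lborel.borel_measurable_lebesgue_integral[OF this]
  show *: "(\<lambda>(c, x). ray_integral g c x) \<in> borel_measurable (borel \<Otimes>\<^sub>M borel)"
    by (simp add: ray_integral_def case_prod_beta)
  from measurable_compose[OF measurable_Pair1' *, of c]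
  show "ray_integral g c \<in> borel_measurable borel" by simp
qed

lemma L1_loc_ray_integral:
  fixes g :: "'a::euclidean_space \<Rightarrow> 'a"
  assumes g: "L1_loc g"
  shows "L1_loc (ray_integral g c)"
  unfolding L1_loc_def
proof (intro conjI allI impI)
  have [measurable]: "g \<in> borel_measurable borel" using g by (rule L1_locD)
  show "ray_integral g c \<in> borel_measurable borel" by measurable
  fix K :: "'a set" assume K: "compact K"
  then have [measurable]: "K \<in> sets borel" by (intro borel_compact)
  obtain R where R: "R > 0" "\<And>x. x \<in> K \<Longrightarrow> norm x \<le> R"
    using compact_imp_bounded[OF K(1)] unfolding bounded_pos by blast
  have "integrable lborel (\<lambda>x. indicator (cball 0 R) x * ray_integral g c x)"
    using lborel_pair.integrable_fst[OF ray_integrable[OF g R(1), of c]]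
    by (simp add: ray_integral_def)
  then have "set_integrable lborel (cball 0 R) (ray_integral g c)" by (simp add: set_integrable_def)
  then show "set_integrable lborel K (ray_integral g c)"
    by (rule set_integrable_subset) (use R in auto)
qed

text \<open>
  The derivative in \<open>t\<close> of the rescaled test function is the divergence of the test vector field
  \<open>y \<mapsto> y \<phi> (y / t)\<close>, up to a power of \<open>t\<close>. This is how dilations of \<open>u\<close> are linked to the weak
  gradient.
\<close>

lemma radial_test_derivative:
  fixes \<phi> :: "'a::euclidean_space \<Rightarrow> real"
  assumes \<phi>: "test_fun \<phi>" and t: "t > 0"
  shows "((\<lambda>t. t powr - real DIM('a) * \<phi> ((1 / t) *\<^sub>R x)) has_real_derivative
     - (t powr (- real DIM('a) - 1) * (\<Sum>b\<in>Basis. frechet_derivative (\<lambda>y. (y \<bullet> b) * \<phi> ((1 / t) *\<^sub>R y)) (at x) b))) (at t)"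
proof -
  let ?D = "\<lambda>b. frechet_derivative \<phi> (at ((1 / t) *\<^sub>R x)) b"
  have "((\<lambda>t. (1 / t) *\<^sub>R x) has_derivative (\<lambda>h. (- h / t\<^sup>2) *\<^sub>R x)) (at t)"
    using t by (auto intro!: derivative_eq_intros simp: power2_eq_square field_simps)
  from has_derivative_compose[OF this test_fun_derivative(1)[OF \<phi>]]
  have 1: "((\<lambda>t. \<phi> ((1 / t) *\<^sub>R x)) has_derivative (\<lambda>h. h * (- 1 / t\<^sup>2 * ?D x))) (at t)"
    unfolding linear_scale[OF test_fun_derivative(2)[OF \<phi>]] by simp
  have 2: "((\<lambda>t. \<phi> ((1 / t) *\<^sub>R x)) has_real_derivative - 1 / t\<^sup>2 * ?D x) (at t)"
    unfolding has_field_derivative_def by (rule has_derivative_eq_rhs[OF 1]) (simp add: fun_eq_iff)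
  have 3: "((\<lambda>t. t powr - real DIM('a)) has_real_derivative - real DIM('a) * t powr (- real DIM('a) - 1)) (at t)"
    using has_real_derivative_powr[OF t, of "- real DIM('a)"] by simp
  have "?D x = ?D (\<Sum>b\<in>Basis. (x \<bullet> b) *\<^sub>R b)" by (simp add: euclidean_representation)
  also have "\<dots> = (\<Sum>b\<in>Basis. (x \<bullet> b) * ?D b)"
    by (simp add: linear_sum[OF test_fun_derivative(2)[OF \<phi>]] linear_scale[OF test_fun_derivative(2)[OF \<phi>]])
  finally have 4: "?D x = (\<Sum>b\<in>Basis. (x \<bullet> b) * ?D b)" .
  have 5: "(\<Sum>b\<in>Basis. frechet_derivative (\<lambda>y. (y \<bullet> b) * \<phi> ((1 / t) *\<^sub>R y)) (at x) b)
     = real DIM('a) * \<phi> ((1 / t) *\<^sub>R x) + 1 / t * ?D x"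
    using t
    by (simp add: test_fun_coordinate(2)[OF test_fun_scale(1)[OF \<phi>]] test_fun_scale(2)[OF \<phi>] sum.distrib 4
        sum_divide_distrib)
  have 6: "t powr - real DIM('a) = t * t powr (- real DIM('a) - 1)"
    using t by (simp add: powr_diff)
  show ?thesis
    by (rule DERIV_cong[OF DERIV_mult[OF 3 2]])
       (unfold 5 6, use t in \<open>simp add: field_simps power2_eq_square\<close>)
qed

text \<open>
  A weakly differentiable function satisfies the fundamental theorem of calculus along almost every
  ray. Against a test function, \<open>u (c x) - u x\<close> becomes by substitution the integral of \<open>u\<close> times
  a difference of rescaled test functions; that difference is an integral of divergences, and the
  definition of the weak gradient applies to each of them. All exchanges of integrals take place on
  compact sets.
\<close>

theorem weak_gradient_along_rays:
  fixes u :: "'a::euclidean_space \<Rightarrow> real"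
  assumes ug: "has_weak_gradient u g" and c: "c > 1"
  shows "AE x in lborel. u (c *\<^sub>R x) - u x = ray_integral g c x"
proof -
  note L = has_weak_gradientD(1,2)[OF ug]
  have [measurable]: "u \<in> borel_measurable borel" "g \<in> borel_measurable borel"
    using L by (auto dest: L1_locD)
  have [measurable]: "cball (0::'a) r \<in> sets borel" for r by auto
  let ?N = "real DIM('a)"
  have "AE x in lborel. u (c *\<^sub>R x) - u x - ray_integral g c x = 0"
  proof (rule fundamental_lemma)
    show "L1_loc (\<lambda>x. u (c *\<^sub>R x) - u x - ray_integral g c x)"
      using c by (intro L1_loc_diff L1_loc_scale L L1_loc_ray_integral) auto
    fix \<phi> :: "'a \<Rightarrow> real" assume \<phi>: "test_fun \<phi>"
    note [measurable] = test_fun_derivative(5)[OF \<phi>]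
    obtain R B where B: "R > 0" "B \<ge> 0"
      "\<And>x. norm x > R \<Longrightarrow> \<phi> x = 0" "\<And>x b. norm x > R \<Longrightarrow> frechet_derivative \<phi> (at x) b = 0"
      "\<And>x. \<bar>\<phi> x\<bar> \<le> B" "\<And>x b. b \<in> Basis \<Longrightarrow> \<bar>frechet_derivative \<phi> (at x) b\<bar> \<le> B"
      using test_funE[OF \<phi>] by blast
    define M where "M t x = t powr (- ?N - 1) *
      (\<Sum>b\<in>Basis. frechet_derivative (\<lambda>y. (y \<bullet> b) * \<phi> ((1 / t) *\<^sub>R y)) (at x) b)" for t x
    have Meq: "M t x = t powr (- ?N - 1) *
      (\<Sum>b\<in>Basis. \<phi> ((1 / t) *\<^sub>R x) + (x \<bullet> b) * (1 / t * frechet_derivative \<phi> (at ((1 / t) *\<^sub>R x)) b))"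
      if "t > 0" for t x
      using that test_fun_scale[OF \<phi>, of "1 / t"] by (simp add: M_def test_fun_coordinate)
    have Mmeas[measurable]: "(\<lambda>(x, t). indicator {1..c} t * M t x) \<in> borel_measurable (borel \<Otimes>\<^sub>M borel)"
    proof -
      note [measurable] = test_fun_derivative(6)[OF \<phi>]
      have "(\<lambda>(x, t). indicator {1..c} t * (t powr (- ?N - 1) *
      (\<Sum>b\<in>Basis. \<phi> ((1 / t) *\<^sub>R x) + (x \<bullet> b) * (1 / t * frechet_derivative \<phi> (at ((1 / t) *\<^sub>R x)) b))))
        \<in> borel_measurable (borel \<Otimes>\<^sub>M borel)"
        by measurable
      then show ?thesis
        by (rule measurable_cong[THEN iffD1, rotated]) (auto simp: indicator_def Meq)
    qed
    define C where "C = ?N * (B + R * c * B)"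
    have C0: "C \<ge> 0" using B c by (simp add: C_def)
    have Mb: "\<bar>M t x\<bar> \<le> C * indicator (cball 0 (R * c)) x" if t: "t \<in> {1..c}" for t x
    proof (cases "norm ((1 / t) *\<^sub>R x) > R")
      case True
      then show ?thesis using t C0 by (simp add: Meq B(3,4) del: norm_scaleR)
    next
      case False
      have x: "norm x \<le> R * c"
      proof -
        have "norm x \<le> R * t" using False t by (simp add: field_simps)
        also have "\<dots> \<le> R * c" using t B by (intro mult_left_mono) auto
        finally show ?thesis .
      qed
      have "\<bar>\<phi> ((1 / t) *\<^sub>R x) + (x \<bullet> b) * (1 / t * frechet_derivative \<phi> (at ((1 / t) *\<^sub>R x)) b)\<bar> \<le> B + R * c * B"
        if b: "b \<in> Basis" for b
      proof -
        have "\<bar>1 / t * frechet_derivative \<phi> (at ((1 / t) *\<^sub>R x)) b\<bar> \<le> 1 * B"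
          unfolding abs_mult using t B b by (intro mult_mono) auto
        moreover have "\<bar>x \<bullet> b\<bar> \<le> R * c" using Basis_le_norm[OF b, of x] x by simp
        ultimately have "\<bar>(x \<bullet> b) * (1 / t * frechet_derivative \<phi> (at ((1 / t) *\<^sub>R x)) b)\<bar> \<le> R * c * B"
          unfolding abs_mult[of "x \<bullet> b"] using B c by (intro mult_mono) auto
        then show ?thesis using B(5)[of "(1 / t) *\<^sub>R x"] by linarith
      qed
      then have "\<bar>\<Sum>b\<in>Basis. \<phi> ((1 / t) *\<^sub>R x) + (x \<bullet> b) * (1 / t * frechet_derivative \<phi> (at ((1 / t) *\<^sub>R x)) b)\<bar>
          \<le> (\<Sum>b\<in>(Basis::'a set). B + R * c * B)" by (intro order_trans[OF sum_abs] sum_mono)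
      then have "\<bar>\<Sum>b\<in>Basis. \<phi> ((1 / t) *\<^sub>R x) + (x \<bullet> b) * (1 / t * frechet_derivative \<phi> (at ((1 / t) *\<^sub>R x)) b)\<bar> \<le> C"
        by (simp add: C_def)
      moreover have "t powr (- ?N - 1) \<le> 1" using t powr_mono[of "- ?N - 1" 0 t] by auto
      ultimately have "\<bar>M t x\<bar> \<le> 1 * C"
      proof -
        assume *: "\<bar>\<Sum>b\<in>Basis. \<phi> ((1 / t) *\<^sub>R x) + (x \<bullet> b) * (1 / t * frechet_derivative \<phi> (at ((1 / t) *\<^sub>R x)) b)\<bar> \<le> C"
          and **: "t powr (- ?N - 1) \<le> 1"
        have "t > 0" using t by simp
        show "\<bar>M t x\<bar> \<le> 1 * C"
          unfolding Meq[OF \<open>t > 0\<close>] abs_mult by (rule mult_mono) (use * ** C0 in auto)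
      qed
      then show ?thesis using x by simp
    qed
    \<comment> \<open>The difference of rescaled test functions as an integral of divergences.\<close>
    have FTC: "(\<integral>t. indicator {1..c} t * M t x \<partial>lborel) = \<phi> x - c powr - ?N * \<phi> ((1 / c) *\<^sub>R x)" for x
    proof -
      have "continuous_on {0<..} (\<lambda>t. t powr (- ?N - 1) *
        (\<Sum>b\<in>Basis. \<phi> ((1 / t) *\<^sub>R x) + (x \<bullet> b) * (1 / t * frechet_derivative \<phi> (at ((1 / t) *\<^sub>R x)) b)))"
        by (intro continuous_intros continuous_on_compose2[OF test_fun_derivative(3)[OF \<phi>]]
            continuous_on_compose2[OF test_fun_derivative(4)[OF \<phi>]]) auto
      then have "continuous_on {0<..} (\<lambda>t. M t x)"
        by (rule continuous_on_cong[THEN iffD1, rotated -1]) (auto simp: Meq)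
      then have cont: "isCont (\<lambda>t. M t x) t" if "t > 0" for t
        using that by (auto simp: continuous_on_eq_continuous_at)
      have "(\<integral>t. M t x * indicator {1..c} t \<partial>lborel) = (- (c powr - ?N * \<phi> ((1 / c) *\<^sub>R x))) - (- (1 powr - ?N * \<phi> ((1 / 1) *\<^sub>R x)))"
      proof (intro integral_FTC_Icc_real cont)
        fix t assume "1 \<le> t" "t \<le> c"
        then have "t > 0" by simp
        from DERIV_minus[OF radial_test_derivative[OF \<phi> this, of x]]
        show "((\<lambda>t. - (t powr - ?N * \<phi> ((1 / t) *\<^sub>R x))) has_real_derivative M t x) (at t)"
          by (simp add: M_def)
      qed (use c in auto)
      then show ?thesis by (simp add: mult.commute)
    qed
    let ?i = "\<lambda>t. indicator {1..c} t :: real"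
    have intM: "integrable (lborel \<Otimes>\<^sub>M lborel) (\<lambda>(x, t). u x * (?i t * M t x))"
    proof (subst integrable_iff_bounded, intro conjI)
      show meas: "(\<lambda>(x, t). u x * (?i t * M t x)) \<in> borel_measurable (lborel \<Otimes>\<^sub>M lborel)"
        unfolding measurable_lborel_pair_iff case_prod_beta by (use Mmeas in \<open>simp add: case_prod_beta\<close>)
      have "integrable lborel (\<lambda>x. indicator (cball 0 (R * c)) x *\<^sub>R u x)"
        using L1_locD(2)[OF L(1) compact_cball[of 0 "R * c"]] by (simp add: set_integrable_def)
      then have fin: "(\<integral>\<^sup>+x. ennreal (norm (indicator (cball 0 (R * c)) x *\<^sub>R u x)) \<partial>lborel) < \<infinity>"
        by (simp add: integrable_iff_bounded)
      have "(\<integral>\<^sup>+z. ennreal (norm (case z of (x, t) \<Rightarrow> u x * (?i t * M t x))) \<partial>(lborel \<Otimes>\<^sub>M lborel))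
        = (\<integral>\<^sup>+x. (\<integral>\<^sup>+t. ennreal (norm (u x * (?i t * M t x))) \<partial>lborel) \<partial>lborel)"
        using meas by (subst lborel.nn_integral_fst[symmetric]) auto
      also have "\<dots> \<le> (\<integral>\<^sup>+x. (\<integral>\<^sup>+t. ennreal (norm (indicator (cball 0 (R * c)) x *\<^sub>R u x)) * (ennreal C * indicator {1..c} t) \<partial>lborel) \<partial>lborel)"
      proof (intro nn_integral_mono)
        fix x :: 'a and t :: real
        show "ennreal (norm (u x * (?i t * M t x)))
          \<le> ennreal (norm (indicator (cball 0 (R * c)) x *\<^sub>R u x)) * (ennreal C * indicator {1..c} t)"
        proof (cases "t \<in> {1..c}")
          case True
          have "\<bar>u x\<bar> * \<bar>M t x\<bar> \<le> \<bar>u x\<bar> * (C * indicator (cball 0 (R * c)) x)"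
            by (intro mult_left_mono Mb True) auto
          then show ?thesis using True C0
            by (auto simp: abs_mult ennreal_mult[symmetric] indicator_def split: if_splits)
        qed simp
      qed
      also have "\<dots> = (\<integral>\<^sup>+x. ennreal (norm (indicator (cball 0 (R * c)) x *\<^sub>R u x)) \<partial>lborel) * (ennreal C * ennreal (c - 1))"
        using c by (simp add: nn_integral_cmult nn_integral_multc)
      also have "\<dots> < \<infinity>" using fin by (simp add: ennreal_mult_less_top)
      finally show "(\<integral>\<^sup>+z. ennreal (norm (case z of (x, t) \<Rightarrow> u x * (?i t * M t x))) \<partial>(lborel \<Otimes>\<^sub>M lborel)) < \<infinity>" .
    qed
    have intH: "integrable (lborel \<Otimes>\<^sub>M lborel) (\<lambda>(x, t). \<phi> x * (?i t * (x \<bullet> g (t *\<^sub>R x))))"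
    proof (rule Bochner_Integration.integrable_bound)
      show "integrable (lborel \<Otimes>\<^sub>M lborel) (\<lambda>z. B * (case z of (x, t) \<Rightarrow> indicator (cball 0 R) x * (?i t * (x \<bullet> g (t *\<^sub>R x)))))"
        by (intro integrable_mult_right ray_integrable L B)
      have [measurable]: "{1..c} \<in> sets borel" by auto
      show "(\<lambda>(x, t). \<phi> x * (?i t * (x \<bullet> g (t *\<^sub>R x)))) \<in> borel_measurable (lborel \<Otimes>\<^sub>M lborel)"
        unfolding measurable_lborel_pair_iff case_prod_beta by measurable
      have "norm (\<phi> x * h) \<le> norm (B * (indicator (cball 0 R) x * h))" for x and h :: real
        using B(2) B(3)[of x] B(5)[of x] by (cases "norm x > R") (auto simp: abs_mult indicator_def intro!: mult_right_mono)
      then show "AE z in lborel \<Otimes>\<^sub>M lborel. norm (case z of (x, t) \<Rightarrow> \<phi> x * (?i t * (x \<bullet> g (t *\<^sub>R x))))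
         \<le> norm (B * (case z of (x, t) \<Rightarrow> indicator (cball 0 R) x * (?i t * (x \<bullet> g (t *\<^sub>R x)))))"
        by (intro AE_I2) auto
    qed
    \<comment> \<open>The definition of the weak gradient, for the fields \<open>y \<phi> (y / t)\<close>, followed by the substitution \<open>y = t x\<close>.\<close>
    have inner: "(\<integral>x. u x * M t x \<partial>lborel) = - (\<integral>x. \<phi> x * (x \<bullet> g (t *\<^sub>R x)) \<partial>lborel)" if t: "t \<in> {1..c}" for t
    proof -
      have t0: "t > 0" using t by simp
      let ?\<chi> = "\<lambda>b y. (y \<bullet> b) * \<phi> ((1 / t) *\<^sub>R y)"
      have \<chi>: "test_fun (?\<chi> b)" for b using t0 by (intro test_fun_coordinate(1) test_fun_scale(1) \<phi>) auto
      have "(\<integral>x. u x * M t x \<partial>lborel) = (\<integral>x. t powr (- ?N - 1) * (\<Sum>b\<in>Basis. u x * frechet_derivative (?\<chi> b) (at x) b) \<partial>lborel)"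
        by (simp add: M_def sum_distrib_left mult_ac)
      also have "\<dots> = t powr (- ?N - 1) * (\<Sum>b\<in>Basis. \<integral>x. u x * frechet_derivative (?\<chi> b) (at x) b \<partial>lborel)"
        by (subst integral_mult_right_zero, subst Bochner_Integration.integral_sum)
           (auto intro!: L1_loc_integrable_test(2)[OF L(1) \<chi>])
      also have "\<dots> = t powr (- ?N - 1) * (\<Sum>b\<in>Basis. - (\<integral>x. (g x \<bullet> b) * ?\<chi> b x \<partial>lborel))"
        using has_weak_gradientD(3)[OF ug \<chi>] by simp
      also have "\<dots> = - (t powr (- ?N - 1) * (\<integral>x. (\<Sum>b\<in>Basis. (g x \<bullet> b) * ?\<chi> b x) \<partial>lborel))"
        by (subst Bochner_Integration.integral_sum) 
           (auto intro!: L1_loc_integrable_test(1)[OF L1_loc_inner[OF L(2)] \<chi>] simp: sum_negf)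
      also have "(\<lambda>x. \<Sum>b\<in>Basis. (g x \<bullet> b) * ?\<chi> b x) = (\<lambda>x. (x \<bullet> g x) * \<phi> ((1 / t) *\<^sub>R x))"
        by (simp add: euclidean_inner[of _ "g _"] sum_distrib_left mult_ac fun_eq_iff)
      also have "(\<integral>x. (x \<bullet> g x) * \<phi> ((1 / t) *\<^sub>R x) \<partial>lborel) 
          = t powr ?N * (\<integral>x. ((t *\<^sub>R x) \<bullet> g (t *\<^sub>R x)) * \<phi> x \<partial>lborel)"
        using integral_scale[OF t0, of "\<lambda>x. (x \<bullet> g x) * \<phi> ((1 / t) *\<^sub>R x)"] t0
        by (simp add: powr_minus field_simps)
      also have "(\<integral>x. ((t *\<^sub>R x) \<bullet> g (t *\<^sub>R x)) * \<phi> x \<partial>lborel) = t * (\<integral>x. \<phi> x * (x \<bullet> g (t *\<^sub>R x)) \<partial>lborel)"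
        by (subst integral_mult_right_zero[symmetric]) (simp add: mult_ac)
      also have "t powr (- ?N - 1) * (t powr ?N * (t * I)) = I" for I
        using t0 by (simp add: powr_diff powr_minus field_simps)
      finally show ?thesis .
    qed
    have i1: "integrable lborel (\<lambda>x. u (c *\<^sub>R x) * \<phi> x)" and i2: "integrable lborel (\<lambda>x. u x * \<phi> x)" 
      and i3: "integrable lborel (\<lambda>x. ray_integral g c x * \<phi> x)"
      and i4: "integrable lborel (\<lambda>x. u x * \<phi> ((1 / c) *\<^sub>R x))"
      using c by (auto intro!: L1_loc_integrable_test \<phi> L1_loc_scale L L1_loc_ray_integral test_fun_scale)
    have "(\<integral>x. u (c *\<^sub>R x) * \<phi> x \<partial>lborel) - (\<integral>x. u x * \<phi> x \<partial>lborel)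
       = (\<integral>x. c powr - ?N * (u x * \<phi> ((1 / c) *\<^sub>R x)) - u x * \<phi> x \<partial>lborel)"
      using integral_scale[of c "\<lambda>x. u x * \<phi> ((1 / c) *\<^sub>R x)"] c i2 i4
      by (subst Bochner_Integration.integral_diff) auto
    also have "\<dots> = (\<integral>x. - (u x * (\<integral>t. ?i t * M t x \<partial>lborel)) \<partial>lborel)"
      unfolding FTC by (simp add: algebra_simps)
    also have "\<dots> = - (\<integral>x. (\<integral>t. u x * (?i t * M t x) \<partial>lborel) \<partial>lborel)" by simp
    also have "\<dots> = - (\<integral>t. (\<integral>x. u x * (?i t * M t x) \<partial>lborel) \<partial>lborel)"
      using lborel_pair.integral_fst[OF intM] lborel_pair.integral_snd[OF intM] by simp
    also have "(\<lambda>t. \<integral>x. u x * (?i t * M t x) \<partial>lborel) = (\<lambda>t. - (\<integral>x. \<phi> x * (?i t * (x \<bullet> g (t *\<^sub>R x))) \<partial>lborel))"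
      using inner by (auto simp: indicator_def)
    also have "- (\<integral>t. - (\<integral>x. \<phi> x * (?i t * (x \<bullet> g (t *\<^sub>R x))) \<partial>lborel) \<partial>lborel) 
        = (\<integral>t. (\<integral>x. \<phi> x * (?i t * (x \<bullet> g (t *\<^sub>R x))) \<partial>lborel) \<partial>lborel)" by simp
    also have "\<dots> = (\<integral>x. (\<integral>t. \<phi> x * (?i t * (x \<bullet> g (t *\<^sub>R x))) \<partial>lborel) \<partial>lborel)"
      using lborel_pair.integral_fst[OF intH] lborel_pair.integral_snd[OF intH] by simp
    also have "\<dots> = (\<integral>x. ray_integral g c x * \<phi> x \<partial>lborel)" by (simp add: ray_integral_def mult.commute)
    finally show "(\<integral>x. (u (c *\<^sub>R x) - u x - ray_integral g c x) * \<phi> x \<partial>lborel) = 0"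
      using i1 i2 i3 by (simp add: left_diff_distrib)
  qed
  then show ?thesis by simp
qed

section \<open>Radial profiles\<close>

lemma AE_on_rays:
  fixes Q :: "real \<Rightarrow> 'a::euclidean_space \<Rightarrow> bool"
  assumes [measurable]: "Measurable.pred (borel \<Otimes>\<^sub>M borel) (\<lambda>(t, x). Q t x)"
    and Q: "\<And>t. t > 0 \<Longrightarrow> t \<noteq> 1 \<Longrightarrow> AE x in lborel. Q t x"
  shows "AE x in lborel. AE t in lborel. t > 0 \<longrightarrow> Q t x"
proof -
  have ne: "AE t in lborel. t \<noteq> (1::real)" by (rule AE_lborel_singleton)
  have "AE t in lborel. AE x::'a in lborel. t > 0 \<longrightarrow> Q t x"
    using ne by eventually_elim (use Q in auto)
  moreover have "{p \<in> space (lborel \<Otimes>\<^sub>M lborel). fst p > 0 \<longrightarrow> Q (fst p) (snd p)} \<in> sets (lborel \<Otimes>\<^sub>M lborel)"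
  proof -
    have "Measurable.pred (borel \<Otimes>\<^sub>M borel) (\<lambda>p. fst p > 0 \<longrightarrow> Q (fst p) (snd p))"
      using assms(1) by (simp add: case_prod_beta)
    then have "Measurable.pred (lborel \<Otimes>\<^sub>M lborel) (\<lambda>p. fst p > 0 \<longrightarrow> Q (fst p) (snd p))"
      by (simp add: measurable_lborel_pair_iff)
    then show ?thesis by (simp add: pred_def)
  qed
  ultimately show ?thesis by (subst lborel_pair.AE_commute[symmetric]) auto
qed

lemma AE_on_rays_fixed:
  assumes P: "AE x::'a::euclidean_space in lborel. P x"
  shows "AE x::'a in lborel. AE t in lborel. t > 0 \<longrightarrow> P (t *\<^sub>R x)"
proof -
  obtain S where S: "S \<in> sets lborel" "{x \<in> space lborel. \<not> P x} \<subseteq> S" "emeasure lborel S = 0"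
    using P by (auto elim!: AE_E)
  have [measurable]: "S \<in> sets borel" using S by simp
  have "AE x in lborel. x \<notin> S" using S by (intro AE_not_in) (auto simp: null_sets_def)
  then have "AE x::'a in lborel. AE t in lborel. t > 0 \<longrightarrow> t *\<^sub>R x \<notin> S"
    by (intro AE_on_rays AE_scale) (simp_all add: case_prod_beta)
  then show ?thesis
    by eventually_elim (rule AE_mp, assumption, use S in auto)
qed

text \<open>
  A null set of radii gives a null set of points. Without polar coordinates: for \<open>t\<close> in \<open>{1..2}\<close> the
  set \<open>{x. t |x| \<in> S}\<close> has measure comparable to that of \<open>{x. |x| \<in> S}\<close>, and by Fubini its average
  over \<open>t\<close> is 0, since \<open>{t. t |x| \<in> S}\<close> is a null set for every \<open>x \<noteq> 0\<close>.
\<close>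

lemma AE_norm:
  assumes P: "AE t in lborel. t > 0 \<longrightarrow> P t"
  shows "AE x::'a::euclidean_space in lborel. P (norm x)"
proof -
  let ?N = "real DIM('a)"
  obtain S where S: "S \<in> sets lborel" "{t \<in> space lborel. \<not> (t > 0 \<longrightarrow> P t)} \<subseteq> S" "emeasure lborel S = 0"
    using P by (auto elim!: AE_E)
  have [measurable]: "S \<in> sets borel" using S by simp
  have AES: "AE t in lborel. t \<notin> S" using S by (intro AE_not_in) (auto simp: null_sets_def)
  define Z where "Z = (\<integral>\<^sup>+x. indicator S (norm x) \<partial>(lborel :: 'a measure))"
  have "(\<integral>\<^sup>+t. indicator {1..2::real} t * (ennreal (2 powr - ?N) * Z) \<partial>lborel)
     \<le> (\<integral>\<^sup>+t. (\<integral>\<^sup>+x. indicator {1..2} t * indicator S (t * norm x) \<partial>(lborel :: 'a measure)) \<partial>lborel)"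
  proof (rule nn_integral_mono)
    fix t :: real
    show "indicator {1..2} t * (ennreal (2 powr - ?N) * Z) \<le> (\<integral>\<^sup>+x. indicator {1..2} t * indicator S (t * norm x) \<partial>(lborel :: 'a measure))"
    proof (cases "t \<in> {1..2}")
      case True
      have "(\<integral>\<^sup>+x. indicator S (t * norm x) \<partial>(lborel :: 'a measure)) = ennreal (t powr - ?N) * Z"
        using nn_integral_scale[of "\<lambda>x::'a. indicator S (norm x)" t] True by (simp add: Z_def)
      moreover have "2 powr - ?N \<le> t powr - ?N" using True by (intro powr_mono2') auto
      ultimately show ?thesis using True by (auto intro!: mult_right_mono ennreal_leI)
    qed simp
  qed
  also have "\<dots> = (\<integral>\<^sup>+x. (\<integral>\<^sup>+t. indicator {1..2} t * indicator S (t * norm x) \<partial>lborel) \<partial>(lborel :: 'a measure))"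
  proof (rule lborel_pair.Fubini')
    have [measurable]: "{1..2::real} \<in> sets borel" by simp
    show "(\<lambda>(x::'a, t). indicator {1..2} t * indicator S (t * norm x) :: ennreal) \<in> borel_measurable (lborel \<Otimes>\<^sub>M lborel)"
      unfolding measurable_lborel_pair_iff case_prod_beta by measurable
  qed
  also have "\<dots> = (\<integral>\<^sup>+x. 0 \<partial>(lborel :: 'a measure))"
  proof (rule nn_integral_cong_AE)
    have "AE x::'a in lborel. x \<noteq> 0" by (rule AE_lborel_singleton)
    then show "AE x::'a in lborel. (\<integral>\<^sup>+t. indicator {1..2} t * indicator S (t * norm x) \<partial>lborel) = 0"
    proof eventually_elim
      case (elim x)
      have "AE t in lborel. 0 + norm x * t \<notin> S"
        by (rule AE_borel_affine) (use elim AES in auto)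
      then have "AE t in lborel. indicator {1..2} t * indicator S (t * norm x) = (0::ennreal)"
        by eventually_elim (auto simp: mult.commute)
      then have "(\<integral>\<^sup>+t. indicator {1..2} t * indicator S (t * norm x) \<partial>lborel) = (\<integral>\<^sup>+t. 0 \<partial>(lborel :: real measure))"
        by (rule nn_integral_cong_AE)
      then show ?case by simp
    qed
  qed
  finally have "ennreal (2 powr - ?N) * Z = 0"
    by (simp add: nn_integral_multc)
  then have "Z = 0" by simp
  then have "AE x::'a in lborel. (indicator S (norm x) :: ennreal) = 0"
    unfolding Z_def by (subst (asm) nn_integral_0_iff_AE) auto
  moreover have "AE x::'a in lborel. x \<noteq> 0" by (rule AE_lborel_singleton)
  ultimately show ?thesis
  proof eventually_elim
    case (elim x)
    then have "norm x > 0" "norm x \<notin> S" by (auto simp: indicator_def split: if_splits)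
    moreover have "{t. 0 < t \<and> \<not> P t} \<subseteq> S" using S(2) by simp
    ultimately show ?case by blast
  qed
qed

text \<open>
  A substitute for integration in polar coordinates: a function with finite integral has finite
  radial integrals, with the weight \<open>t^(N-1)\<close>, along almost all rays. Averaging the rays through the
  shell \<open>1 < |x| < 2\<close>, each point \<open>y\<close> is met for \<open>t\<close> between \<open>|y|/2\<close> and \<open>|y|\<close>, which has measure at
  most 1 with respect to \<open>dt / t\<close>.
\<close>

lemma nn_integral_rays_finite:
  fixes G :: "'a::euclidean_space \<Rightarrow> ennreal"
  assumes [measurable]: "G \<in> borel_measurable borel" and G: "(\<integral>\<^sup>+x. G x \<partial>lborel) < \<infinity>"
  shows "AE x in lborel. norm x \<in> {1<..<2} \<longrightarrow>
    (\<integral>\<^sup>+t. indicator {0<..} t * (ennreal (t powr (real DIM('a) - 1)) * G (t *\<^sub>R x)) \<partial>lborel) < \<infinity>"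
proof -
  let ?N = "real DIM('a)"
  have [measurable]: "{1::real<..<2} \<in> sets borel" "{0::real<..} \<in> sets borel" by simp_all
  define H where "H x = (\<integral>\<^sup>+t. indicator {0<..} t * (ennreal (t powr (?N - 1)) * G (t *\<^sub>R x)) \<partial>lborel)" for x
  have H[measurable]: "H \<in> borel_measurable borel"
  proof -
    have "(\<lambda>(x, t). indicator {0<..} t * (ennreal (t powr (?N - 1)) * G (t *\<^sub>R x))) \<in> borel_measurable (borel \<Otimes>\<^sub>M lborel)"
      unfolding case_prod_beta by measurable
    from lborel.borel_measurable_nn_integral[OF this] show ?thesis by (simp add: H_def[abs_def])
  qed
  have "(\<integral>\<^sup>+x. indicator {1<..<2} (norm x) * H x \<partial>lborel)
      = (\<integral>\<^sup>+x. (\<integral>\<^sup>+t. indicator {1<..<2} (norm x) * (indicator {0<..} t * (ennreal (t powr (?N - 1)) * G (t *\<^sub>R x))) \<partial>lborel) \<partial>lborel)"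
    unfolding H_def by (intro nn_integral_cong nn_integral_cmult[symmetric]) measurable
  also have "\<dots> = (\<integral>\<^sup>+t. (\<integral>\<^sup>+x. indicator {1<..<2} (norm x) * (indicator {0<..} t * (ennreal (t powr (?N - 1)) * G (t *\<^sub>R x))) \<partial>lborel) \<partial>lborel)"
    by (rule lborel_pair.Fubini') (unfold measurable_lborel_pair_iff case_prod_beta, measurable)
  also have "\<dots> = (\<integral>\<^sup>+t. (\<integral>\<^sup>+y. indicator {1<..<2} (norm y / t) * (indicator {0<..} t * (ennreal (1 / t) * G y)) \<partial>lborel) \<partial>lborel)"
  proof (rule nn_integral_cong)
    fix t :: real
    show "(\<integral>\<^sup>+x. indicator {1<..<2} (norm x) * (indicator {0<..} t * (ennreal (t powr (?N - 1)) * G (t *\<^sub>R x))) \<partial>lborel)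
      = (\<integral>\<^sup>+y. indicator {1<..<2} (norm y / t) * (indicator {0<..} t * (ennreal (1 / t) * G y)) \<partial>lborel)"
    proof (cases "t > 0")
      case True
      let ?f = "\<lambda>y. indicator {1<..<2} (norm y / t) * (indicator {0<..} t * (ennreal (t powr (?N - 1)) * G y))"
      have "?f \<in> borel_measurable borel" by measurable
      from nn_integral_scale[OF this True]
      have "(\<integral>\<^sup>+x. indicator {1<..<2} (norm x) * (indicator {0<..} t * (ennreal (t powr (?N - 1)) * G (t *\<^sub>R x))) \<partial>lborel)
        = ennreal (t powr - ?N) * (\<integral>\<^sup>+y. ?f y \<partial>lborel)" using True by simp
      also have "\<dots> = (\<integral>\<^sup>+y. ennreal (t powr - ?N) * ?f y \<partial>lborel)"
        by (rule nn_integral_cmult[symmetric]) measurable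
      also have "\<dots> = (\<integral>\<^sup>+y. indicator {1<..<2} (norm y / t) * (indicator {0<..} t * (ennreal (1 / t) * G y)) \<partial>lborel)"
      proof (rule nn_integral_cong)
        fix y
        have "ennreal (t powr - ?N) * ennreal (t powr (?N - 1)) = ennreal (1 / t)"
          using True by (simp add: ennreal_mult[symmetric] powr_diff powr_minus_divide)
        from this[symmetric] show "ennreal (t powr - ?N) * ?f y = indicator {1<..<2} (norm y / t) * (indicator {0<..} t * (ennreal (1 / t) * G y))"
          by (simp only: mult_ac)
      qed
      finally show ?thesis .
    qed simp
  qed
  also have "\<dots> = (\<integral>\<^sup>+y. (\<integral>\<^sup>+t. indicator {1<..<2} (norm y / t) * (indicator {0<..} t * (ennreal (1 / t) * G y)) \<partial>lborel) \<partial>lborel)"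
    by (rule lborel_pair.Fubini') (unfold measurable_lborel_pair_iff case_prod_beta, measurable)
  also have "\<dots> \<le> (\<integral>\<^sup>+y. G y \<partial>lborel)"
  proof (rule nn_integral_mono)
    fix y :: 'a
    have "(\<integral>\<^sup>+t. indicator {1<..<2} (norm y / t) * (indicator {0<..} t * (ennreal (1 / t) * G y)) \<partial>lborel)
      \<le> (\<integral>\<^sup>+t. ennreal (2 / norm y) * G y * indicator {norm y / 2..norm y} t \<partial>lborel)"
    proof (rule nn_integral_mono)
      fix t :: real
      show "indicator {1<..<2} (norm y / t) * (indicator {0<..} t * (ennreal (1 / t) * G y))
        \<le> ennreal (2 / norm y) * G y * indicator {norm y / 2..norm y} t"
      proof (cases "t > 0 \<and> 1 < norm y / t \<and> norm y / t < 2")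
        case True
        then have "norm y / 2 \<le> t" "t \<le> norm y" "norm y > 0" by (auto simp: field_simps)
        moreover from this have "1 / t \<le> 2 / norm y" using True by (auto simp: field_simps)
        ultimately show ?thesis using True by (auto intro!: mult_right_mono ennreal_leI)
      qed (auto simp: indicator_def)
    qed
    also have "\<dots> = ennreal (2 / norm y) * G y * ennreal (norm y / 2)"
      by (simp add: nn_integral_cmult)
    also have "\<dots> \<le> G y"
    proof (cases "y = 0")
      case False
      then have "ennreal (2 / norm y) * ennreal (norm y / 2) = 1"
        by (simp add: ennreal_mult[symmetric])
      then have "G y * (ennreal (2 / norm y) * ennreal (norm y / 2)) = G y" by simp
      then show ?thesis by (simp only: mult_ac order_refl)
    qed simp
    finally show "(\<integral>\<^sup>+t. indicator {1<..<2} (norm y / t) * (indicator {0<..} t * (ennreal (1 / t) * G y)) \<partial>lborel) \<le> G y" .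
  qed
  finally have "(\<integral>\<^sup>+x. indicator {1<..<2} (norm x) * H x \<partial>lborel) < \<infinity>" using G by (rule order.strict_trans1)
  then have "AE x in lborel. indicator {1<..<2} (norm x) * H x \<noteq> \<infinity>"
    by (intro nn_integral_PInf_AE) auto
  then show ?thesis by eventually_elim (auto simp: H_def less_top)
qed

text \<open>
  The expected value of \<open>u (c x) - u x\<close>, for \<open>c\<close> on either side of 1.
\<close>

definition ray_difference :: "('a::euclidean_space \<Rightarrow> 'a) \<Rightarrow> real \<Rightarrow> 'a \<Rightarrow> real" where
  "ray_difference g c x = (if c \<ge> 1 then ray_integral g c x else - ray_integral g (1 / c) (c *\<^sub>R x))"

lemma ray_difference_eq:
  assumes ug: "has_weak_gradient u g" and c: "c > 0" "c \<noteq> 1"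
  shows "AE x in lborel. u (c *\<^sub>R x) - u x = ray_difference g c x"
proof (cases "c \<ge> 1")
  case True
  then have "c > 1" using c by simp
  from weak_gradient_along_rays[OF ug this] show ?thesis using True by (simp add: ray_difference_def)
next
  case False
  then have "1 / c > 1" using c by (simp add: field_simps)
  from AE_scale[OF weak_gradient_along_rays[OF ug this] c(1)]
  show ?thesis by eventually_elim (use False c in \<open>simp add: ray_difference_def\<close>)
qed

lemma ray_difference_measurable:
  assumes [measurable]: "g \<in> borel_measurable borel"
  shows "(\<lambda>(c, x). ray_difference g c x) \<in> borel_measurable (borel \<Otimes>\<^sub>M borel)"
proof -
  note ray_integral_measurable(1)[OF assms, measurable]
  have 1: "(\<lambda>p. (\<lambda>(c, x). ray_integral g c x) (1 / fst p, fst p *\<^sub>R snd p)) \<in> borel_measurable (borel \<Otimes>\<^sub>M borel)"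
    by measurable
  have 2: "(\<lambda>p. (\<lambda>(c, x). ray_integral g c x) p) \<in> borel_measurable (borel \<Otimes>\<^sub>M borel)"
    by measurable
  have "(\<lambda>p. if fst p \<ge> 1 then (\<lambda>(c, x). ray_integral g c x) p
      else - (\<lambda>(c, x). ray_integral g c x) (1 / fst p, fst p *\<^sub>R snd p)) \<in> borel_measurable (borel \<Otimes>\<^sub>M borel)"
    by (intro measurable_If borel_measurable_uminus 1 2) measurable
  then show ?thesis by (simp add: ray_difference_def case_prod_beta)
qed

lemma set_integral_combine_Icc:
  fixes F :: "real \<Rightarrow> real"
  assumes "\<And>a b. 0 < a \<Longrightarrow> a \<le> b \<Longrightarrow> set_integrable lborel {a..b} F" "0 < a" "a \<le> b" "b \<le> c"
  shows "(LBINT t:{a..c}. F t) = (LBINT t:{a..b}. F t) + (LBINT t:{b..c}. F t)"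
proof -
  have 1: "F integrable_on {a..c}" using assms by (intro set_borel_integral_eq_integral) auto
  have 2: "(LBINT t:{x..y}. F t) = integral {x..y} F" if "0 < x" "x \<le> y" for x y
    using assms(1) that by (intro set_borel_integral_eq_integral) auto
  show ?thesis using Henstock_Kurzweil_Integration.integral_combine[OF assms(3,4) 1] assms by (simp add: 2)
qed

lemma AE_not_in_open_imp_empty:
  fixes U :: "'a::euclidean_space set"
  assumes "open U" "AE x in lborel. x \<notin> U"
  shows "U = {}"
proof (rule ccontr)
  assume "U \<noteq> {}"
  have "U \<in> null_sets lborel" using assms by (intro AE_iff_null_sets[THEN iffD2]) auto
  then have "negligible U" by (simp add: negligible_iff_null_sets null_sets_completionI)
  then show False using open_not_negligible[OF assms(1)] \<open>U \<noteq> {}\<close> by blast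
qed

text \<open>
  A radial weakly differentiable function has an absolutely continuous profile. The profile is read
  off along a single ray through a generic point \<open>x0\<close>: the weak gradient is integrable along this
  ray, and both the radial representation of \<open>u\<close> and the fundamental theorem of calculus hold at almost
  every point of it. As \<open>\<bar>F\<bar>\<close> is at most the norm of the gradient on the ray, \<open>F\<close> inherits its
  \<open>L^p\<close> bound.
\<close>

theorem radial_profile:
  fixes u :: "'a::euclidean_space \<Rightarrow> real" and p :: real
  assumes ug: "has_weak_gradient u g" and rad: "radial u"
  obtains f F :: "real \<Rightarrow> real" where
    "F \<in> borel_measurable borel"
    "\<And>a b. 0 < a \<Longrightarrow> a \<le> b \<Longrightarrow> set_integrable lborel {a..b} F"
    "\<And>a b. 0 < a \<Longrightarrow> a \<le> b \<Longrightarrow> f b - f a = (LBINT t:{a..b}. F t)"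
    "AE x in lborel. u x = f (norm x)"
    "p > 0 \<Longrightarrow> (\<integral>\<^sup>+x. ennreal (norm (g x) powr p) \<partial>lborel) < \<infinity> \<Longrightarrow>
      (\<integral>\<^sup>+t. indicator {0<..} t * ennreal (t powr (real DIM('a) - 1) * \<bar>F t\<bar> powr p) \<partial>lborel) < \<infinity>"
proof -
  let ?N = "real DIM('a)"
  note L = has_weak_gradientD(1,2)[OF ug]
  have um[measurable]: "u \<in> borel_measurable borel" and gm[measurable]: "g \<in> borel_measurable borel"
    using L by (auto dest: L1_locD)
  obtain f0 where f0[measurable]: "f0 \<in> borel_measurable borel" and uf0: "AE x in lborel. u x = f0 (norm x)"
    using rad by (auto simp: radial_def)
  have e1: "AE x in lborel. AE t in lborel. t > 0 \<longrightarrow> u (t *\<^sub>R x) - u x = ray_difference g t x"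
    using ray_difference_measurable[OF gm]
    by (intro AE_on_rays ray_difference_eq[OF ug]) (auto simp: case_prod_beta intro!: borel_measurable_eq)
  have e2: "AE x in lborel. AE t in lborel. t > 0 \<longrightarrow> u (t *\<^sub>R x) = f0 (norm (t *\<^sub>R x))"
    by (rule AE_on_rays_fixed[OF uf0])
  define G1 where "G1 n y = ennreal (norm (indicator (cball 0 (2 * real n)) y *\<^sub>R g y))" for n :: nat and y :: 'a
  define Gp where "Gp y = (if (\<integral>\<^sup>+x. ennreal (norm (g x) powr p) \<partial>lborel) < \<infinity> then ennreal (norm (g y) powr p) else 0)" for y
  have "AE x in lborel. norm x \<in> {1<..<2} \<longrightarrow>
    (\<integral>\<^sup>+t. indicator {0<..} t * (ennreal (t powr (?N - 1)) * G1 n (t *\<^sub>R x)) \<partial>lborel) < \<infinity>" for n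
  proof (rule nn_integral_rays_finite)
    have [measurable]: "cball (0::'a) r \<in> sets borel" for r by auto
    show "G1 n \<in> borel_measurable borel" unfolding G1_def[abs_def] by measurable
    show "(\<integral>\<^sup>+x. G1 n x \<partial>lborel) < \<infinity>"
      using L1_locD(2)[OF L(2) compact_cball[of 0 "2 * real n"]]
      unfolding set_integrable_def integrable_iff_bounded G1_def by simp
  qed
  then have e3: "AE x in lborel. \<forall>n. norm x \<in> {1<..<2} \<longrightarrow>
    (\<integral>\<^sup>+t. indicator {0<..} t * (ennreal (t powr (?N - 1)) * G1 n (t *\<^sub>R x)) \<partial>lborel) < \<infinity>"
    by (subst AE_all_countable) auto
  have e4: "AE x in lborel. norm x \<in> {1<..<2} \<longrightarrow>
    (\<integral>\<^sup>+t. indicator {0<..} t * (ennreal (t powr (?N - 1)) * Gp (t *\<^sub>R x)) \<partial>lborel) < \<infinity>"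
  proof (rule nn_integral_rays_finite)
    show "Gp \<in> borel_measurable borel" unfolding Gp_def[abs_def] by measurable
    show "(\<integral>\<^sup>+x. Gp x \<partial>lborel) < \<infinity>"
      by (cases "(\<integral>\<^sup>+x. ennreal (norm (g x) powr p) \<partial>lborel) < \<infinity>") (simp_all add: Gp_def)
  qed
  \<comment> \<open>A point in general position on the shell, where all the almost sure properties hold.\<close>
  obtain x0 where x0: "norm x0 \<in> {1<..<2}"
    and x1: "AE t in lborel. t > 0 \<longrightarrow> u (t *\<^sub>R x0) - u x0 = ray_difference g t x0"
    and x2: "AE t in lborel. t > 0 \<longrightarrow> u (t *\<^sub>R x0) = f0 (norm (t *\<^sub>R x0))"
    and x3: "\<And>n. (\<integral>\<^sup>+t. indicator {0<..} t * (ennreal (t powr (?N - 1)) * G1 n (t *\<^sub>R x0)) \<partial>lborel) < \<infinity>"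
    and x4: "(\<integral>\<^sup>+t. indicator {0<..} t * (ennreal (t powr (?N - 1)) * Gp (t *\<^sub>R x0)) \<partial>lborel) < \<infinity>"
  proof -
    let ?Q = "\<lambda>x. norm x \<in> {1<..<2} \<longrightarrow> (AE t in lborel. t > 0 \<longrightarrow> u (t *\<^sub>R x) - u x = ray_difference g t x)
      \<and> (AE t in lborel. t > 0 \<longrightarrow> u (t *\<^sub>R x) = f0 (norm (t *\<^sub>R x)))
      \<and> (\<forall>n. (\<integral>\<^sup>+t. indicator {0<..} t * (ennreal (t powr (?N - 1)) * G1 n (t *\<^sub>R x)) \<partial>lborel) < \<infinity>)
      \<and> (\<integral>\<^sup>+t. indicator {0<..} t * (ennreal (t powr (?N - 1)) * Gp (t *\<^sub>R x)) \<partial>lborel) < \<infinity>"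
    have Q: "AE x in lborel. ?Q x" using e1 e2 e3 e4 by eventually_elim blast
    have "\<exists>x. norm x \<in> {1<..<2} \<and> ?Q x"
    proof (rule ccontr)
      assume neg: "\<not> ?thesis"
      have "AE x in lborel. x \<notin> {x::'a. 1 < norm x \<and> norm x < 2}"
        using Q by eventually_elim (use neg in auto)
      moreover have "open {x::'a. 1 < norm x \<and> norm x < 2}"
        by (intro open_Collect_conj open_Collect_less continuous_intros)
      ultimately have empty: "{x::'a. 1 < norm x \<and> norm x < 2} = {}" by (intro AE_not_in_open_imp_empty)
      obtain b :: 'a where "b \<in> Basis" using nonempty_Basis by blast
      then have "(3/2) *\<^sub>R b \<in> {x::'a. 1 < norm x \<and> norm x < 2}" by simp
      then show False unfolding empty by simp
    qed
    then show ?thesis using that by blast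
  qed
  define r where "r = norm x0"
  have r: "r > 0" "1 < r" "r < 2" using x0 by (auto simp: r_def)
  define F where "F t = indicator {0<..} t * ((x0 \<bullet> g ((t / r) *\<^sub>R x0)) / r)" for t :: real
  have Fm[measurable]: "F \<in> borel_measurable borel"
  proof -
    have [measurable]: "{0::real<..} \<in> sets borel" by simp
    show ?thesis unfolding F_def[abs_def] by measurable
  qed
  have Fr: "\<bar>F (0 + r * t)\<bar> \<le> norm (g (t *\<^sub>R x0))" if "t > 0" for t
  proof -
    have "\<bar>x0 \<bullet> g (t *\<^sub>R x0)\<bar> \<le> r * norm (g (t *\<^sub>R x0))"
      unfolding r_def by (rule Cauchy_Schwarz_ineq2)
    then show ?thesis using r that by (simp add: F_def abs_mult field_simps)
  qed
  have Fint: "set_integrable lborel {a..b} F" if ab: "0 < a" "a \<le> b" for a b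
  proof -
    obtain n where n: "real n \<ge> b" using real_arch_simple by blast
    define w where "w = (a / r) powr (1 - ?N)"
    have "(\<integral>\<^sup>+t. ennreal (norm (indicator {a..b} t *\<^sub>R F t)) \<partial>lborel) 
        = ennreal \<bar>r\<bar> * (\<integral>\<^sup>+t. ennreal (norm (indicator {a..b} (0 + r * t) *\<^sub>R F (0 + r * t))) \<partial>lborel)"
      using r by (intro nn_integral_real_affine) auto
    also have "\<dots> \<le> ennreal \<bar>r\<bar> * (\<integral>\<^sup>+t. ennreal w * (indicator {0<..} t * (ennreal (t powr (?N - 1)) * G1 n (t *\<^sub>R x0))) \<partial>lborel)"
    proof (intro mult_left_mono nn_integral_mono)
      fix t
      show "ennreal (norm (indicator {a..b} (0 + r * t) *\<^sub>R F (0 + r * t)))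
        \<le> ennreal w * (indicator {0<..} t * (ennreal (t powr (?N - 1)) * G1 n (t *\<^sub>R x0)))"
      proof (cases "0 + r * t \<in> {a..b}")
        case True
        then have "r * t > 0" "a / r \<le> t" using ab r by (auto simp: field_simps)
        then have t: "t > 0" using r by (simp add: zero_less_mult_iff)
        have "norm (t *\<^sub>R x0) \<le> real n" using True t n by (simp add: r_def mult.commute)
        then have G: "G1 n (t *\<^sub>R x0) = ennreal (norm (g (t *\<^sub>R x0)))" using n ab by (simp add: G1_def)
        have "1 = w * (a / r) powr (?N - 1)" using ab r by (simp add: w_def powr_add[symmetric])
        also have "\<dots> \<le> w * t powr (?N - 1)"
          using ab r \<open>a / r \<le> t\<close> DIM_positive[where 'a = 'a] by (intro mult_left_mono powr_mono2) (auto simp: w_def Suc_le_eq)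
        finally have "norm (F (0 + r * t)) \<le> w * t powr (?N - 1) * norm (g (t *\<^sub>R x0))"
          using Fr[OF t] mult_right_mono[of 1 "w * t powr (?N - 1)" "norm (g (t *\<^sub>R x0))"] by simp
        then show ?thesis unfolding G using True t
          by (simp add: ennreal_mult[symmetric] w_def mult.assoc ennreal_leI)
      qed simp
    qed auto
    also have "\<dots> = ennreal \<bar>r\<bar> * (ennreal w * (\<integral>\<^sup>+t. (indicator {0<..} t * (ennreal (t powr (?N - 1)) * G1 n (t *\<^sub>R x0))) \<partial>lborel))"
    proof (subst nn_integral_cmult)
      have [measurable]: "{0::real<..} \<in> sets borel" "cball (0::'a) (2 * real n) \<in> sets borel" by auto
      show "(\<lambda>t. indicator {0<..} t * (ennreal (t powr (?N - 1)) * G1 n (t *\<^sub>R x0))) \<in> borel_measurable lborel"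
        unfolding G1_def by measurable
    qed simp
    also have "\<dots> < \<infinity>" using x3[of n] by (simp add: ennreal_mult_less_top)
    finally show ?thesis unfolding set_integrable_def integrable_iff_bounded by simp
  qed
  \<comment> \<open>The substitution \<open>s = d r t\<close> turns integrals along the ray into integrals of \<open>F\<close> over radii.\<close>
  have sub: "(\<integral>t. indicator {1..c} t * (y \<bullet> g (t *\<^sub>R y)) \<partial>lborel) = (LBINT t:{d*r..c*d*r}. F t)"
    if d: "d > 0" "c \<ge> 1" and y: "y = d *\<^sub>R x0" for c d y
  proof -
    have "(LBINT t:{d*r..c*d*r}. F t) = \<bar>d * r\<bar> *\<^sub>R (\<integral>t. indicator {d*r..c*d*r} (0 + d * r * t) *\<^sub>R F (0 + d * r * t) \<partial>lborel)"
      unfolding set_lebesgue_integral_def using d r by (intro lborel_integral_real_affine) auto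
    also have "\<dots> = (\<integral>t. (d * r) * (indicator {d*r..c*d*r} (d * r * t) * F (d * r * t)) \<partial>lborel)"
      using d r by simp
    also have "\<dots> = (\<integral>t. indicator {1..c} t * (y \<bullet> g (t *\<^sub>R y)) \<partial>lborel)"
    proof (rule Bochner_Integration.integral_cong[OF refl])
      fix t :: real
      have "d * r * t \<in> {d*r..c*d*r} \<longleftrightarrow> t \<in> {1..c}"
        using d r by (auto simp: mult.commute[of c] mult.assoc[of d r])
      then show "(d * r) * (indicator {d*r..c*d*r} (d * r * t) * F (d * r * t)) = indicator {1..c} t * (y \<bullet> g (t *\<^sub>R y))"
        using d r by (auto simp: indicator_def F_def y zero_less_mult_iff mult.commute)
    qed
    finally show ?thesis by simp
  qed
  define f where "f t = u x0 + (if t \<ge> r then (LBINT s:{r..t}. F s) else - (LBINT s:{t..r}. F s))" for t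
  have fr: "f (t * r) = u x0 + ray_difference g t x0" if "t > 0" for t
    using that r sub[of 1 t x0] sub[of t "1 / t" "t *\<^sub>R x0"]
    by (auto simp: f_def ray_difference_def ray_integral_def mult_less_cancel_right2)
  show ?thesis
  proof (rule that[of F f])
    show "F \<in> borel_measurable borel" "\<And>a b. 0 < a \<Longrightarrow> a \<le> b \<Longrightarrow> set_integrable lborel {a..b} F"
      by (fact Fm, fact Fint)
    show "f b - f a = (LBINT t:{a..b}. F t)" if ab: "0 < a" "a \<le> b" for a b
      using ab r(1) set_integral_combine_Icc[OF Fint ab(1), of r b] set_integral_combine_Icc[OF Fint ab, of r]
        set_integral_combine_Icc[OF Fint r(1), of a b]
      by (auto simp: f_def not_le)
    show "AE x in lborel. u x = f (norm x)"
    proof -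
      have "AE t in lborel. t > 0 \<longrightarrow> f0 (t * r) = f (t * r)"
        using x1 x2 by eventually_elim (auto simp: fr r_def[symmetric])
      from AE_scale[OF this, of "1 / r"]
      have "AE t in lborel. (1 / r) * t > 0 \<longrightarrow> f0 ((1 / r) * t * r) = f ((1 / r) * t * r)"
        using r(1) by simp
      then have "AE t in lborel. t > 0 \<longrightarrow> f0 t = f t"
        by eventually_elim (use r(1) in auto)
      from AE_norm[OF this] uf0 show ?thesis by eventually_elim simp
    qed
    show "(\<integral>\<^sup>+t. indicator {0<..} t * ennreal (t powr (?N - 1) * \<bar>F t\<bar> powr p) \<partial>lborel) < \<infinity>"
      if p: "p > 0" and fin: "(\<integral>\<^sup>+x. ennreal (norm (g x) powr p) \<partial>lborel) < \<infinity>"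
    proof -
      have [measurable]: "{0::real<..} \<in> sets borel" by simp
      have Gp: "Gp y = ennreal (norm (g y) powr p)" for y using fin by (simp add: Gp_def)
      have "(\<integral>\<^sup>+t. indicator {0<..} t * ennreal (t powr (?N - 1) * \<bar>F t\<bar> powr p) \<partial>lborel)
        = ennreal \<bar>r\<bar> * (\<integral>\<^sup>+t. indicator {0<..} (0 + r * t) * ennreal ((0 + r * t) powr (?N - 1) * \<bar>F (0 + r * t)\<bar> powr p) \<partial>lborel)"
        using r by (intro nn_integral_real_affine) auto
      also have "\<dots> \<le> ennreal \<bar>r\<bar> * (\<integral>\<^sup>+t. ennreal (r powr (?N - 1)) * (indicator {0<..} t * (ennreal (t powr (?N - 1)) * Gp (t *\<^sub>R x0))) \<partial>lborel)"
      proof (intro mult_left_mono nn_integral_mono)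
        fix t
        show "indicator {0<..} (0 + r * t) * ennreal ((0 + r * t) powr (?N - 1) * \<bar>F (0 + r * t)\<bar> powr p)
          \<le> ennreal (r powr (?N - 1)) * (indicator {0<..} t * (ennreal (t powr (?N - 1)) * Gp (t *\<^sub>R x0)))"
        proof (cases "t > 0")
          case True
          have "\<bar>F (0 + r * t)\<bar> powr p \<le> norm (g (t *\<^sub>R x0)) powr p"
            using Fr[OF True] p by (intro powr_mono2) auto
          then have "(r * t) powr (?N - 1) * \<bar>F (0 + r * t)\<bar> powr p \<le> r powr (?N - 1) * (t powr (?N - 1) * norm (g (t *\<^sub>R x0)) powr p)"
            using True r by (simp add: powr_mult mult.assoc mult_left_mono)
          then show ?thesis using True r by (simp add: Gp ennreal_mult[symmetric] ennreal_leI)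
        qed (use r in \<open>simp add: zero_less_mult_iff\<close>)
      qed auto
      also have "\<dots> = ennreal \<bar>r\<bar> * (ennreal (r powr (?N - 1)) * (\<integral>\<^sup>+t. indicator {0<..} t * (ennreal (t powr (?N - 1)) * Gp (t *\<^sub>R x0)) \<partial>lborel))"
        unfolding Gp by (intro arg_cong2[where f = "(*)"] refl nn_integral_cmult) measurable
      also have "\<dots> < \<infinity>" using x4 by (simp add: ennreal_mult_less_top)
      finally show ?thesis .
    qed
  qed
qed

section \<open>Measure distortion of bi-Lipschitz maps\<close>

lemma emeasure_ball_scale:
  fixes c z :: "'a::euclidean_space"
  assumes "L > 0" "r \<ge> 0"
  shows "emeasure lborel (ball z (L * r)) = ennreal (L powr real DIM('a)) * emeasure lborel (ball c r)"
  using assms by (simp add: emeasure_ball ennreal_mult[symmetric] power_mult_distrib powr_realpow mult_ac)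

text \<open>
  The preimage of \<open>U\<close> under \<open>\<phi>\<close> is covered by the images under the \<open>L\<close>-Lipschitz inverse of the balls
  of a Vitali covering of \<open>U\<close>. Each image lies in a ball whose radius is larger by the factor \<open>L\<close>, and
  the image of the null set that the covering misses is again a null set.
\<close>

lemma emeasure_vimage_open_le:
  fixes \<phi> \<psi> :: "'a::euclidean_space \<Rightarrow> 'a"
  assumes [measurable]: "\<phi> \<in> borel_measurable borel" and inv: "\<And>x. \<psi> (\<phi> x) = x"
    and lip: "\<And>x y. dist (\<psi> x) (\<psi> y) \<le> L * dist x y" and L: "L > 0" and U: "open U"
  shows "emeasure lborel (\<phi> -` U) \<le> ennreal (L powr real DIM('a)) * emeasure lborel U"
proof -
  define K where "K = {(x, r). x \<in> U \<and> 0 < r \<and> ball x r \<subseteq> U}"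
  have cov: "\<exists>i. i \<in> K \<and> x \<in> ball (fst i) (snd i) \<and> snd i < d" if x: "x \<in> U" "0 < d" for x d
  proof -
    obtain e where e: "e > 0" "ball x e \<subseteq> U" using U x by (auto simp: open_contains_ball)
    have "ball x (min e (d / 2)) \<subseteq> U" using e by auto
    then have "(x, min e (d / 2)) \<in> K" using e x by (simp add: K_def)
    moreover have "x \<in> ball x (min e (d / 2))" "min e (d / 2) < d" using e x by auto
    ultimately show ?thesis by (intro exI[of _ "(x, min e (d / 2))"]) simp
  qed
  obtain C where C: "countable C" "C \<subseteq> K"
    and disj: "pairwise (\<lambda>i j. disjnt (ball (fst i) (snd i)) (ball (fst j) (snd j))) C"
    and neg: "negligible (U - (\<Union>i\<in>C. ball (fst i) (snd i)))"
    by (rule Vitali_covering_theorem_balls[of U K fst snd, OF cov])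
  define I where "I = to_nat_on C"
  define it where "it n = inv_into C I n" for n
  have I: "inj_on I C" unfolding I_def using C(1) by (rule inj_on_to_nat_on)
  have it: "it (I i) = i" if "i \<in> C" for i using I that by (simp add: it_def)
  define X where "X n = (if n \<in> I ` C then ball (fst (it n)) (snd (it n)) else {})" for n
  define Y where "Y n = (if n \<in> I ` C then ball (\<psi> (fst (it n))) (L * snd (it n)) else {})" for n
  have itC: "it n \<in> C" if "n \<in> I ` C" for n using that it by auto
  have "X (I i) = ball (fst i) (snd i)" if "i \<in> C" for i using that by (simp add: X_def it)
  then have UX: "(\<Union>i\<in>C. ball (fst i) (snd i)) = (\<Union>n. X n)"
    by (force simp: X_def split: if_splits)
  have "disjoint_family X"
    unfolding disjoint_family_on_def
  proof (intro ballI impI)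
    fix m n :: nat assume "m \<noteq> n"
    then show "X m \<inter> X n = {}"
    proof (cases "m \<in> I ` C \<and> n \<in> I ` C")
      case True
      then obtain i j where ij: "i \<in> C" "j \<in> C" "m = I i" "n = I j" by blast
      then have "i \<noteq> j" using \<open>m \<noteq> n\<close> by blast
      then show ?thesis using pairwiseD[OF disj ij(1,2)] ij by (simp add: X_def it disjnt_def)
    qed (auto simp: X_def)
  qed
  moreover have "range X \<subseteq> sets lborel" by (auto simp: X_def)
  ultimately have sumX: "(\<Sum>n. emeasure lborel (X n)) = emeasure lborel (\<Union>n. X n)"
    by (intro suminf_emeasure) auto
  have XU: "(\<Union>n. X n) \<subseteq> U" unfolding UX[symmetric]
  proof (rule UN_least)
    fix i assume "i \<in> C"
    then have "i \<in> K" using C(2) by blast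
    then show "ball (fst i) (snd i) \<subseteq> U" by (simp add: K_def case_prod_beta)
  qed
  let ?Z = "\<psi> ` (U - (\<Union>n. X n))"
  have "negligible ?Z"
    using neg unfolding UX
  proof (rule negligible_locally_Lipschitz_image[OF order_refl])
    fix x
    show "\<exists>T B. open T \<and> x \<in> T \<and> (\<forall>y\<in>(U - (\<Union>n. X n)) \<inter> T. norm (\<psi> y - \<psi> x) \<le> B * norm (y - x))"
      using lip by (intro exI[of _ UNIV] exI[of _ L]) (auto simp: dist_norm)
  qed
  then have Z: "?Z \<in> null_sets lebesgue" by (simp add: negligible_iff_null_sets)
  have sub: "\<phi> -` U \<subseteq> ?Z \<union> (\<Union>n. Y n)"
  proof
    fix x assume "x \<in> \<phi> -` U"
    then have x: "\<phi> x \<in> U" "x = \<psi> (\<phi> x)" using inv by auto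
    show "x \<in> ?Z \<union> (\<Union>n. Y n)"
    proof (cases "\<phi> x \<in> (\<Union>n. X n)")
      case True
      then obtain n where n: "n \<in> I ` C" "\<phi> x \<in> ball (fst (it n)) (snd (it n))"
        by (auto simp: X_def split: if_splits)
      have "dist (\<psi> (fst (it n))) (\<psi> (\<phi> x)) \<le> L * dist (fst (it n)) (\<phi> x)" by (rule lip)
      also have "\<dots> < L * snd (it n)" using n L by simp
      finally have "x \<in> Y n" using n x by (simp add: Y_def inv)
      then show ?thesis by blast
    qed (use x in blast)
  qed
  have Ys: "Y n \<in> sets lebesgue" for n by (simp add: Y_def)
  have "emeasure lborel (\<phi> -` U) = emeasure lebesgue (\<phi> -` U)"
  proof -
    have "\<phi> -` U \<inter> space borel \<in> sets borel" using U by (intro measurable_sets[of \<phi> borel borel]) auto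
    then show ?thesis by simp
  qed
  also have "\<dots> \<le> emeasure lebesgue (?Z \<union> (\<Union>n. Y n))"
  proof (rule emeasure_mono[OF sub])
    show "?Z \<union> (\<Union>n. Y n) \<in> sets lebesgue"
      using Z Ys by (intro sets.Un sets.countable_UN) (auto simp: null_sets_def)
  qed
  also have "\<dots> = emeasure lebesgue (\<Union>n. Y n)"
    using Ys by (subst Un_commute, intro emeasure_Un_null_set[OF _ Z] sets.countable_UN) auto
  also have "\<dots> \<le> (\<Sum>n. emeasure lebesgue (Y n))"
    using Ys by (intro emeasure_subadditive_countably) auto
  also have "\<dots> = (\<Sum>n. ennreal (L powr real DIM('a)) * emeasure lborel (X n))"
  proof (intro suminf_cong)
    fix n
    show "emeasure lebesgue (Y n) = ennreal (L powr real DIM('a)) * emeasure lborel (X n)"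
    proof (cases "n \<in> I ` C")
      case True
      then have "snd (it n) \<ge> 0" using itC C(2) by (force simp: K_def)
      then show ?thesis using True L emeasure_ball_scale[of L "snd (it n)" "\<psi> (fst (it n))" "fst (it n)"]
        by (simp add: X_def Y_def)
    qed (simp add: X_def Y_def)
  qed
  also have "\<dots> = ennreal (L powr real DIM('a)) * emeasure lborel (\<Union>n. X n)"
    by (simp add: sumX)
  also have "\<dots> \<le> ennreal (L powr real DIM('a)) * emeasure lborel U"
    using XU U by (intro mult_left_mono emeasure_mono) auto
  finally show ?thesis .
qed

lemma nn_integral_lipschitz_inverse_le:
  fixes \<phi> \<psi> :: "'a::euclidean_space \<Rightarrow> 'a" and h :: "'a \<Rightarrow> ennreal"
  assumes \<phi>[measurable]: "\<phi> \<in> borel_measurable borel" and inv: "\<And>x. \<psi> (\<phi> x) = x"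
    and lip: "\<And>x y. dist (\<psi> x) (\<psi> y) \<le> L * dist x y" and L: "L > 0"
    and [measurable]: "h \<in> borel_measurable borel"
  shows "(\<integral>\<^sup>+x. h (\<phi> x) \<partial>lborel) \<le> ennreal (L powr real DIM('a)) * (\<integral>\<^sup>+x. h x \<partial>lborel)"
proof -
  let ?c = "ennreal (L powr real DIM('a))"
  have le: "emeasure (distr lborel borel \<phi>) A \<le> emeasure (density lborel (\<lambda>_. ?c)) A" if A: "A \<in> sets borel" for A
  proof -
    have [measurable]: "A \<in> sets borel" by (rule A)
    have "emeasure lborel (\<phi> -` A) \<le> ?c * emeasure lborel A"
    proof (rule ennreal_le_epsilon)
      fix e :: real assume e: "e > 0"
      define e' where "e' = e / L powr real DIM('a)"
      have e': "e' > 0" using e L by (simp add: e'_def)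
      obtain U where U: "open U" "A \<subseteq> U" "emeasure lborel (U - A) < e'"
        using outer_regular_lborel[OF A e'] by blast
      have [measurable]: "U \<in> sets borel" using U(1) by simp
      have "emeasure lborel (\<phi> -` A) \<le> emeasure lborel (\<phi> -` U)"
        using U(2) measurable_sets[OF \<phi>, of U] by (intro emeasure_mono) auto
      also have "\<dots> \<le> ?c * emeasure lborel U" by (rule emeasure_vimage_open_le[OF \<phi> inv lip L U(1)])
      also have "emeasure lborel U = emeasure lborel (A \<union> (U - A))" using U(2) by (simp add: Un_absorb1)
      also have "\<dots> = emeasure lborel A + emeasure lborel (U - A)" by (subst plus_emeasure[symmetric]) auto
      also have "?c * (emeasure lborel A + emeasure lborel (U - A)) \<le> ?c * (emeasure lborel A + ennreal e')"
        using U(3) by (intro mult_left_mono add_left_mono) auto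
      also have "\<dots> = ?c * emeasure lborel A + ennreal e"
        using e L by (simp add: distrib_left ennreal_mult[symmetric] e'_def)
      finally show "emeasure lborel (\<phi> -` A) \<le> ?c * emeasure lborel A + ennreal e" .
    qed
    then show ?thesis by (simp add: emeasure_distr emeasure_density nn_integral_cmult_indicator)
  qed
  have "(\<integral>\<^sup>+x. h (\<phi> x) \<partial>lborel) = (\<integral>\<^sup>+x. h x \<partial>distr lborel borel \<phi>)"
    by (subst nn_integral_distr) auto
  also have "\<dots> \<le> (\<integral>\<^sup>+x. h x \<partial>density lborel (\<lambda>_. ?c))"
    by (rule nn_integral_mono_measure) (auto simp: le_measure le)
  also have "\<dots> = ?c * (\<integral>\<^sup>+x. h x \<partial>lborel)"
    by (simp add: nn_integral_density nn_integral_cmult)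
  finally show ?thesis .
qed



section \<open>Cut-off dilations\<close>

text \<open>
  A piecewise linear function of slope at most 2 that equals \<open>r\<close> on \<open>{2 * \<delta>..R}\<close> and vanishes outside
  \<open>{\<delta><..<2 * R}\<close>. The slope bound does not depend on \<open>\<delta>\<close> and \<open>R\<close>.
\<close>

definition cutoff_radius :: "real \<Rightarrow> real \<Rightarrow> real \<Rightarrow> real" where
  "cutoff_radius \<delta> R r = max 0 (min (2 * (r - \<delta>)) (min r (2 * R - r)))"

definition local_dilation :: "real \<Rightarrow> real \<Rightarrow> real \<Rightarrow> 'a::euclidean_space \<Rightarrow> 'a" where
  "local_dilation \<delta> R \<epsilon> x = (1 + \<epsilon> * (cutoff_radius \<delta> R (norm x) / norm x)) *\<^sub>R x"

lemma cutoff_radius: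
  "cutoff_radius \<delta> R r \<ge> 0" "r \<ge> 0 \<Longrightarrow> cutoff_radius \<delta> R r \<le> r"
  "\<bar>cutoff_radius \<delta> R r - cutoff_radius \<delta> R r'\<bar> \<le> 2 * \<bar>r - r'\<bar>"
  "0 < \<delta> \<Longrightarrow> 2 * \<delta> \<le> r \<Longrightarrow> r \<le> R \<Longrightarrow> cutoff_radius \<delta> R r = r"
  "r \<notin> {\<delta><..<2 * R} \<Longrightarrow> cutoff_radius \<delta> R r = 0"
proof -
  show "cutoff_radius \<delta> R r \<ge> 0" "r \<ge> 0 \<Longrightarrow> cutoff_radius \<delta> R r \<le> r"
    by (simp_all add: cutoff_radius_def)
  have mn: "\<bar>min a b - min c d\<bar> \<le> K" "\<bar>max a b - max c d\<bar> \<le> K" 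
    if "\<bar>a - c\<bar> \<le> K" "\<bar>b - d\<bar> \<le> K" for a b c d K :: real
    using that by (auto simp: min_def max_def abs_le_iff)
  show "\<bar>cutoff_radius \<delta> R r - cutoff_radius \<delta> R r'\<bar> \<le> 2 * \<bar>r - r'\<bar>"
    unfolding cutoff_radius_def by (intro mn) (simp_all add: abs_if)
  show "0 < \<delta> \<Longrightarrow> 2 * \<delta> \<le> r \<Longrightarrow> r \<le> R \<Longrightarrow> cutoff_radius \<delta> R r = r"
    by (simp add: cutoff_radius_def)
  show "r \<notin> {\<delta><..<2 * R} \<Longrightarrow> cutoff_radius \<delta> R r = 0"
    by (auto simp: cutoff_radius_def not_less min.coboundedI1 min.coboundedI2)
qed

lemma cutoff_field_lipschitz:
  fixes x y :: "'a::euclidean_space"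
  shows "norm ((cutoff_radius \<delta> R (norm x) / norm x) *\<^sub>R x - (cutoff_radius \<delta> R (norm y) / norm y) *\<^sub>R y) \<le> 4 * norm (x - y)"
proof -
  let ?m = "cutoff_radius \<delta> R"
  have b: "norm ((?m (norm z) / norm z) *\<^sub>R z) \<le> norm z" for z :: 'a
    using cutoff_radius(1)[of \<delta> R "norm z"] cutoff_radius(2)[of "norm z" \<delta> R] by simp
  show ?thesis
  proof (cases "x = 0 \<or> y = 0")
    case True
    then show ?thesis using b[of x] b[of y] by auto
  next
    case False
    define a c where "a = norm x" and "c = norm y"
    have a: "a > 0" "c > 0" using False by (auto simp: a_def c_def)
    have ac: "\<bar>a - c\<bar> \<le> norm (x - y)" unfolding a_def c_def by (rule norm_triangle_ineq3)
    have m1: "0 \<le> ?m a / a" "?m a / a \<le> 1" using cutoff_radius(1)[of \<delta> R a] cutoff_radius(2)[of a \<delta> R] a by auto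
    have "\<bar>?m a / a - ?m c / c\<bar> * c = \<bar>(?m a - ?m c) + ?m a / a * (c - a)\<bar>"
    proof -
      have "\<bar>?m a / a - ?m c / c\<bar> * c = \<bar>(?m a / a - ?m c / c) * c\<bar>" using a by (simp add: abs_mult)
      also have "(?m a / a - ?m c / c) * c = (?m a - ?m c) + ?m a / a * (c - a)"
        using a by (simp add: field_simps)
      finally show ?thesis .
    qed
    also have "\<dots> \<le> \<bar>?m a - ?m c\<bar> + ?m a / a * \<bar>c - a\<bar>"
      by (rule order_trans[OF abs_triangle_ineq]) (simp only: abs_mult abs_of_nonneg[OF m1(1)] order_refl)
    also have "\<dots> \<le> 2 * \<bar>a - c\<bar> + 1 * \<bar>a - c\<bar>"
      using m1 cutoff_radius(3)[of \<delta> R a c] by (intro add_mono mult_mono) auto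
    also have "\<dots> \<le> 3 * norm (x - y)" using ac by simp
    finally have k: "\<bar>?m a / a - ?m c / c\<bar> * c \<le> 3 * norm (x - y)" .
    have "(?m a / a) *\<^sub>R x - (?m c / c) *\<^sub>R y = (?m a / a) *\<^sub>R (x - y) + (?m a / a - ?m c / c) *\<^sub>R y"
      by (simp add: algebra_simps)
    then have "norm ((?m a / a) *\<^sub>R x - (?m c / c) *\<^sub>R y) \<le> ?m a / a * norm (x - y) + \<bar>?m a / a - ?m c / c\<bar> * c"
      using norm_triangle_ineq[of "(?m a / a) *\<^sub>R (x - y)" "(?m a / a - ?m c / c) *\<^sub>R y"]
      by (simp only: norm_scaleR abs_of_nonneg[OF m1(1)] c_def)
    also have "\<dots> \<le> 1 * norm (x - y) + 3 * norm (x - y)"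
      using m1 k by (intro add_mono mult_right_mono) auto
    finally show ?thesis by (simp add: a_def c_def)
  qed
qed

text \<open>
  The bound \<open>\<epsilon> \<le> 1/8\<close> makes both the map, with constant \<open>1 + 4 \<epsilon>\<close>, and its inverse, with constant
  \<open>1 / (1 - 4 \<epsilon>)\<close>, Lipschitz with the constant \<open>\<Lambda> = 1 + 8 \<epsilon>\<close>.
\<close>

locale cut_off_dilation =
  fixes \<delta> R \<epsilon> :: real
  assumes \<delta>: "0 < \<delta>" and \<delta>R: "4 * \<delta> \<le> R" and \<epsilon>: "0 < \<epsilon>" "\<epsilon> \<le> 1 / 8"
begin

abbreviation \<phi> :: "'a::euclidean_space \<Rightarrow> 'a" where "\<phi> \<equiv> local_dilation \<delta> R \<epsilon>"
abbreviation \<Lambda> :: real where "\<Lambda> \<equiv> 1 + 8 * \<epsilon>"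

lemma norm_phi: "norm (\<phi> x) = norm x + \<epsilon> * cutoff_radius \<delta> R (norm x)"
proof (cases "x = 0")
  case False
  then show ?thesis
    using \<epsilon> cutoff_radius(1)[of \<delta> R "norm x"] by (simp add: local_dilation_def field_simps)
qed (use \<delta> in \<open>simp add: local_dilation_def cutoff_radius(5)\<close>)

lemma norm_phi_bounds: "norm x \<le> norm (\<phi> x)" "norm (\<phi> x) \<le> (1 + \<epsilon>) * norm x"
  using \<epsilon> cutoff_radius(1)[of \<delta> R "norm x"] cutoff_radius(2)[of "norm x" \<delta> R]
  by (auto simp: norm_phi algebra_simps mult_left_mono)

lemma phi_lipschitz:
  fixes x y :: "'a::euclidean_space"
  shows "norm (\<phi> x - \<phi> y) \<le> (1 + 4 * \<epsilon>) * norm (x - y)"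
    and "(1 - 4 * \<epsilon>) * norm (x - y) \<le> norm (\<phi> x - \<phi> y)"
proof -
  let ?T = "\<lambda>z. (cutoff_radius \<delta> R (norm z) / norm z) *\<^sub>R z"
  have d: "\<phi> x - \<phi> y = (x - y) + \<epsilon> *\<^sub>R (?T x - ?T y)" by (simp add: local_dilation_def algebra_simps)
  have T: "norm (\<epsilon> *\<^sub>R (?T x - ?T y)) \<le> \<epsilon> * (4 * norm (x - y))"
    using cutoff_field_lipschitz[of \<delta> R x y] \<epsilon> by simp
  have *: "norm (a + b) \<le> (1 + 4 * \<epsilon>) * norm a" "(1 - 4 * \<epsilon>) * norm a \<le> norm (a + b)"
    if "norm b \<le> \<epsilon> * (4 * norm a)" for a b :: 'a
    using that norm_triangle_ineq[of a b] norm_diff_ineq[of a b] by (simp_all add: left_diff_distrib distrib_right)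
  show "norm (\<phi> x - \<phi> y) \<le> (1 + 4 * \<epsilon>) * norm (x - y)"
    "(1 - 4 * \<epsilon>) * norm (x - y) \<le> norm (\<phi> x - \<phi> y)"
    unfolding d by (rule *[OF T])+
qed

text \<open>
  Surjectivity is the intermediate value theorem for \<open>r + \<epsilon> cutoff_radius \<delta> R r\<close> on the ray through
  the given point.
\<close>

lemma phi_bij: "bij (\<phi> :: 'a::euclidean_space \<Rightarrow> 'a)"
proof (rule bijI)
  show "inj (\<phi> :: 'a \<Rightarrow> 'a)"
  proof (rule injI)
    fix x y :: 'a assume "\<phi> x = \<phi> y"
    then have "(1 - 4 * \<epsilon>) * norm (x - y) \<le> 0" using phi_lipschitz(2)[of x y] by simp
    then show "x = y" using \<epsilon> by (simp add: mult_le_0_iff)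
  qed
  have "\<exists>x. \<phi> x = z" for z :: 'a
  proof (cases "z = 0")
    case True
    then show ?thesis by (intro exI[of _ 0]) (simp add: local_dilation_def)
  next
    case False
    let ?k = "\<lambda>r. r + \<epsilon> * cutoff_radius \<delta> R r"
    have "continuous_on {0..norm z} ?k" unfolding cutoff_radius_def by (intro continuous_intros)
    moreover have "?k 0 \<le> norm z" using \<delta> by (simp add: cutoff_radius(5))
    moreover have "norm z \<le> ?k (norm z)" using \<epsilon> cutoff_radius(1) by simp
    ultimately obtain r where r: "0 \<le> r" "?k r = norm z" using IVT'[of ?k 0 "norm z" "norm z"] by auto
    have r0: "r > 0"
    proof (rule ccontr)
      assume "\<not> r > 0" then have "r = 0" using r by simp
      then show False using r \<delta> False by (simp add: cutoff_radius(5))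
    qed
    have "\<phi> ((r / norm z) *\<^sub>R z) = ((r + \<epsilon> * cutoff_radius \<delta> R r) / norm z) *\<^sub>R z"
      using r0 False by (simp add: local_dilation_def field_simps)
    also have "\<dots> = z" using r False by simp
    finally show ?thesis by blast
  qed
  then show "surj (\<phi> :: 'a \<Rightarrow> 'a)" by (metis surjI)
qed

lemma phi_continuous: "continuous_on UNIV (\<phi> :: 'a::euclidean_space \<Rightarrow> 'a)"
proof (rule lipschitz_on_continuous_on)
  show "(1 + 4 * \<epsilon>)-lipschitz_on UNIV (\<phi> :: 'a \<Rightarrow> 'a)"
    using phi_lipschitz(1) \<epsilon> by (intro lipschitz_onI) (auto simp: dist_norm)
qed

lemma phi_measurable[measurable]: "(\<phi> :: 'a::euclidean_space \<Rightarrow> 'a) \<in> borel_measurable borel"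
  using phi_continuous by (rule borel_measurable_continuous_onI)

lemma inv_phi_lipschitz: "dist (inv \<phi> x) (inv \<phi> y) \<le> \<Lambda> * dist x y"
proof -
  have s: "\<phi> (inv \<phi> z) = z" for z by (simp add: phi_bij bij_is_surj surj_f_inv_f)
  have "(1 - 4 * \<epsilon>) * dist (inv \<phi> x) (inv \<phi> y) \<le> dist x y"
    using phi_lipschitz(2)[of "inv \<phi> x" "inv \<phi> y"] by (simp add: s dist_norm)
  then have "\<Lambda> * ((1 - 4 * \<epsilon>) * dist (inv \<phi> x) (inv \<phi> y)) \<le> \<Lambda> * dist x y"
    using \<epsilon> by (intro mult_left_mono) auto
  moreover have "1 \<le> \<Lambda> * (1 - 4 * \<epsilon>)"
  proof -
    have "\<epsilon> * \<epsilon> \<le> \<epsilon> * (1 / 8)" using \<epsilon> by (intro mult_left_mono) auto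
    then show ?thesis by (simp add: algebra_simps)
  qed
  then have "1 * dist (inv \<phi> x) (inv \<phi> y) \<le> \<Lambda> * (1 - 4 * \<epsilon>) * dist (inv \<phi> x) (inv \<phi> y)"
    by (intro mult_right_mono) auto
  ultimately show ?thesis by (simp add: mult.assoc)
qed

lemma nn_integral_phi:
  fixes h :: "'a::euclidean_space \<Rightarrow> ennreal"
  assumes [measurable]: "h \<in> borel_measurable borel"
  shows "(\<integral>\<^sup>+x. h (\<phi> x) \<partial>lborel) \<le> ennreal (\<Lambda> powr real DIM('a)) * (\<integral>\<^sup>+x. h x \<partial>lborel)"
    and "(\<integral>\<^sup>+x. h x \<partial>lborel) \<le> ennreal (\<Lambda> powr real DIM('a)) * (\<integral>\<^sup>+x. h (\<phi> x) \<partial>lborel)"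
proof -
  have "bij (\<phi> :: 'a \<Rightarrow> 'a)" by (rule phi_bij)
  then have inv: "\<And>x :: 'a. inv \<phi> (\<phi> x) = x" "\<And>x :: 'a. \<phi> (inv \<phi> x) = x"
    by (simp_all add: bij_is_surj surj_f_inv_f bij_is_inj)
  have "continuous_on UNIV (inv \<phi> :: 'a \<Rightarrow> 'a)"
    using inv_phi_lipschitz \<epsilon> by (intro lipschitz_on_continuous_on[of \<Lambda>] lipschitz_onI) auto
  then have m: "(inv \<phi> :: 'a \<Rightarrow> 'a) \<in> borel_measurable borel" by (rule borel_measurable_continuous_onI)
  show "(\<integral>\<^sup>+x. h (\<phi> x) \<partial>lborel) \<le> ennreal (\<Lambda> powr real DIM('a)) * (\<integral>\<^sup>+x. h x \<partial>lborel)"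
    using \<epsilon> by (intro nn_integral_lipschitz_inverse_le[OF phi_measurable inv(1) inv_phi_lipschitz]) auto
  have lip: "dist (\<phi> x) (\<phi> y) \<le> \<Lambda> * dist x y" for x y :: 'a
  proof -
    have "dist (\<phi> x) (\<phi> y) \<le> (1 + 4 * \<epsilon>) * dist x y" using phi_lipschitz(1) by (simp add: dist_norm)
    also have "\<dots> \<le> \<Lambda> * dist x y" using \<epsilon> by (intro mult_right_mono) auto
    finally show ?thesis .
  qed
  have "(\<integral>\<^sup>+x. h (\<phi> (inv \<phi> x)) \<partial>lborel) \<le> ennreal (\<Lambda> powr real DIM('a)) * (\<integral>\<^sup>+x. h (\<phi> x) \<partial>lborel)"
    using \<epsilon> by (intro nn_integral_lipschitz_inverse_le[OF m inv(2) lip, where h = "\<lambda>x. h (\<phi> x)"]) auto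
  then show "(\<integral>\<^sup>+x. h x \<partial>lborel) \<le> ennreal (\<Lambda> powr real DIM('a)) * (\<integral>\<^sup>+x. h (\<phi> x) \<partial>lborel)"
    by (simp add: inv)
qed

text \<open>
  An annulus in the target space over which the map is the exact dilation. The inner radius
  \<open>4 * \<delta>\<close> instead of \<open>2 * \<delta>\<close> leaves room for the factor \<open>1 + \<epsilon>\<close>, so that the annulus can be the same
  for all \<open>\<epsilon>\<close>.
\<close>

definition core :: "'a::euclidean_space set" where "core = {x. 4 * \<delta> \<le> norm x \<and> norm x \<le> R}"

lemma core_measurable[measurable]: "core \<in> sets borel"
  unfolding core_def by measurable

lemma core_phi:
  "\<phi> x \<in> core \<Longrightarrow> \<phi> x = (1 + \<epsilon>) *\<^sub>R x"
  "(1 + \<epsilon>) *\<^sub>R x \<in> core \<Longrightarrow> \<phi> x = (1 + \<epsilon>) *\<^sub>R x"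
proof -
  have *: "\<phi> x = (1 + \<epsilon>) *\<^sub>R x" if "2 * \<delta> \<le> norm x" "norm x \<le> R"
    using cutoff_radius(4)[OF \<delta> that] that \<delta> by (simp add: local_dilation_def)
  have 1: "(1 + \<epsilon>) * norm x \<le> 2 * norm x" using \<epsilon> by (intro mult_right_mono) auto
  show "\<phi> x = (1 + \<epsilon>) *\<^sub>R x" if "\<phi> x \<in> core"
    using that norm_phi_bounds[of x] 1 by (intro *) (auto simp: core_def)
  have 2: "1 * norm x \<le> (1 + \<epsilon>) * norm x" using \<epsilon> by (intro mult_right_mono) auto
  show "\<phi> x = (1 + \<epsilon>) *\<^sub>R x" if "(1 + \<epsilon>) *\<^sub>R x \<in> core"
    using that 1 2 \<epsilon> by (intro *) (auto simp: core_def)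
qed

lemma indicator_core_phi: "indicator core (\<phi> x) = (indicator core ((1 + \<epsilon>) *\<^sub>R x) :: ennreal)"
proof (cases "\<phi> x \<in> core")
  case True
  then show ?thesis using core_phi(1)[OF True] by simp
next
  case False
  then have "(1 + \<epsilon>) *\<^sub>R x \<notin> core" using core_phi(2)[of x] by auto
  then show ?thesis using False by simp
qed

lemma nn_integral_phi_core:
  fixes h :: "'a::euclidean_space \<Rightarrow> ennreal"
  assumes [measurable]: "h \<in> borel_measurable borel"
  shows "(\<integral>\<^sup>+x. h (\<phi> x) * indicator core (\<phi> x) \<partial>lborel)
    = ennreal ((1 + \<epsilon>) powr - real DIM('a)) * (\<integral>\<^sup>+x. h x * indicator core x \<partial>lborel)"
proof -
  have "h (\<phi> x) * indicator core (\<phi> x) = h ((1 + \<epsilon>) *\<^sub>R x) * indicator core ((1 + \<epsilon>) *\<^sub>R x)" for x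
  proof (cases "\<phi> x \<in> core")
    case True
    then show ?thesis using core_phi(1)[OF True] by simp
  next
    case False
    then show ?thesis using indicator_core_phi[of x] by simp
  qed
  then show ?thesis using nn_integral_scale[of "\<lambda>x. h x * indicator core x" "1 + \<epsilon>"] \<epsilon> by simp
qed

lemma nn_integral_phi_le:
  fixes h :: "'a::euclidean_space \<Rightarrow> ennreal"
  assumes [measurable]: "h \<in> borel_measurable borel"
  shows "(\<integral>\<^sup>+x. h (\<phi> x) \<partial>lborel) \<le> 
    (\<integral>\<^sup>+x. ennreal (if x \<in> core then (1 + \<epsilon>) powr - real DIM('a) else \<Lambda> powr real DIM('a)) * h x \<partial>lborel)"
proof -
  have "(\<integral>\<^sup>+x. h (\<phi> x) \<partial>lborel) 
      = (\<integral>\<^sup>+x. h (\<phi> x) * indicator core (\<phi> x) + h (\<phi> x) * indicator (- core) (\<phi> x) \<partial>lborel)"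
    by (intro nn_integral_cong) (auto simp: indicator_def)
  also have "\<dots> = (\<integral>\<^sup>+x. h (\<phi> x) * indicator core (\<phi> x) \<partial>lborel) + (\<integral>\<^sup>+x. h (\<phi> x) * indicator (- core) (\<phi> x) \<partial>lborel)"
    by (rule nn_integral_add) measurable
  also have "\<dots> \<le> ennreal ((1 + \<epsilon>) powr - real DIM('a)) * (\<integral>\<^sup>+x. h x * indicator core x \<partial>lborel)
     + ennreal (\<Lambda> powr real DIM('a)) * (\<integral>\<^sup>+x. h x * indicator (- core) x \<partial>lborel)"
    by (intro add_mono nn_integral_phi(1)[of "\<lambda>x. h x * indicator (- core) x"]) (auto simp: nn_integral_phi_core)
  also have "\<dots> = (\<integral>\<^sup>+x. ennreal ((1 + \<epsilon>) powr - real DIM('a)) * (h x * indicator core x)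
     + ennreal (\<Lambda> powr real DIM('a)) * (h x * indicator (- core) x) \<partial>lborel)"
    by (subst nn_integral_add) (auto simp: nn_integral_cmult)
  also have "\<dots> = (\<integral>\<^sup>+x. ennreal (if x \<in> core then (1 + \<epsilon>) powr - real DIM('a) else \<Lambda> powr real DIM('a)) * h x \<partial>lborel)"
    by (intro nn_integral_cong) (auto simp: indicator_def)
  finally show ?thesis .
qed

lemma nn_integral_phi_ge:
  fixes h :: "'a::euclidean_space \<Rightarrow> ennreal"
  assumes [measurable]: "h \<in> borel_measurable borel"
  shows "(\<integral>\<^sup>+x. ennreal (if x \<in> core then (1 + \<epsilon>) powr - real DIM('a) else \<Lambda> powr - real DIM('a)) * h x \<partial>lborel)
    \<le> (\<integral>\<^sup>+x. h (\<phi> x) \<partial>lborel)"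
proof -
  have "(\<integral>\<^sup>+x. ennreal (if x \<in> core then (1 + \<epsilon>) powr - real DIM('a) else \<Lambda> powr - real DIM('a)) * h x \<partial>lborel)
     = (\<integral>\<^sup>+x. ennreal ((1 + \<epsilon>) powr - real DIM('a)) * (h x * indicator core x)
     + ennreal (\<Lambda> powr - real DIM('a)) * (h x * indicator (- core) x) \<partial>lborel)"
    by (intro nn_integral_cong) (auto simp: indicator_def)
  also have "\<dots> = ennreal ((1 + \<epsilon>) powr - real DIM('a)) * (\<integral>\<^sup>+x. h x * indicator core x \<partial>lborel)
     + ennreal (\<Lambda> powr - real DIM('a)) * (\<integral>\<^sup>+x. h x * indicator (- core) x \<partial>lborel)"
    by (subst nn_integral_add) (auto simp: nn_integral_cmult)
  also have "\<dots> \<le> (\<integral>\<^sup>+x. h (\<phi> x) * indicator core (\<phi> x) \<partial>lborel) + (\<integral>\<^sup>+x. h (\<phi> x) * indicator (- core) (\<phi> x) \<partial>lborel)"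
  proof (intro add_mono)
    have "ennreal (\<Lambda> powr - real DIM('a)) * (\<integral>\<^sup>+x. h x * indicator (- core) x \<partial>lborel)
      \<le> ennreal (\<Lambda> powr - real DIM('a)) * (ennreal (\<Lambda> powr real DIM('a)) * (\<integral>\<^sup>+x. h (\<phi> x) * indicator (- core) (\<phi> x) \<partial>lborel))"
      by (intro mult_left_mono nn_integral_phi(2)[of "\<lambda>x. h x * indicator (- core) x"]) auto
    also have "\<dots> = (\<integral>\<^sup>+x. h (\<phi> x) * indicator (- core) (\<phi> x) \<partial>lborel)"
      using \<epsilon> by (simp add: mult.assoc[symmetric] ennreal_mult[symmetric] powr_add[symmetric])
    finally show "ennreal (\<Lambda> powr - real DIM('a)) * (\<integral>\<^sup>+x. h x * indicator (- core) x \<partial>lborel)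
      \<le> (\<integral>\<^sup>+x. h (\<phi> x) * indicator (- core) (\<phi> x) \<partial>lborel)" .
  qed (simp add: nn_integral_phi_core)
  also have "\<dots> = (\<integral>\<^sup>+x. h (\<phi> x) * indicator core (\<phi> x) + h (\<phi> x) * indicator (- core) (\<phi> x) \<partial>lborel)"
    by (rule nn_integral_add[symmetric]) measurable
  also have "\<dots> = (\<integral>\<^sup>+x. h (\<phi> x) \<partial>lborel)"
    by (intro nn_integral_cong) (auto simp: indicator_def)
  finally show ?thesis .
qed

lemma AE_phi:
  assumes P: "AE x::'a::euclidean_space in lborel. P x"
  shows "AE x::'a in lborel. P (\<phi> x)"
proof -
  obtain S where S: "S \<in> sets lborel" "{x \<in> space lborel. \<not> P x} \<subseteq> S" "emeasure lborel S = 0"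
    using P by (auto elim!: AE_E)
  have [measurable]: "S \<in> sets borel" using S by simp
  have "(\<integral>\<^sup>+x. indicator S (\<phi> x) \<partial>lborel) = 0"
    using nn_integral_phi(1)[of "indicator S :: 'a \<Rightarrow> ennreal"] S by simp
  then have "AE x in lborel. (indicator S (\<phi> x) :: ennreal) = 0"
    by (subst (asm) nn_integral_0_iff_AE) auto
  then show ?thesis by eventually_elim (use S in \<open>auto simp: indicator_def split: if_splits\<close>)
qed

end

section \<open>The Bregman remainder\<close>

text \<open>
  The volume of the shell is \<open>\<tau>^N - (\<tau> / (1 + e))^N\<close> times that of the unit ball; Bernoulli's
  inequality gives the bound, which is linear in the relative thickness.
\<close>

lemma emeasure_shell_le:
  assumes \<tau>: "\<tau> > 0" and e: "0 < e" "e \<le> 1"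
  shows "emeasure lborel {x::'a::euclidean_space. norm x \<le> \<tau> \<and> \<tau> \<le> (1 + e) * norm x}
    \<le> ennreal (unit_ball_vol (real DIM('a)) * real DIM('a) * e * \<tau> powr real DIM('a))"
proof -
  let ?V = "unit_ball_vol (real DIM('a))" and ?n = "DIM('a)"
  have V: "?V \<ge> 0" by simp
  have eq: "{x::'a. norm x \<le> \<tau> \<and> \<tau> \<le> (1 + e) * norm x} = cball 0 \<tau> - ball 0 (\<tau> / (1 + e))"
    using e by (auto simp: field_simps)
  have le: "\<tau> / (1 + e) \<le> \<tau>" using \<tau> e by (simp add: field_simps)
  have "emeasure lborel (cball (0::'a) \<tau> - ball 0 (\<tau> / (1 + e))) 
      = emeasure lborel (cball (0::'a) \<tau>) - emeasure lborel (ball (0::'a) (\<tau> / (1 + e)))"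
    using le \<tau> e by (intro emeasure_Diff) (auto simp: emeasure_ball)
  also have "\<dots> = ennreal (?V * \<tau> ^ ?n - ?V * (\<tau> / (1 + e)) ^ ?n)"
    using \<tau> e by (simp add: emeasure_ball emeasure_cball ennreal_minus)
  also have "\<dots> \<le> ennreal (?V * real ?n * e * \<tau> powr real ?n)"
  proof (rule ennreal_leI)
    have "1 - e \<le> 1 / (1 + e)"
      using e by (simp add: field_simps)
    then have "(1 - e) ^ ?n \<le> (1 / (1 + e)) ^ ?n" using e by (intro power_mono) auto
    moreover have "1 + real ?n * (- e) \<le> (1 + (- e)) ^ ?n"
      using e by (intro Bernoulli_inequality) auto
    ultimately have "1 - (1 / (1 + e)) ^ ?n \<le> real ?n * e" by simp
    then have "?V * \<tau> ^ ?n * (1 - (1 / (1 + e)) ^ ?n) \<le> ?V * \<tau> ^ ?n * (real ?n * e)"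
      using V \<tau> by (intro mult_left_mono) auto
    then show "?V * \<tau> ^ ?n - ?V * (\<tau> / (1 + e)) ^ ?n \<le> ?V * real ?n * e * \<tau> powr real ?n"
      using \<tau> by (simp add: powr_realpow power_divide algebra_simps)
  qed
  finally show ?thesis unfolding eq .
qed

text \<open>
  By Fubini, the integral is at most the integral over \<open>t\<close> of \<open>F0 t\<close> times the integral of
  \<open>|x|^\<alpha> |v^(q-1) - u^(q-1)|\<close> over the shell \<open>t / (1 + e) \<le> |x| \<le> t\<close>. The volume of the shell accounts
  for a factor \<open>e\<close>; what is left tends to 0 for every \<open>t\<close> by continuity of \<open>f\<close>, and is dominated by
  means of the decreasing majorant \<open>W\<close> of \<open>f^(q-1)\<close>.
\<close>

lemma bregman_little_o:
  fixes u :: "'a::euclidean_space \<Rightarrow> real" and v :: "nat \<Rightarrow> 'a \<Rightarrow> real" and f F0 W :: "real \<Rightarrow> real"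
  assumes [measurable]: "u \<in> borel_measurable borel" "\<And>n. v n \<in> borel_measurable borel"
    "F0 \<in> borel_measurable borel"
    and e: "\<And>n. 0 < e n" "\<And>n. e n \<le> 1" "e \<longlonglongrightarrow> 0"
    and uf: "AE x in lborel. u x = f (norm x)"
    and vf: "\<And>n. AE x in lborel. v n x = f (k n (norm x))"
    and k: "\<And>n r. r > 0 \<Longrightarrow> r \<le> k n r" "\<And>n r. r > 0 \<Longrightarrow> k n r \<le> (1 + e n) * r"
    and f0: "\<And>r. r > 0 \<Longrightarrow> f r \<ge> 0" and fc: "continuous_on {0<..} f"
    and F0: "\<And>t. F0 t \<ge> 0"
    and inc: "\<And>n r. r > 0 \<Longrightarrow> ennreal \<bar>f (k n r) - f r\<bar>
        \<le> (\<integral>\<^sup>+t. ennreal (F0 t) * indicator {r..(1 + e n) * r} t \<partial>lborel)"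
    and W: "\<And>r. r > 0 \<Longrightarrow> f r powr (q - 1) \<le> W r" "\<And>r s. 0 < r \<Longrightarrow> r \<le> s \<Longrightarrow> W s \<le> W r"
    and [measurable]: "W \<in> borel_measurable borel"
    and fin: "(\<integral>\<^sup>+t. indicator {0<..} t * ennreal (F0 t * (t powr (real DIM('a) + \<alpha>) * W (t / 2))) \<partial>lborel) < \<infinity>"
    and q: "q > 1"
  shows "(\<lambda>n. ennreal (1 / e n) * (\<integral>\<^sup>+x. ennreal (norm x powr \<alpha> * \<bar>v n x powr (q - 1) - u x powr (q - 1)\<bar> * \<bar>v n x - u x\<bar>) \<partial>lborel)) \<longlonglongrightarrow> 0"
proof -
  let ?N = "real DIM('a)"
  have [measurable]: "{0::real<..} \<in> sets borel" by simp
  define \<omega> where "\<omega> n x = \<bar>v n x powr (q - 1) - u x powr (q - 1)\<bar>" for n x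
  have [measurable]: "\<omega> n \<in> borel_measurable borel" for n unfolding \<omega>_def[abs_def] by measurable
  define J where "J n x t = (if norm x \<le> t \<and> t \<le> (1 + e n) * norm x then ennreal (norm x powr \<alpha> * \<omega> n x) else 0)" for n x t
  have J[measurable]: "(\<lambda>(x, t). J n x t) \<in> borel_measurable (borel \<Otimes>\<^sub>M borel)" for n
    unfolding J_def case_prod_beta by measurable
  define I where "I n t = (\<integral>\<^sup>+x. J n x t \<partial>lborel)" for n t
  have [measurable]: "I n \<in> borel_measurable borel" for n
  proof -
    have "(\<lambda>(t, x). J n x t) \<in> borel_measurable (borel \<Otimes>\<^sub>M lborel)"
      unfolding J_def case_prod_beta by measurable
    from lborel.borel_measurable_nn_integral[OF this] show ?thesis by (simp add: I_def[abs_def])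
  qed
  define C where "C = unit_ball_vol ?N * ?N * 2 powr \<bar>\<alpha>\<bar>"
  have C0: "C \<ge> 0" by (simp add: C_def)
  have W0: "W r \<ge> 0" if "r > 0" for r using W(1)[OF that] order_trans[OF powr_ge_zero] by blast
  have ae: "AE x in lborel. x \<noteq> 0 \<and> u x = f (norm x) \<and> v n x = f (k n (norm x))" for n
    using uf vf[of n] AE_lborel_singleton[of 0] by eventually_elim auto
  have step1: "(\<integral>\<^sup>+x. ennreal (norm x powr \<alpha> * \<omega> n x * \<bar>v n x - u x\<bar>) \<partial>lborel)
      \<le> (\<integral>\<^sup>+t. indicator {0<..} t * ennreal (F0 t) * I n t \<partial>lborel)" for n
  proof -
    have "(\<integral>\<^sup>+x. ennreal (norm x powr \<alpha> * \<omega> n x * \<bar>v n x - u x\<bar>) \<partial>lborel)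
      \<le> (\<integral>\<^sup>+x. (\<integral>\<^sup>+t. indicator {0<..} t * ennreal (F0 t) * J n x t \<partial>lborel) \<partial>lborel)"
    proof (rule nn_integral_mono_AE)
      show "AE x in lborel. ennreal (norm x powr \<alpha> * \<omega> n x * \<bar>v n x - u x\<bar>)
         \<le> (\<integral>\<^sup>+t. indicator {0<..} t * ennreal (F0 t) * J n x t \<partial>lborel)"
        using ae[of n]
      proof eventually_elim
        case (elim x)
        then have x: "norm x > 0" by simp
        have "ennreal (norm x powr \<alpha> * \<omega> n x * \<bar>v n x - u x\<bar>)
           = ennreal (norm x powr \<alpha> * \<omega> n x) * ennreal \<bar>f (k n (norm x)) - f (norm x)\<bar>"
          using elim by (simp add: ennreal_mult[symmetric] \<omega>_def)
        also have "\<dots> \<le> ennreal (norm x powr \<alpha> * \<omega> n x) * (\<integral>\<^sup>+t. ennreal (F0 t) * indicator {norm x..(1 + e n) * norm x} t \<partial>lborel)"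
          by (intro mult_left_mono inc x) auto
        also have "\<dots> = (\<integral>\<^sup>+t. ennreal (norm x powr \<alpha> * \<omega> n x) * (ennreal (F0 t) * indicator {norm x..(1 + e n) * norm x} t) \<partial>lborel)"
          by (rule nn_integral_cmult[symmetric]) measurable
        also have "\<dots> = (\<integral>\<^sup>+t. indicator {0<..} t * ennreal (F0 t) * J n x t \<partial>lborel)"
        proof (rule nn_integral_cong)
          fix t
          have "norm x \<le> t \<Longrightarrow> t > 0" using x by linarith
          then show "ennreal (norm x powr \<alpha> * \<omega> n x) * (ennreal (F0 t) * indicator {norm x..(1 + e n) * norm x} t)
            = indicator {0<..} t * ennreal (F0 t) * J n x t"
            by (cases "t > 0") (auto simp: J_def indicator_def mult.commute)
        qed
        finally show ?case .
      qed
    qed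
    also have "\<dots> = (\<integral>\<^sup>+t. (\<integral>\<^sup>+x. indicator {0<..} t * ennreal (F0 t) * J n x t \<partial>lborel) \<partial>lborel)"
      by (rule lborel_pair.Fubini') (unfold measurable_lborel_pair_iff case_prod_beta J_def, measurable)
    also have "\<dots> = (\<integral>\<^sup>+t. indicator {0<..} t * ennreal (F0 t) * I n t \<partial>lborel)"
      unfolding I_def J_def by (intro nn_integral_cong nn_integral_cmult) measurable
    finally show ?thesis .
  qed
  have step2: "I n t \<le> ennreal (S * C * e n * t powr (?N + \<alpha>))"
    if t: "t > 0" and S: "S \<ge> 0" "\<And>r. t / (1 + e n) \<le> r \<Longrightarrow> r \<le> t \<Longrightarrow> \<bar>f (k n r) powr (q - 1) - f r powr (q - 1)\<bar> \<le> S"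
    for n t S
  proof -
    let ?A = "{x::'a. norm x \<le> t \<and> t \<le> (1 + e n) * norm x}"
    have [measurable]: "?A \<in> sets borel" by measurable
    have "I n t \<le> (\<integral>\<^sup>+x. ennreal (2 powr \<bar>\<alpha>\<bar> * t powr \<alpha> * S) * indicator ?A x \<partial>lborel)"
      unfolding I_def
    proof (rule nn_integral_mono_AE)
      show "AE x in lborel. J n x t \<le> ennreal (2 powr \<bar>\<alpha>\<bar> * t powr \<alpha> * S) * indicator ?A x"
        using ae[of n]
      proof eventually_elim
        case (elim x)
        show ?case
        proof (cases "x \<in> ?A")
          case True
          have x: "norm x > 0" using elim by simp
          have "\<omega> n x \<le> S" using elim True e(1)[of n] S(2)[of "norm x"] by (auto simp: \<omega>_def field_simps)
          moreover have "norm x powr \<alpha> \<le> 2 powr \<bar>\<alpha>\<bar> * t powr \<alpha>"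
          proof (cases "\<alpha> \<ge> 0")
            case \<alpha>: True
            have "norm x powr \<alpha> \<le> t powr \<alpha>" using True \<alpha> by (intro powr_mono2) auto
            also have "\<dots> \<le> 2 powr \<bar>\<alpha>\<bar> * t powr \<alpha>"
              using powr_mono[of 0 "\<bar>\<alpha>\<bar>" 2] mult_right_mono[of 1 "2 powr \<bar>\<alpha>\<bar>" "t powr \<alpha>"] by simp
            finally show ?thesis .
          next
            case False
            have "t \<le> (1 + e n) * norm x" using True by simp
            also have "\<dots> \<le> 2 * norm x" using e(2)[of n] by (intro mult_right_mono) auto
            finally have "t / 2 \<le> norm x" by simp
            then have "norm x powr \<alpha> \<le> (t / 2) powr \<alpha>" using t False by (intro powr_mono2') auto
            also have "\<dots> = 2 powr \<bar>\<alpha>\<bar> * t powr \<alpha>" using t False by (simp add: powr_divide powr_minus_divide)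
            finally show ?thesis .
          qed
          ultimately have "norm x powr \<alpha> * \<omega> n x \<le> 2 powr \<bar>\<alpha>\<bar> * t powr \<alpha> * S"
            by (intro mult_mono) (auto simp: \<omega>_def)
          then show ?thesis using True by (simp add: J_def ennreal_leI)
        qed (auto simp: J_def)
      qed
    qed
    also have "\<dots> = ennreal (2 powr \<bar>\<alpha>\<bar> * t powr \<alpha> * S) * emeasure lborel ?A"
      by (simp add: nn_integral_cmult)
    also have "\<dots> \<le> ennreal (2 powr \<bar>\<alpha>\<bar> * t powr \<alpha> * S) * ennreal (unit_ball_vol ?N * ?N * e n * t powr ?N)"
      by (intro mult_left_mono emeasure_shell_le t e) auto
    also have "\<dots> = ennreal (S * C * e n * t powr (?N + \<alpha>))"
      using S e(1)[of n] by (subst ennreal_mult[symmetric]) (auto simp: C_def powr_add mult_ac)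
    finally show ?thesis .
  qed
  have lim: "(\<lambda>n. \<integral>\<^sup>+t. indicator {0<..} t * ennreal (F0 t) * (ennreal (1 / e n) * I n t) \<partial>lborel) \<longlonglongrightarrow> (\<integral>\<^sup>+t. 0 \<partial>(lborel :: real measure))"
  proof (rule nn_integral_dominated_convergence[where w = "\<lambda>t. ennreal C * (indicator {0<..} t * ennreal (F0 t * (t powr (?N + \<alpha>) * W (t / 2))))"])
    show "(\<integral>\<^sup>+t. ennreal C * (indicator {0<..} t * ennreal (F0 t * (t powr (?N + \<alpha>) * W (t / 2)))) \<partial>lborel) < \<infinity>"
      using fin by (subst nn_integral_cmult) (auto simp: ennreal_mult_less_top)
    show "AE t in lborel. indicator {0<..} t * ennreal (F0 t) * (ennreal (1 / e n) * I n t)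
      \<le> ennreal C * (indicator {0<..} t * ennreal (F0 t * (t powr (?N + \<alpha>) * W (t / 2))))" for n
    proof (rule AE_I2)
      fix t :: real
      show "indicator {0<..} t * ennreal (F0 t) * (ennreal (1 / e n) * I n t)
      \<le> ennreal C * (indicator {0<..} t * ennreal (F0 t * (t powr (?N + \<alpha>) * W (t / 2))))"
      proof (cases "t > 0")
        case True
        have "I n t \<le> ennreal (W (t / 2) * C * e n * t powr (?N + \<alpha>))"
        proof (rule step2[OF True])
          show "W (t / 2) \<ge> 0" using W0 True by simp
          fix r assume r: "t / (1 + e n) \<le> r" "r \<le> t"
          have "t / 2 \<le> t / (1 + e n)" using True e(1,2)[of n] by (intro divide_left_mono) auto
          then have "t / 2 \<le> r" using r(1) by (rule order_trans)
          then have "r > 0" using True by simp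
          have "f r powr (q - 1) \<le> W (t / 2)" "f (k n r) powr (q - 1) \<le> W (t / 2)"
            using W(1)[OF \<open>r > 0\<close>] W(1)[of "k n r"] W(2)[of "t / 2" r] W(2)[of "t / 2" "k n r"] k(1)[OF \<open>r > 0\<close>, of n] \<open>t / 2 \<le> r\<close> True
            by auto
          then show "\<bar>f (k n r) powr (q - 1) - f r powr (q - 1)\<bar> \<le> W (t / 2)"
            using powr_ge_zero[of "f r" "q - 1"] powr_ge_zero[of "f (k n r)" "q - 1"] by linarith
        qed
        then have "ennreal (F0 t) * (ennreal (1 / e n) * I n t) \<le> ennreal (F0 t) * (ennreal (1 / e n) * ennreal (W (t / 2) * C * e n * t powr (?N + \<alpha>)))"
          by (intro mult_left_mono) auto
        also have "\<dots> = ennreal (F0 t * (1 / e n * (W (t / 2) * C * e n * t powr (?N + \<alpha>))))"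
          using F0[of t] e(1)[of n] C0 W0[of "t / 2"] True by (simp only: ennreal_mult[symmetric] zero_le_divide_1_iff mult_nonneg_nonneg less_imp_le powr_ge_zero half_gt_zero)
        also have "F0 t * (1 / e n * (W (t / 2) * C * e n * t powr (?N + \<alpha>))) = C * (F0 t * (t powr (?N + \<alpha>) * W (t / 2)))"
          using e(1)[of n] by simp
        finally show ?thesis using True C0 F0[of t] W0[of "t / 2"] by (simp add: ennreal_mult[symmetric])
      qed simp
    qed
    show "AE t in lborel. (\<lambda>n. indicator {0<..} t * ennreal (F0 t) * (ennreal (1 / e n) * I n t)) \<longlonglongrightarrow> 0"
    proof (rule AE_I2)
      fix t :: real
      show "(\<lambda>n. indicator {0<..} t * ennreal (F0 t) * (ennreal (1 / e n) * I n t)) \<longlonglongrightarrow> 0"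
      proof (cases "t > 0")
        case t: True
        have "(\<lambda>n. ennreal (1 / e n) * I n t) \<longlonglongrightarrow> 0"
        proof (rule order_tendstoI)
          fix a :: ennreal assume "a > 0"
          then obtain \<eta> where \<eta>: "0 < ennreal \<eta>" "ennreal \<eta> < a" "\<eta> > 0"
            by (metis dense ennreal_cases ennreal_less_zero_iff less_top_ennreal order.strict_trans top.not_eq_extremum)
          \<comment> \<open>The bound \<open>S\<close> on the oscillation makes the estimate \<open>step2\<close> at most \<open>\<eta>\<close>; adding 1 avoids a zero denominator.\<close>
          define S where "S = \<eta> / (C * t powr (?N + \<alpha>) + 1)"
          have den: "C * t powr (?N + \<alpha>) + 1 > 0" using C0 by (simp add: add_nonneg_pos)
          have S: "S > 0" using \<eta> den by (simp add: S_def)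
          have SC: "S * (C * t powr (?N + \<alpha>)) \<le> \<eta>"
            using den \<eta> C0 by (simp add: S_def field_simps)
          have "continuous_on {0<..} (\<lambda>r. f r powr (q - 1))"
            using fc f0 q by (intro continuous_on_powr' continuous_intros) auto
          then have "isCont (\<lambda>r. f r powr (q - 1)) t" using t by (simp add: continuous_on_eq_continuous_at)
          then obtain d where d: "d > 0" "\<And>r. \<bar>r - t\<bar> < d \<Longrightarrow> \<bar>f r powr (q - 1) - f t powr (q - 1)\<bar> < S / 2"
            using S unfolding continuous_at_eps_delta dist_real_def by (metis half_gt_zero)
          have "\<forall>\<^sub>F n in sequentially. e n < d / t" using e(3) d t by (intro order_tendstoD) auto
          then show "\<forall>\<^sub>F n in sequentially. ennreal (1 / e n) * I n t < a"
          proof eventually_elim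
            case (elim n)
            have ed: "e n * t < d" using elim t by (simp add: field_simps)
            have "I n t \<le> ennreal (S * C * e n * t powr (?N + \<alpha>))"
            proof (rule step2[OF t])
              fix r assume r: "t / (1 + e n) \<le> r" "r \<le> t"
              have "t - e n * t \<le> t / (1 + e n)"
                using t e(1)[of n] by (simp add: field_simps)
              then have r1: "t - e n * t \<le> r" using r by simp
              have "t / (1 + e n) > 0" using t e(1)[of n] by (simp add: add_pos_pos)
              then have r0: "r > 0" using r by simp
              have "k n r \<le> (1 + e n) * t"
                using k(2)[OF r0, of n] r e(1)[of n] by (meson add_nonneg_nonneg less_imp_le mult_left_mono order_trans zero_le_one)
              then have "\<bar>r - t\<bar> < d" "\<bar>k n r - t\<bar> < d"
                using r1 r k(1)[OF r0, of n] ed by (auto simp: algebra_simps abs_if)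
              from d(2)[OF this(1)] d(2)[OF this(2)]
              show "\<bar>f (k n r) powr (q - 1) - f r powr (q - 1)\<bar> \<le> S" by linarith
            qed (use S in simp)
            then have "ennreal (1 / e n) * I n t \<le> ennreal (1 / e n) * ennreal (S * C * e n * t powr (?N + \<alpha>))"
              by (intro mult_left_mono) auto
            also have "\<dots> = ennreal (S * (C * t powr (?N + \<alpha>)))"
              using e(1)[of n] S C0 by (subst ennreal_mult[symmetric]) auto
            also have "\<dots> \<le> ennreal \<eta>" using SC by (rule ennreal_leI)
            also have "\<dots> < a" by (rule \<eta>)
            finally show ?case .
          qed
        qed simp
        from ennreal_tendsto_cmult[OF _ this, of "ennreal (F0 t)"] show ?thesis using t by simp
      qed simp
    qed
  qed simp_all
  show ?thesis
  proof (rule tendsto_sandwich[OF _ _ tendsto_const lim[simplified]])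
    show "\<forall>\<^sub>F n in sequentially. ennreal (1 / e n) * (\<integral>\<^sup>+x. ennreal (norm x powr \<alpha> * \<bar>v n x powr (q - 1) - u x powr (q - 1)\<bar> * \<bar>v n x - u x\<bar>) \<partial>lborel)
      \<le> (\<integral>\<^sup>+t. indicator {0<..} t * ennreal (F0 t) * (ennreal (1 / e n) * I n t) \<partial>lborel)"
    proof (rule always_eventually, rule allI)
      fix n
      have "ennreal (1 / e n) * (\<integral>\<^sup>+x. ennreal (norm x powr \<alpha> * \<omega> n x * \<bar>v n x - u x\<bar>) \<partial>lborel)
        \<le> ennreal (1 / e n) * (\<integral>\<^sup>+t. indicator {0<..} t * ennreal (F0 t) * I n t \<partial>lborel)"
        by (intro mult_left_mono step1) auto
      also have "\<dots> = (\<integral>\<^sup>+t. ennreal (1 / e n) * (indicator {0<..} t * ennreal (F0 t) * I n t) \<partial>lborel)"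
        by (rule nn_integral_cmult[symmetric]) measurable
      also have "\<dots> = (\<integral>\<^sup>+t. indicator {0<..} t * ennreal (F0 t) * (ennreal (1 / e n) * I n t) \<partial>lborel)"
        by (simp add: mult_ac)
      finally show "ennreal (1 / e n) * (\<integral>\<^sup>+x. ennreal (norm x powr \<alpha> * \<bar>v n x powr (q - 1) - u x powr (q - 1)\<bar> * \<bar>v n x - u x\<bar>) \<partial>lborel)
      \<le> (\<integral>\<^sup>+t. indicator {0<..} t * ennreal (F0 t) * (ennreal (1 / e n) * I n t) \<partial>lborel)"
        by (simp add: \<omega>_def)
    qed
  qed simp
qed

section \<open>Testing the equation with a deformed solution\<close>

lemma young_powr:
  fixes a b p :: real
  assumes p: "p > 1" and ab: "a \<ge> 0" "b \<ge> 0"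
  shows "a powr (p - 1) * b \<le> (1 - 1 / p) * a powr p + 1 / p * b powr p"
proof -
  have "a powr (p - 1) * b \<le> (a powr (p - 1)) powr (p / (p - 1)) / (p / (p - 1)) + b powr p / p"
  proof (rule Youngs_inequality)
    show "p / (p - 1) > 1" using p by simp
    show "1 / (p / (p - 1)) + 1 / p = 1" using p by (simp add: add_divide_distrib[symmetric])
  qed (use p ab in auto)
  also have "(a powr (p - 1)) powr (p / (p - 1)) = a powr p"
    using p by (simp add: powr_powr)
  also have "a powr p / (p / (p - 1)) = (1 - 1 / p) * a powr p"
    using p by (simp add: left_diff_distrib right_diff_distrib diff_divide_distrib)
  finally show ?thesis by simp
qed

lemma norm_Phi: "p > 1 \<Longrightarrow> norm (Phi p t) = norm t powr (p - 1)"
  by (cases "t = 0") (simp_all add: Phi_def powr_diff power2_eq_square)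

lemma Phi_inner_le:
  fixes a b :: "'b::real_inner"
  assumes p: "p > 1"
  shows "Phi p a \<bullet> b \<le> (1 - 1 / p) * norm a powr p + 1 / p * norm b powr p"
proof -
  have "Phi p a \<bullet> b \<le> norm (Phi p a) * norm b" by (rule norm_cauchy_schwarz)
  also have "\<dots> \<le> (1 - 1 / p) * norm a powr p + 1 / p * norm b powr p"
    unfolding norm_Phi[OF p] by (rule young_powr[OF p]) auto
  finally show ?thesis .
qed

lemma Phi_inner_self:
  fixes a :: "'b::real_inner"
  assumes p: "p > 1"
  shows "Phi p a \<bullet> a = norm a powr p"
  by (cases "a = 0") (simp_all add: Phi_def power2_norm_eq_inner[symmetric] powr_diff power2_eq_square)

text \<open>
  Young's inequality with the roles of \<open>a\<close> and \<open>b\<close> exchanged. The error is the symmetrised Bregman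
  divergence of the convex function \<open>t^q\<close>, which is quadratically small for \<open>a\<close> close to \<open>b\<close>.
\<close>

lemma bregman_lower_bound:
  fixes a b q :: real
  assumes q: "q > 1" and ab: "a \<ge> 0" "b \<ge> 0"
  shows "a powr q + 1 / q * (b powr q - a powr q) - (b powr (q - 1) - a powr (q - 1)) * (b - a) \<le> a powr (q - 1) * b"
proof -
  have e: "t powr (q - 1) * t = t powr q" if "t \<ge> 0" for t
    using that by (cases "t = 0") (simp_all add: powr_diff)
  show ?thesis using young_powr[OF q ab(2,1)] e[OF ab(1)] e[OF ab(2)] by (simp add: algebra_simps)
qed

lemma bregman_bounds:
  fixes a b q :: real
  assumes q: "q > 1" and ab: "a \<ge> 0" "b \<ge> 0"
  shows "\<bar>(b powr (q - 1) - a powr (q - 1)) * (b - a)\<bar> \<le> b powr q + a powr q"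
    and "\<bar>b powr (q - 1) - a powr (q - 1)\<bar> * \<bar>b - a\<bar> = (b powr (q - 1) - a powr (q - 1)) * (b - a)"
proof -
  have e: "t powr (q - 1) * t = t powr q" if "t \<ge> 0" for t
    using that by (cases "t = 0") (simp_all add: powr_diff)
  have "(b powr (q - 1) - a powr (q - 1)) * (b - a) \<ge> 0"
  proof (cases "a \<le> b")
    case True
    then show ?thesis using ab q by (intro mult_nonneg_nonneg) (auto intro: powr_mono2)
  next
    case False
    then show ?thesis using ab q by (intro mult_nonpos_nonpos) (auto intro: powr_mono2)
  qed
  then show "\<bar>b powr (q - 1) - a powr (q - 1)\<bar> * \<bar>b - a\<bar> = (b powr (q - 1) - a powr (q - 1)) * (b - a)"
    by (simp add: abs_mult[symmetric])
  have "a powr (q - 1) * b \<ge> 0" "b powr (q - 1) * a \<ge> 0" using ab by simp_all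
  then show "\<bar>(b powr (q - 1) - a powr (q - 1)) * (b - a)\<bar> \<le> b powr q + a powr q"
    using \<open>(b powr (q - 1) - a powr (q - 1)) * (b - a) \<ge> 0\<close> e[OF ab(1)] e[OF ab(2)] by (simp add: algebra_simps)
qed

definition nonlocal_density :: "real \<Rightarrow> real \<Rightarrow> ('a::euclidean_space \<Rightarrow> real) \<Rightarrow> 'a \<times> 'a \<Rightarrow> real" where
  "nonlocal_density s p u = (\<lambda>(x, y). \<bar>u x - u y\<bar> powr p / norm (x - y) powr (real DIM('a) + s * p))"

text \<open>
  For \<open>p > 1\<close>, the value of \<^const>\<open>L_form\<close> on the diagonal.
\<close>

definition energy :: "real \<Rightarrow> real \<Rightarrow> real \<Rightarrow> ('a::euclidean_space \<Rightarrow> real) \<Rightarrow> real" where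
  "energy \<gamma> s p u = 
     (if \<gamma> = 0 then 0 else \<gamma> * (\<integral>x. norm (weak_grad u x) powr p \<partial>lborel)) +
     (if \<gamma> = 1 then 0 else (1 - \<gamma>) * (\<integral>z. nonlocal_density s p u z \<partial>(lborel \<Otimes>\<^sub>M lborel)))"

definition weighted_power :: "real \<Rightarrow> real \<Rightarrow> ('a::euclidean_space \<Rightarrow> real) \<Rightarrow> 'a \<Rightarrow> real" where
  "weighted_power \<kappa> r u x = norm x powr \<kappa> * \<bar>u x\<bar> powr r"

lemma integrand_self:
  assumes "p > 1"
  shows "local_integrand p u u = (\<lambda>x. norm (weak_grad u x) powr p)"
    "nonlocal_integrand s p u u = nonlocal_density s p u"
    "power_integrand \<kappa> p u u = weighted_power \<kappa> p u"
  using Phi_inner_self[OF assms] Phi_inner_self[OF assms, where 'b = real]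
  by (auto simp: local_integrand_def nonlocal_integrand_def nonlocal_density_def power_integrand_def
      weighted_power_def fun_eq_iff mult.assoc)

text \<open>
  The inequality on which everything rests: all three terms of the weak formulation, tested with \<open>v\<close>,
  are compared with the corresponding functionals at \<open>u\<close> and \<open>v\<close>.
\<close>

lemma test_inequality:
  fixes u v :: "'a::euclidean_space \<Rightarrow> real"
  assumes sol: "positive_weak_solution \<gamma> s p q \<alpha> \<beta> u" and v: "v \<in> sol_space \<gamma> s p \<beta>"
    and pq: "p > 1" "q > 1" and \<gamma>: "0 \<le> \<gamma>" "\<gamma> \<le> 1"
    and v0: "AE x in lborel. v x \<ge> 0"
    and iloc: "\<gamma> \<noteq> 0 \<Longrightarrow> integrable lborel (\<lambda>x. norm (weak_grad v x) powr p)"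
    and inl: "\<gamma> \<noteq> 1 \<Longrightarrow> integrable (lborel \<Otimes>\<^sub>M lborel) (nonlocal_density s p v)"
    and iB: "integrable lborel (weighted_power \<beta> p v)"
    and iA: "integrable lborel (weighted_power \<alpha> q v)"
  defines "A \<equiv> \<lambda>w. \<integral>x. weighted_power \<alpha> q w x \<partial>lborel" and "B \<equiv> \<lambda>w. \<integral>x. weighted_power \<beta> p w x \<partial>lborel"
  shows "A u = energy \<gamma> s p u + B u"
    and "integrable lborel (\<lambda>x. norm x powr \<alpha> * ((v x powr (q - 1) - u x powr (q - 1)) * (v x - u x)))"
    and "1 / q * (A v - A u) - (\<integral>x. norm x powr \<alpha> * ((v x powr (q - 1) - u x powr (q - 1)) * (v x - u x)) \<partial>lborel)
      \<le> 1 / p * (energy \<gamma> s p v - energy \<gamma> s p u) + 1 / p * (B v - B u)"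
proof -
  have u: "u \<in> sol_space \<gamma> s p \<beta>" and u0: "AE x in lborel. u x > 0"
    and wf: "\<And>w. w \<in> sol_space \<gamma> s p \<beta> \<Longrightarrow> weak_form_defined \<gamma> s p q \<alpha> \<beta> u w"
    and eq: "\<And>w. w \<in> sol_space \<gamma> s p \<beta> \<Longrightarrow> L_form \<gamma> s p u w + (\<integral>x. power_integrand \<beta> p u w x \<partial>lborel)
          = (\<integral>x. power_integrand \<alpha> q u w x \<partial>lborel)"
    using sol by (auto simp: positive_weak_solution_def)
  have [measurable]: "u \<in> borel_measurable borel" "v \<in> borel_measurable borel"
    using u v by (auto simp: sol_space_def W_rad_def W_space_def L_weighted_def split: if_splits)
  note wu = wf[OF u, unfolded weak_form_defined_def integrand_self[OF pq(1)] integrand_self(3)[OF pq(2)]]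
  note wv = wf[OF v, unfolded weak_form_defined_def]
  have Lu: "L_form \<gamma> s p u u = energy \<gamma> s p u"
    by (simp add: L_form_def energy_def integrand_self[OF pq(1)])
  show AEB: "A u = energy \<gamma> s p u + B u"
    using eq[OF u] by (simp add: Lu A_def B_def integrand_self[OF pq(1)] integrand_self(3)[OF pq(2)])
  let ?c = "1 - 1 / p"
  have c0: "?c \<ge> 0" "1 / p \<ge> 0" using pq by auto
  have Lv: "L_form \<gamma> s p u v \<le> ?c * energy \<gamma> s p u + 1 / p * energy \<gamma> s p v"
  proof -
    have 1: "(\<integral>x. local_integrand p u v x \<partial>lborel) 
      \<le> ?c * (\<integral>x. norm (weak_grad u x) powr p \<partial>lborel) + 1 / p * (\<integral>x. norm (weak_grad v x) powr p \<partial>lborel)" if "\<gamma> \<noteq> 0"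
    proof -
      have i: "integrable lborel (\<lambda>x. norm (weak_grad u x) powr p)" "integrable lborel (\<lambda>x. norm (weak_grad v x) powr p)"
        "integrable lborel (local_integrand p u v)" using wu wv iloc that by auto
      have "(\<integral>x. local_integrand p u v x \<partial>lborel) \<le> (\<integral>x. ?c * norm (weak_grad u x) powr p + 1 / p * norm (weak_grad v x) powr p \<partial>lborel)"
      proof (rule integral_mono)
        show "local_integrand p u v x \<le> ?c * norm (weak_grad u x) powr p + 1 / p * norm (weak_grad v x) powr p" for x
          unfolding local_integrand_def by (rule Phi_inner_le[OF pq(1)])
      qed (use i in auto)
      also have "\<dots> = ?c * (\<integral>x. norm (weak_grad u x) powr p \<partial>lborel) + 1 / p * (\<integral>x. norm (weak_grad v x) powr p \<partial>lborel)"
        using i by (subst Bochner_Integration.integral_add) auto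
      finally show ?thesis .
    qed
    have 2: "(\<integral>z. nonlocal_integrand s p u v z \<partial>(lborel \<Otimes>\<^sub>M lborel)) 
      \<le> ?c * (\<integral>z. nonlocal_density s p u z \<partial>(lborel \<Otimes>\<^sub>M lborel)) + 1 / p * (\<integral>z. nonlocal_density s p v z \<partial>(lborel \<Otimes>\<^sub>M lborel))" 
      if "\<gamma> \<noteq> 1"
    proof -
      have i: "integrable (lborel \<Otimes>\<^sub>M lborel) (nonlocal_density s p u)" "integrable (lborel \<Otimes>\<^sub>M lborel) (nonlocal_density s p v)"
        "integrable (lborel \<Otimes>\<^sub>M lborel) (nonlocal_integrand s p u v)" using wu wv inl that by auto
      have pt: "nonlocal_integrand s p u v z \<le> ?c * nonlocal_density s p u z + 1 / p * nonlocal_density s p v z" for z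
      proof (cases z)
        case (Pair x y)
        let ?D = "norm (x - y) powr (real DIM('a) + s * p)"
        have "Phi p (u x - u y) * (v x - v y) \<le> ?c * \<bar>u x - u y\<bar> powr p + 1 / p * \<bar>v x - v y\<bar> powr p"
          using Phi_inner_le[OF pq(1), of "u x - u y" "v x - v y"] by simp
        then have "Phi p (u x - u y) * (v x - v y) / ?D \<le> (?c * \<bar>u x - u y\<bar> powr p + 1 / p * \<bar>v x - v y\<bar> powr p) / ?D"
          by (rule divide_right_mono) simp
        then show ?thesis unfolding Pair nonlocal_integrand_def nonlocal_density_def by (simp add: add_divide_distrib)
      qed
      have "(\<integral>z. nonlocal_integrand s p u v z \<partial>(lborel \<Otimes>\<^sub>M lborel)) \<le> (\<integral>z. ?c * nonlocal_density s p u z + 1 / p * nonlocal_density s p v z \<partial>(lborel \<Otimes>\<^sub>M lborel))"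
        using i by (intro integral_mono Bochner_Integration.integrable_add integrable_mult_right pt) auto
      also have "\<dots> = ?c * (\<integral>z. nonlocal_density s p u z \<partial>(lborel \<Otimes>\<^sub>M lborel)) + 1 / p * (\<integral>z. nonlocal_density s p v z \<partial>(lborel \<Otimes>\<^sub>M lborel))"
        using i by (subst Bochner_Integration.integral_add) auto
      finally show ?thesis .
    qed
    have m: "t * X \<le> c * (t * Y) + d * (t * Z)" if "X \<le> c * Y + d * Z" "t \<ge> 0" for t X Y Z c d :: real
      using mult_left_mono[OF that] by (simp add: algebra_simps)
    have "(if \<gamma> = 0 then 0 else \<gamma> * (\<integral>x. local_integrand p u v x \<partial>lborel))
      \<le> ?c * (if \<gamma> = 0 then 0 else \<gamma> * (\<integral>x. norm (weak_grad u x) powr p \<partial>lborel))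
      + 1 / p * (if \<gamma> = 0 then 0 else \<gamma> * (\<integral>x. norm (weak_grad v x) powr p \<partial>lborel))"
      using m[OF 1 \<gamma>(1)] by (cases "\<gamma> = 0") simp_all
    moreover have "(if \<gamma> = 1 then 0 else (1 - \<gamma>) * (\<integral>z. nonlocal_integrand s p u v z \<partial>(lborel \<Otimes>\<^sub>M lborel)))
      \<le> ?c * (if \<gamma> = 1 then 0 else (1 - \<gamma>) * (\<integral>z. nonlocal_density s p u z \<partial>(lborel \<Otimes>\<^sub>M lborel)))
      + 1 / p * (if \<gamma> = 1 then 0 else (1 - \<gamma>) * (\<integral>z. nonlocal_density s p v z \<partial>(lborel \<Otimes>\<^sub>M lborel)))"
      using m[OF 2, of "1 - \<gamma>"] \<gamma> by (cases "\<gamma> = 1") simp_all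
    ultimately show ?thesis
      unfolding L_form_def energy_def distrib_left by linarith
  qed
  have Bv: "(\<integral>x. power_integrand \<beta> p u v x \<partial>lborel) \<le> ?c * B u + 1 / p * B v"
  proof -
    have pt: "power_integrand \<beta> p u v x \<le> ?c * weighted_power \<beta> p u x + 1 / p * weighted_power \<beta> p v x" for x
    proof -
      have "Phi p (u x) * v x \<le> ?c * \<bar>u x\<bar> powr p + 1 / p * \<bar>v x\<bar> powr p"
        using Phi_inner_le[OF pq(1), of "u x" "v x"] by simp
      from mult_left_mono[OF this, of "norm x powr \<beta>"] show ?thesis
        by (simp add: power_integrand_def weighted_power_def algebra_simps)
    qed
    have i: "integrable lborel (weighted_power \<beta> p u)" "integrable lborel (power_integrand \<beta> p u v)" using wu wv by auto
    have "(\<integral>x. power_integrand \<beta> p u v x \<partial>lborel) \<le> (\<integral>x. ?c * weighted_power \<beta> p u x + 1 / p * weighted_power \<beta> p v x \<partial>lborel)"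
      using i iB by (intro integral_mono Bochner_Integration.integrable_add integrable_mult_right pt) auto
    also have "\<dots> = ?c * B u + 1 / p * B v"
      unfolding B_def using i iB by (subst Bochner_Integration.integral_add) auto
    finally show ?thesis .
  qed
  let ?b = "\<lambda>x. norm x powr \<alpha> * ((v x powr (q - 1) - u x powr (q - 1)) * (v x - u x))"
  have iAu: "integrable lborel (weighted_power \<alpha> q u)" using wu by auto
  have ae: "AE x in lborel. u x > 0 \<and> v x \<ge> 0" using u0 v0 by eventually_elim auto
  show ib: "integrable lborel ?b"
  proof (rule Bochner_Integration.integrable_bound)
    show "integrable lborel (\<lambda>x. weighted_power \<alpha> q v x + weighted_power \<alpha> q u x)" using iA iAu by auto
    show "?b \<in> borel_measurable lborel" by measurable
    show "AE x in lborel. norm (?b x) \<le> norm (weighted_power \<alpha> q v x + weighted_power \<alpha> q u x)"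
      using ae
    proof eventually_elim
      case (elim x)
      have "norm x powr \<alpha> * \<bar>(v x powr (q - 1) - u x powr (q - 1)) * (v x - u x)\<bar>
        \<le> norm x powr \<alpha> * (v x powr q + u x powr q)"
        using elim by (intro mult_left_mono bregman_bounds(1)[OF pq(2)]) auto
      then show ?case using elim by (simp add: weighted_power_def abs_mult distrib_left)
    qed
  qed
  have Av: "A u + 1 / q * (A v - A u) - (\<integral>x. ?b x \<partial>lborel) \<le> (\<integral>x. power_integrand \<alpha> q u v x \<partial>lborel)"
  proof -
    have "A u + 1 / q * (A v - A u) - (\<integral>x. ?b x \<partial>lborel)
      = (\<integral>x. weighted_power \<alpha> q u x + 1 / q * (weighted_power \<alpha> q v x - weighted_power \<alpha> q u x) - ?b x \<partial>lborel)"
      unfolding A_def using iAu iA ib by simp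
    also have "\<dots> \<le> (\<integral>x. power_integrand \<alpha> q u v x \<partial>lborel)"
    proof (rule integral_mono_AE)
      show "AE x in lborel. weighted_power \<alpha> q u x + 1 / q * (weighted_power \<alpha> q v x - weighted_power \<alpha> q u x) - ?b x
         \<le> power_integrand \<alpha> q u v x"
        using ae
      proof eventually_elim
        case (elim x)
        have "Phi q (u x) = u x powr (q - 1)" using elim by (simp add: Phi_def powr_diff power2_eq_square)
        then show ?case
          using mult_left_mono[OF bregman_lower_bound[OF pq(2), of "u x" "v x"], of "norm x powr \<alpha>"] elim
          by (simp add: weighted_power_def power_integrand_def algebra_simps)
      qed
    qed (use iAu iA ib wv in auto)
    finally show ?thesis .
  qed
  show "1 / q * (A v - A u) - (\<integral>x. ?b x \<partial>lborel) \<le> 1 / p * (energy \<gamma> s p v - energy \<gamma> s p u) + 1 / p * (B v - B u)"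
  proof -
    have fin: "iq * (AV - AA) - Bg \<le> ip * (EV - E) + ip * (BV - BB)"
      if "AA + iq * (AV - AA) - Bg \<le> W" "L + Bb = W" "L \<le> (1 - ip) * E + ip * EV" "Bb \<le> (1 - ip) * BB + ip * BV" "AA = E + BB"
      for AA AV Bg W L Bb E EV BB BV ip iq :: real
      using that by (simp add: algebra_simps)
    show ?thesis by (rule fin[OF Av eq[OF v] Lv Bv AEB])
  qed
qed

lemma powr_difference_quotient:
  fixes m c :: real
  assumes e: "\<And>n. e n > 0" "e \<longlonglongrightarrow> 0"
  shows "(\<lambda>n. ((1 + m * e n) powr c - 1) / e n) \<longlonglongrightarrow> m * c"
proof -
  have "((\<lambda>x. (1 + m * x) powr c) has_real_derivative c * (1 + m * 0) powr (c - 1) * m) (at 0)"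
    by (auto intro!: derivative_eq_intros)
  then have "((\<lambda>h. ((1 + m * h) powr c - 1) / h) \<longlongrightarrow> m * c) (at 0)"
    by (simp add: DERIV_def mult.commute)
  moreover have "filterlim e (at 0) sequentially"
    using e by (auto simp: filterlim_at less_imp_neq[symmetric] intro!: always_eventually)
  ultimately show ?thesis by (rule filterlim_compose)
qed

text \<open>
  Division by \<open>e n\<close> and passage to the limit in the test inequality. Every functional is split into
  the part over the region where the deformation is an exact dilation (index \<open>c\<close>), whose exact degree
  enters the limit, and the remaining part (index \<open>o\<close>), for which the crude factor \<open>(1 + 8 e)^K\<close> is
  enough. For pure dilations the latter is 0.
\<close>

lemma pohozaev_limit:
  fixes e Av Bv Ev Br :: "nat \<Rightarrow> real"
  assumes e: "\<And>n. e n > 0" "e \<longlonglongrightarrow> 0" and pq: "p > 0" "q > 0"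
    and ineq: "\<And>n. 1 / q * (Av n - (Ac + Ao)) - Br n \<le> 1 / p * (Ev n - (Ec + Eo)) + 1 / p * (Bv n - (Bc + Bo))"
    and Av: "\<And>n. (1 + e n) powr a * Ac + (1 + 8 * e n) powr (- K) * Ao \<le> Av n"
    and Bv: "\<And>n. Bv n \<le> (1 + e n) powr b * Bc + (1 + 8 * e n) powr K * Bo"
    and Ev: "\<And>n. Ev n \<le> (1 + e n) powr c * Ec + (1 + 8 * e n) powr K * Eo"
    and Br: "(\<lambda>n. Br n / e n) \<longlonglongrightarrow> 0"
  shows "1 / q * (a * Ac - 8 * K * Ao) \<le> 1 / p * (c * Ec + 8 * K * Eo) + 1 / p * (b * Bc + 8 * K * Bo)"
proof -
  define d where "d m k n = ((1 + m * e n) powr k - 1) / e n" for m k n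
  have d: "d m k \<longlonglongrightarrow> m * k" for m k unfolding d_def by (rule powr_difference_quotient[OF e])
  have "1 / q * (d 1 a n * Ac + d 8 (- K) n * Ao) - Br n / e n
     \<le> 1 / p * (d 1 c n * Ec + d 8 K n * Eo) + 1 / p * (d 1 b n * Bc + d 8 K n * Bo)" for n
  proof -
    have "1 / q * (((1 + e n) powr a * Ac + (1 + 8 * e n) powr (- K) * Ao) - (Ac + Ao)) - Br n
     \<le> 1 / p * (((1 + e n) powr c * Ec + (1 + 8 * e n) powr K * Eo) - (Ec + Eo))
      + 1 / p * (((1 + e n) powr b * Bc + (1 + 8 * e n) powr K * Bo) - (Bc + Bo))" (is "?L \<le> ?R")
    proof -
      have "?L \<le> 1 / q * (Av n - (Ac + Ao)) - Br n"
        using Av[of n] pq by (intro diff_right_mono mult_left_mono) auto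
      also note ineq[of n]
      also have "1 / p * (Ev n - (Ec + Eo)) + 1 / p * (Bv n - (Bc + Bo)) \<le> ?R"
        using Ev[of n] Bv[of n] pq by (intro add_mono mult_left_mono) auto
      finally show ?thesis .
    qed
    then have "?L / e n \<le> ?R / e n" using e(1)[of n] by (intro divide_right_mono) auto
    moreover have "?L / e n = 1 / q * (d 1 a n * Ac + d 8 (- K) n * Ao) - Br n / e n"
      by (simp add: d_def diff_divide_distrib add_divide_distrib algebra_simps)
    moreover have "?R / e n = 1 / p * (d 1 c n * Ec + d 8 K n * Eo) + 1 / p * (d 1 b n * Bc + d 8 K n * Bo)"
      by (simp add: d_def diff_divide_distrib add_divide_distrib algebra_simps)
    ultimately show ?thesis by simp
  qed
  moreover have "(\<lambda>n. 1 / q * (d 1 a n * Ac + d 8 (- K) n * Ao) - Br n / e n) \<longlonglongrightarrow> 1 / q * ((1 * a) * Ac + (8 * (- K)) * Ao) - 0"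
    by (intro tendsto_diff[OF _ Br] tendsto_mult tendsto_add tendsto_const d)
  moreover have "(\<lambda>n. 1 / p * (d 1 c n * Ec + d 8 K n * Eo) + 1 / p * (d 1 b n * Bc + d 8 K n * Bo))
      \<longlonglongrightarrow> 1 / p * ((1 * c) * Ec + (8 * K) * Eo) + 1 / p * ((1 * b) * Bc + (8 * K) * Bo)"
    by (intro tendsto_mult tendsto_add tendsto_const d)
  ultimately have "1 / q * ((1 * a) * Ac + (8 * (- K)) * Ao) - 0
     \<le> 1 / p * ((1 * c) * Ec + (8 * K) * Eo) + 1 / p * ((1 * b) * Bc + (8 * K) * Bo)"
    by (intro LIMSEQ_le) auto
  then show ?thesis by simp
qed

section \<open>Energies of solutions under cut-off dilations\<close>

lemma integral_split_weight:
  fixes h :: "'b \<Rightarrow> real"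
  assumes h: "integrable M h" and G[measurable]: "G \<in> sets M"
  shows "integrable M (\<lambda>x. (if x \<in> G then a else b) * h x)"
    and "(\<integral>x. (if x \<in> G then a else b) * h x \<partial>M)
      = a * (\<integral>x. indicator G x * h x \<partial>M) + b * ((\<integral>x. h x \<partial>M) - (\<integral>x. indicator G x * h x \<partial>M))"
proof -
  have i: "integrable M (\<lambda>x. indicator G x * h x)"
    using integrable_real_mult_indicator[OF G h] by (simp add: mult.commute)
  have eq: "(\<lambda>x. (if x \<in> G then a else b) * h x) = (\<lambda>x. a * (indicator G x * h x) + b * (h x - indicator G x * h x))"
    by (auto simp: fun_eq_iff)
  show "integrable M (\<lambda>x. (if x \<in> G then a else b) * h x)"
    unfolding eq using i h by auto
  show "(\<integral>x. (if x \<in> G then a else b) * h x \<partial>M)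
      = a * (\<integral>x. indicator G x * h x \<partial>M) + b * ((\<integral>x. h x \<partial>M) - (\<integral>x. indicator G x * h x \<partial>M))"
    unfolding eq using i h by simp
qed

lemma integral_le_from_nn_integral:
  fixes f g :: "'b \<Rightarrow> real"
  assumes [measurable]: "f \<in> borel_measurable M" and g: "integrable M g"
    and f0: "\<And>x. f x \<ge> 0" and g0: "\<And>x. g x \<ge> 0"
    and le: "(\<integral>\<^sup>+x. ennreal (f x) \<partial>M) \<le> (\<integral>\<^sup>+x. ennreal (g x) \<partial>M)"
  shows "integrable M f" "(\<integral>x. f x \<partial>M) \<le> (\<integral>x. g x \<partial>M)"
proof -
  have G: "(\<integral>\<^sup>+x. ennreal (g x) \<partial>M) = ennreal (\<integral>x. g x \<partial>M)"
    using g g0 by (intro nn_integral_eq_integral) auto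
  have "(\<integral>\<^sup>+x. ennreal (norm (f x)) \<partial>M) < \<infinity>"
    using le f0 unfolding G by (simp add: le_less_trans)
  then show i: "integrable M f" by (auto simp: integrable_iff_bounded)
  have "(\<integral>\<^sup>+x. ennreal (f x) \<partial>M) = ennreal (\<integral>x. f x \<partial>M)"
    using i f0 by (intro nn_integral_eq_integral) auto
  then show "(\<integral>x. f x \<partial>M) \<le> (\<integral>x. g x \<partial>M)"
    using le G f0 g0 by (simp add: ennreal_le_iff integral_nonneg_AE)
qed

context cut_off_dilation
begin

lemma norm_powr_phi:
  fixes x :: "'a::euclidean_space"
  assumes "x \<noteq> 0"
  shows "\<phi> x \<in> core \<Longrightarrow> norm x powr \<kappa> = (1 + \<epsilon>) powr - \<kappa> * norm (\<phi> x) powr \<kappa>"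
    and "norm x powr \<kappa> \<le> \<Lambda> powr \<bar>\<kappa>\<bar> * norm (\<phi> x) powr \<kappa>"
    and "\<Lambda> powr - \<bar>\<kappa>\<bar> * norm (\<phi> x) powr \<kappa> \<le> norm x powr \<kappa>"
proof -
  have x: "norm x > 0" using assms by simp
  show "norm x powr \<kappa> = (1 + \<epsilon>) powr - \<kappa> * norm (\<phi> x) powr \<kappa>" if c: "\<phi> x \<in> core"
  proof -
    have "norm (\<phi> x) = (1 + \<epsilon>) * norm x" using core_phi(1)[OF c] \<epsilon> by simp
    then show ?thesis using \<epsilon> x by (simp add: powr_mult powr_minus)
  qed
  have le: "norm x \<le> norm (\<phi> x)" by (rule norm_phi_bounds)
  have ge: "norm (\<phi> x) \<le> \<Lambda> * norm x"
    using norm_phi_bounds(2)[of x] mult_right_mono[of "1 + \<epsilon>" \<Lambda> "norm x"] \<epsilon> by simp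
  have L1: "1 \<le> \<Lambda> powr \<bar>\<kappa>\<bar>" using powr_mono[of 0 "\<bar>\<kappa>\<bar>" \<Lambda>] \<epsilon> by simp
  have L2: "\<Lambda> powr - \<bar>\<kappa>\<bar> \<le> 1" using powr_mono[of "- \<bar>\<kappa>\<bar>" 0 \<Lambda>] \<epsilon> by simp
  have px: "norm (\<phi> x) > 0" using x le by linarith
  have up: "norm x powr \<kappa> \<le> \<Lambda> powr \<bar>\<kappa>\<bar> * norm (\<phi> x) powr \<kappa> \<and> \<Lambda> powr - \<bar>\<kappa>\<bar> * norm (\<phi> x) powr \<kappa> \<le> norm x powr \<kappa>"
  proof (cases "\<kappa> \<ge> 0")
    case True
    have a: "norm x powr \<kappa> \<le> norm (\<phi> x) powr \<kappa>" using le True by (intro powr_mono2) auto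
    have "norm (\<phi> x) powr \<kappa> \<le> (\<Lambda> * norm x) powr \<kappa>" using ge True by (intro powr_mono2) auto
    also have "\<dots> = \<Lambda> powr \<kappa> * norm x powr \<kappa>" using \<epsilon> by (simp add: powr_mult)
    finally have b: "\<Lambda> powr - \<kappa> * norm (\<phi> x) powr \<kappa> \<le> \<Lambda> powr - \<kappa> * (\<Lambda> powr \<kappa> * norm x powr \<kappa>)"
      by (intro mult_left_mono) auto
    have "\<Lambda> powr - \<kappa> * (\<Lambda> powr \<kappa> * norm x powr \<kappa>) = norm x powr \<kappa>"
      using \<epsilon> by (simp add: powr_minus)
    note b = b[unfolded this]
    show ?thesis using a b L1 True mult_right_mono[of 1 "\<Lambda> powr \<kappa>" "norm (\<phi> x) powr \<kappa>"] by auto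
  next
    case False
    have a: "norm (\<phi> x) powr \<kappa> \<le> norm x powr \<kappa>" using le False x by (intro powr_mono2') auto
    have "(\<Lambda> * norm x) powr \<kappa> \<le> norm (\<phi> x) powr \<kappa>" using ge False px by (intro powr_mono2') auto
    then have "\<Lambda> powr \<kappa> * norm x powr \<kappa> \<le> norm (\<phi> x) powr \<kappa>" using \<epsilon> by (simp add: powr_mult)
    then have b: "\<Lambda> powr - \<kappa> * (\<Lambda> powr \<kappa> * norm x powr \<kappa>) \<le> \<Lambda> powr - \<kappa> * norm (\<phi> x) powr \<kappa>"
      by (intro mult_left_mono) auto
    have "\<Lambda> powr - \<kappa> * (\<Lambda> powr \<kappa> * norm x powr \<kappa>) = norm x powr \<kappa>"
      using \<epsilon> by (simp add: powr_minus)
    note b = b[unfolded this]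
    show ?thesis using a b L2 False mult_right_mono[of "\<Lambda> powr \<kappa>" 1 "norm (\<phi> x) powr \<kappa>"] by auto
  qed
  then show "norm x powr \<kappa> \<le> \<Lambda> powr \<bar>\<kappa>\<bar> * norm (\<phi> x) powr \<kappa>"
    "\<Lambda> powr - \<bar>\<kappa>\<bar> * norm (\<phi> x) powr \<kappa> \<le> norm x powr \<kappa>" by auto
qed

lemma AE_nonzero: "AE x::'a::euclidean_space in lborel. x \<noteq> 0"
  by (rule AE_lborel_singleton)

text \<open>
  Behaviour of the weighted norms under cut-off dilations: exact scaling on the core, and a factor
  \<open>1 + O(\<epsilon>)\<close> elsewhere. The lower bound must keep the part outside the core, since losing it would
  cost more than \<open>O(\<epsilon>)\<close>.
\<close>

lemma weighted_phi:
  fixes u :: "'a::euclidean_space \<Rightarrow> real"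
  assumes [measurable]: "u \<in> borel_measurable borel" and i: "integrable lborel (weighted_power \<kappa> r u)"
    and K: "real DIM('a) + \<bar>\<kappa>\<bar> \<le> K"
  defines "c \<equiv> \<integral>x. indicator core x * weighted_power \<kappa> r u x \<partial>lborel"
    and "t \<equiv> \<integral>x. weighted_power \<kappa> r u x \<partial>lborel"
  shows "integrable lborel (weighted_power \<kappa> r (\<lambda>x. u (\<phi> x)))"
    and "(\<integral>x. weighted_power \<kappa> r (\<lambda>x. u (\<phi> x)) x \<partial>lborel) \<le> (1 + \<epsilon>) powr - (real DIM('a) + \<kappa>) * c + \<Lambda> powr K * (t - c)"
    and "(1 + \<epsilon>) powr - (real DIM('a) + \<kappa>) * c + \<Lambda> powr - K * (t - c) \<le> (\<integral>x. weighted_power \<kappa> r (\<lambda>x. u (\<phi> x)) x \<partial>lborel)"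
proof -
  let ?N = "real DIM('a)" and ?w = "weighted_power \<kappa> r u" and ?wv = "weighted_power \<kappa> r (\<lambda>x. u (\<phi> x))"
  have w0: "?w x \<ge> 0" "?wv x \<ge> 0" for x by (simp_all add: weighted_power_def)
  have [measurable]: "?w \<in> borel_measurable borel" "?wv \<in> borel_measurable borel"
    unfolding weighted_power_def[abs_def] by measurable
  let ?g = "\<lambda>b x. (if x \<in> core then (1 + \<epsilon>) powr - (?N + \<kappa>) else b) * ?w x"
  have ig: "integrable lborel (?g b)" and eg: "(\<integral>x. ?g b x \<partial>lborel) = (1 + \<epsilon>) powr - (?N + \<kappa>) * c + b * (t - c)" for b
    using integral_split_weight[OF i, of core] by (simp_all add: c_def t_def)
  have "t - c = (\<integral>x. ?w x - indicator core x * ?w x \<partial>lborel)"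
    unfolding c_def t_def using i integrable_real_mult_indicator[OF _ i, of core]
    by (subst Bochner_Integration.integral_diff) (auto simp: mult.commute)
  also have "\<dots> \<ge> 0" using w0 by (intro integral_nonneg_AE AE_I2) (auto simp: indicator_def)
  finally have tc: "t - c \<ge> 0" .
  have K1: "\<Lambda> powr (?N + \<bar>\<kappa>\<bar>) \<le> \<Lambda> powr K" "\<Lambda> powr - K \<le> \<Lambda> powr - (?N + \<bar>\<kappa>\<bar>)"
    using K \<epsilon> by (auto intro!: powr_mono)
  have le: "(\<integral>\<^sup>+x. ennreal (?wv x) \<partial>lborel) \<le> (\<integral>\<^sup>+x. ennreal (?g (\<Lambda> powr (?N + \<bar>\<kappa>\<bar>)) x) \<partial>lborel)"
  proof -
    let ?h = "\<lambda>y. ennreal ((if y \<in> core then (1 + \<epsilon>) powr - \<kappa> else \<Lambda> powr \<bar>\<kappa>\<bar>) * ?w y)"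
    have "(\<integral>\<^sup>+x. ennreal (?wv x) \<partial>lborel) \<le> (\<integral>\<^sup>+x. ?h (\<phi> x) \<partial>lborel)"
    proof (rule nn_integral_mono_AE)
      show "AE x in lborel. ennreal (?wv x) \<le> ?h (\<phi> x)"
        using AE_nonzero
      proof eventually_elim
        case (elim x)
        have "norm x powr \<kappa> \<le> (if \<phi> x \<in> core then (1 + \<epsilon>) powr - \<kappa> else \<Lambda> powr \<bar>\<kappa>\<bar>) * norm (\<phi> x) powr \<kappa>"
          using norm_powr_phi[OF elim, of \<kappa>] by auto
        from mult_right_mono[OF this, of "\<bar>u (\<phi> x)\<bar> powr r"] show ?case
          by (intro ennreal_leI) (simp add: weighted_power_def mult.assoc)
      qed
    qed
    also have "\<dots> \<le> (\<integral>\<^sup>+x. ennreal (if x \<in> core then (1 + \<epsilon>) powr - ?N else \<Lambda> powr ?N) * ?h x \<partial>lborel)"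
      by (rule nn_integral_phi_le) measurable
    also have "\<dots> = (\<integral>\<^sup>+x. ennreal (?g (\<Lambda> powr (?N + \<bar>\<kappa>\<bar>)) x) \<partial>lborel)"
      using w0 by (intro nn_integral_cong) (auto simp: ennreal_mult[symmetric] powr_add[symmetric] mult.assoc[symmetric])
    finally show ?thesis .
  qed
  have ge: "(\<integral>\<^sup>+x. ennreal (?g (\<Lambda> powr - (?N + \<bar>\<kappa>\<bar>)) x) \<partial>lborel) \<le> (\<integral>\<^sup>+x. ennreal (?wv x) \<partial>lborel)"
  proof -
    let ?h = "\<lambda>y. ennreal ((if y \<in> core then (1 + \<epsilon>) powr - \<kappa> else \<Lambda> powr - \<bar>\<kappa>\<bar>) * ?w y)"
    have "(\<integral>\<^sup>+x. ennreal (?g (\<Lambda> powr - (?N + \<bar>\<kappa>\<bar>)) x) \<partial>lborel)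
       = (\<integral>\<^sup>+x. ennreal (if x \<in> core then (1 + \<epsilon>) powr - ?N else \<Lambda> powr - ?N) * ?h x \<partial>lborel)"
      using w0 by (intro nn_integral_cong) (auto simp: ennreal_mult[symmetric] powr_add[symmetric] mult.assoc[symmetric])
    also have "\<dots> \<le> (\<integral>\<^sup>+x. ?h (\<phi> x) \<partial>lborel)" by (rule nn_integral_phi_ge) measurable
    also have "\<dots> \<le> (\<integral>\<^sup>+x. ennreal (?wv x) \<partial>lborel)"
    proof (rule nn_integral_mono_AE)
      show "AE x in lborel. ?h (\<phi> x) \<le> ennreal (?wv x)"
        using AE_nonzero
      proof eventually_elim
        case (elim x)
        have "(if \<phi> x \<in> core then (1 + \<epsilon>) powr - \<kappa> else \<Lambda> powr - \<bar>\<kappa>\<bar>) * norm (\<phi> x) powr \<kappa> \<le> norm x powr \<kappa>"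
          using norm_powr_phi[OF elim, of \<kappa>] by auto
        from mult_right_mono[OF this, of "\<bar>u (\<phi> x)\<bar> powr r"] show ?case
          by (intro ennreal_leI) (simp add: weighted_power_def mult.assoc)
      qed
    qed
    finally show ?thesis .
  qed
  have g0: "?g b x \<ge> 0" if "b \<ge> 0" for b x using that w0 by simp
  note R = integral_le_from_nn_integral[OF _ ig w0(2) g0 le]
  show iv: "integrable lborel ?wv" by (rule R(1)) auto
  have "(\<integral>x. ?wv x \<partial>lborel) \<le> (1 + \<epsilon>) powr - (?N + \<kappa>) * c + \<Lambda> powr (?N + \<bar>\<kappa>\<bar>) * (t - c)"
    unfolding eg[symmetric] by (rule R(2)) auto
  also have "\<dots> \<le> (1 + \<epsilon>) powr - (?N + \<kappa>) * c + \<Lambda> powr K * (t - c)"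
    using K1 tc by (intro add_left_mono mult_right_mono) auto
  finally show "(\<integral>x. ?wv x \<partial>lborel) \<le> (1 + \<epsilon>) powr - (?N + \<kappa>) * c + \<Lambda> powr K * (t - c)" .
  have "(1 + \<epsilon>) powr - (?N + \<kappa>) * c + \<Lambda> powr - K * (t - c) \<le> (1 + \<epsilon>) powr - (?N + \<kappa>) * c + \<Lambda> powr - (?N + \<bar>\<kappa>\<bar>) * (t - c)"
    using K1 tc by (intro add_left_mono mult_right_mono) auto
  also have "\<dots> \<le> (\<integral>x. ?wv x \<partial>lborel)"
    unfolding eg[symmetric] by (rule integral_le_from_nn_integral(2)[OF _ iv g0 w0(2) ge]) auto
  finally show "(1 + \<epsilon>) powr - (?N + \<kappa>) * c + \<Lambda> powr - K * (t - c) \<le> (\<integral>x. ?wv x \<partial>lborel)" .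
qed

text \<open>
  The same for the Gagliardo seminorm. Only pairs of points that both lie in the core scale exactly;
  for the other pairs the distance and the two volume elements change by factors of at most
  \<open>\<Lambda>^(N + s p)\<close> and \<open>\<Lambda>^N\<close>.
\<close>

lemma nonlocal_phi:
  fixes u :: "'a::euclidean_space \<Rightarrow> real"
  assumes [measurable]: "u \<in> borel_measurable borel" and i: "integrable (lborel \<Otimes>\<^sub>M lborel) (nonlocal_density s p u)"
    and sp: "s * p \<ge> 0" and K: "3 * real DIM('a) + s * p \<le> K"
  defines "c \<equiv> \<integral>z. indicator (core \<times> core) z * nonlocal_density s p u z \<partial>(lborel \<Otimes>\<^sub>M lborel)"
    and "t \<equiv> \<integral>z. nonlocal_density s p u z \<partial>(lborel \<Otimes>\<^sub>M lborel)"
  shows "integrable (lborel \<Otimes>\<^sub>M lborel) (nonlocal_density s p (\<lambda>x. u (\<phi> x)))"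
    and "(\<integral>z. nonlocal_density s p (\<lambda>x. u (\<phi> x)) z \<partial>(lborel \<Otimes>\<^sub>M lborel))
      \<le> (1 + \<epsilon>) powr - (real DIM('a) - s * p) * c + \<Lambda> powr K * (t - c)"
proof -
  let ?N = "real DIM('a)" and ?w = "nonlocal_density s p u" and ?wv = "nonlocal_density s p (\<lambda>x. u (\<phi> x))"
  let ?P = "lborel \<Otimes>\<^sub>M lborel :: ('a \<times> 'a) measure"
  define S where "S = ?N + s * p"
  have S0: "S \<ge> 0" using sp by (simp add: S_def)
  have w0: "?w z \<ge> 0" "?wv z \<ge> 0" for z by (simp_all add: nonlocal_density_def case_prod_beta)
  have wm[measurable]: "?w \<in> borel_measurable (borel \<Otimes>\<^sub>M borel)" "?wv \<in> borel_measurable (borel \<Otimes>\<^sub>M borel)"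
    unfolding nonlocal_density_def case_prod_beta by measurable
  define H where "H x y = ennreal ((if x \<in> core \<and> y \<in> core then (1 + \<epsilon>) powr S else \<Lambda> powr S) * ?w (x, y))" for x y
  have Hm[measurable]: "(\<lambda>(x, y). H x y) \<in> borel_measurable (borel \<Otimes>\<^sub>M borel)"
    unfolding H_def case_prod_beta by measurable
  have pt: "ennreal (?wv (x, y)) \<le> H (\<phi> x) (\<phi> y)" for x y
  proof (cases "x = y")
    case False
    define D where "D = norm (x - y)"
    define D' where "D' = norm (\<phi> x - \<phi> y)"
    have D: "D > 0" using False by (simp add: D_def)
    have "(1 - 4 * \<epsilon>) * D \<le> D'" unfolding D_def D'_def by (rule phi_lipschitz)
    moreover have "(1 - 4 * \<epsilon>) * D > 0" using \<epsilon> D by simp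
    ultimately have D': "D' > 0" by linarith
    have "D' \<le> \<Lambda> * D"
    proof (rule order_trans)
      show "D' \<le> (1 + 4 * \<epsilon>) * D" unfolding D_def D'_def by (rule phi_lipschitz)
      show "(1 + 4 * \<epsilon>) * D \<le> \<Lambda> * D" using \<epsilon> D by (intro mult_right_mono) auto
    qed
    then have a: "1 / D powr S \<le> \<Lambda> powr S / D' powr S"
    proof -
      assume "D' \<le> \<Lambda> * D"
      then have "D' powr S \<le> (\<Lambda> * D) powr S" using S0 D' by (intro powr_mono2) auto
      also have "\<dots> = \<Lambda> powr S * D powr S" using \<epsilon> D by (intro powr_mult)
      finally show ?thesis using D D' \<epsilon> by (simp add: field_simps)
    qed
    have b: "1 / D powr S = (1 + \<epsilon>) powr S / D' powr S" if "\<phi> x \<in> core" "\<phi> y \<in> core"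
    proof -
      have "\<phi> x - \<phi> y = (1 + \<epsilon>) *\<^sub>R (x - y)"
        using core_phi(1)[OF that(1)] core_phi(1)[OF that(2)] by (simp add: algebra_simps)
      then have "D' = (1 + \<epsilon>) * D" using \<epsilon> by (simp add: D_def D'_def)
      then show ?thesis using \<epsilon> D by (simp add: powr_mult)
    qed
    have "1 / D powr S \<le> (if \<phi> x \<in> core \<and> \<phi> y \<in> core then (1 + \<epsilon>) powr S else \<Lambda> powr S) / D' powr S"
      using a b by auto
    from mult_left_mono[OF this, of "\<bar>u (\<phi> x) - u (\<phi> y)\<bar> powr p"] show ?thesis
      unfolding H_def by (intro ennreal_leI) (simp add: nonlocal_density_def S_def D_def D'_def mult_ac)
  qed (simp add: nonlocal_density_def)
  let ?m = "\<lambda>x::'a. ennreal (if x \<in> core then (1 + \<epsilon>) powr - ?N else \<Lambda> powr ?N)"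
  let ?g = "\<lambda>z. (if z \<in> core \<times> core then (1 + \<epsilon>) powr - (?N - s * p) else \<Lambda> powr (2 * ?N + S)) * ?w z"
  have le: "(\<integral>\<^sup>+z. ennreal (?wv z) \<partial>?P) \<le> (\<integral>\<^sup>+z. ennreal (?g z) \<partial>?P)"
  proof -
    have "(\<integral>\<^sup>+z. ennreal (?wv z) \<partial>?P) = (\<integral>\<^sup>+x. (\<integral>\<^sup>+y. ennreal (?wv (x, y)) \<partial>lborel) \<partial>lborel)"
      using wm(2) by (subst lborel.nn_integral_fst[symmetric]) (auto simp: measurable_lborel_pair_iff)
    also have "\<dots> \<le> (\<integral>\<^sup>+x. (\<integral>\<^sup>+y. H (\<phi> x) (\<phi> y) \<partial>lborel) \<partial>lborel)"
      by (intro nn_integral_mono pt)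
    also have "\<dots> \<le> (\<integral>\<^sup>+x. (\<integral>\<^sup>+y. ?m y * H (\<phi> x) y \<partial>lborel) \<partial>lborel)"
      using measurable_compose[OF measurable_Pair1' Hm] by (intro nn_integral_mono nn_integral_phi_le) simp
    also have "\<dots> \<le> (\<integral>\<^sup>+x. ?m x * (\<integral>\<^sup>+y. ?m y * H x y \<partial>lborel) \<partial>lborel)"
    proof (rule nn_integral_phi_le)
      have "(\<lambda>(x, y). ?m y * H x y) \<in> borel_measurable (borel \<Otimes>\<^sub>M lborel)"
        using Hm by (simp add: case_prod_beta)
      from lborel.borel_measurable_nn_integral[OF this]
      show "(\<lambda>x. \<integral>\<^sup>+y. ?m y * H x y \<partial>lborel) \<in> borel_measurable borel" by simp
    qed
    also have "\<dots> = (\<integral>\<^sup>+x. (\<integral>\<^sup>+y. ?m x * (?m y * H x y) \<partial>lborel) \<partial>lborel)"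
      using measurable_compose[OF measurable_Pair1' Hm] by (intro nn_integral_cong nn_integral_cmult[symmetric]) simp
    also have "\<dots> \<le> (\<integral>\<^sup>+x. (\<integral>\<^sup>+y. ennreal (?g (x, y)) \<partial>lborel) \<partial>lborel)"
    proof (intro nn_integral_mono)
      fix x y :: 'a
      have m1: "(1 + \<epsilon>) powr - ?N \<le> \<Lambda> powr ?N"
        using powr_mono[of "- ?N" 0 "1 + \<epsilon>"] powr_mono[of 0 ?N \<Lambda>] \<epsilon> by simp
      have L: "\<Lambda> powr (2 * ?N + S) = \<Lambda> powr ?N * (\<Lambda> powr ?N * \<Lambda> powr S)"
        by (simp add: powr_add[symmetric])
      have C: "(1 + \<epsilon>) powr - (?N - s * p) = (1 + \<epsilon>) powr - ?N * ((1 + \<epsilon>) powr - ?N * (1 + \<epsilon>) powr S)"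
        by (simp add: powr_add[symmetric] S_def)
      have "(if x \<in> core then (1 + \<epsilon>) powr - ?N else \<Lambda> powr ?N) * ((if y \<in> core then (1 + \<epsilon>) powr - ?N else \<Lambda> powr ?N) *
        (if x \<in> core \<and> y \<in> core then (1 + \<epsilon>) powr S else \<Lambda> powr S))
        \<le> (if (x, y) \<in> core \<times> core then (1 + \<epsilon>) powr - (?N - s * p) else \<Lambda> powr (2 * ?N + S))"
        unfolding L C using m1 by (auto intro!: mult_mono)
      from mult_right_mono[OF this w0(1)[of "(x, y)"]]
      show "?m x * (?m y * H x y) \<le> ennreal (?g (x, y))"
        unfolding H_def using w0(1)[of "(x, y)"]
        by (subst ennreal_mult[symmetric], simp, simp)+ (intro ennreal_leI, simp add: mult.assoc)
    qed
    also have "\<dots> = (\<integral>\<^sup>+z. ennreal (?g z) \<partial>?P)"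
    proof (rule lborel.nn_integral_fst)
      have "core \<times> core \<in> sets (borel \<Otimes>\<^sub>M borel :: ('a \<times> 'a) measure)" by (intro pair_measureI) auto
      then show "(\<lambda>z. ennreal (?g z)) \<in> borel_measurable ?P"
        unfolding measurable_lborel_pair_iff by measurable
    qed
    finally show ?thesis .
  qed
  have cc: "core \<times> core \<in> sets ?P" by (intro pair_measureI) auto
  have ig: "integrable ?P ?g" and eg: "(\<integral>z. ?g z \<partial>?P) = (1 + \<epsilon>) powr - (?N - s * p) * c + \<Lambda> powr (2 * ?N + S) * (t - c)"
    using integral_split_weight[OF i cc] by (simp_all add: c_def t_def)
  have "t - c = (\<integral>z. ?w z - indicator (core \<times> core) z * ?w z \<partial>?P)"
    unfolding c_def t_def using i integrable_real_mult_indicator[OF cc i]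
    by (subst Bochner_Integration.integral_diff) (auto simp: mult.commute)
  also have "\<dots> \<ge> 0" using w0 by (intro integral_nonneg_AE AE_I2) (auto simp: indicator_def)
  finally have tc: "t - c \<ge> 0" .
  have wvm: "?wv \<in> borel_measurable ?P" using wm(2) by (simp add: measurable_lborel_pair_iff)
  have g0: "?g z \<ge> 0" for z using w0 by simp
  note R = integral_le_from_nn_integral[OF wvm ig w0(2) g0 le]
  show "integrable ?P ?wv" by (rule R(1))
  have "(\<integral>z. ?wv z \<partial>?P) \<le> (1 + \<epsilon>) powr - (?N - s * p) * c + \<Lambda> powr (2 * ?N + S) * (t - c)"
    using R(2) unfolding eg .
  also have "\<dots> \<le> (1 + \<epsilon>) powr - (?N - s * p) * c + \<Lambda> powr K * (t - c)"
    using K \<epsilon> tc by (intro add_left_mono mult_right_mono powr_mono) (auto simp: S_def)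
  finally show "(\<integral>z. ?wv z \<partial>?P) \<le> (1 + \<epsilon>) powr - (?N - s * p) * c + \<Lambda> powr K * (t - c)" .
qed

end

section \<open>Positivity, continuity and exhaustion by annuli\<close>

text \<open>
  A closed condition that holds for the continuous profile at almost all points holds at all radii:
  otherwise it would fail on a nonempty open set of points.
\<close>

lemma AE_radial_closed:
  fixes f :: "real \<Rightarrow> real"
  assumes fc: "continuous_on {0<..} f" and S: "closed S"
    and ae: "AE x::'a::euclidean_space in lborel. f (norm x) \<in> S" and r: "r > 0"
  shows "f r \<in> S"
proof (rule ccontr)
  assume neg: "f r \<notin> S"
  let ?T = "f -` (- S) \<inter> {0<..}"
  have T: "open ?T" using fc S by (subst (asm) continuous_on_open_vimage) auto
  have "open (norm -` ?T :: 'a set)"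
    using T by (intro open_vimage continuous_intros)
  moreover have "AE x in lborel. x \<notin> (norm -` ?T :: 'a set)"
    using ae by eventually_elim auto
  ultimately have "norm -` ?T = ({} :: 'a set)" by (rule AE_not_in_open_imp_empty)
  moreover obtain b :: 'a where "b \<in> Basis" using nonempty_Basis by blast
  then have "r *\<^sub>R b \<in> norm -` ?T" using r neg by simp
  ultimately show False by blast
qed

lemma profile_continuous:
  fixes f F :: "real \<Rightarrow> real"
  assumes Fi: "\<And>a b. 0 < a \<Longrightarrow> a \<le> b \<Longrightarrow> set_integrable lborel {a..b} F"
    and fF: "\<And>a b. 0 < a \<Longrightarrow> a \<le> b \<Longrightarrow> f b - f a = (LBINT t:{a..b}. F t)"
  shows "continuous_on {0<..} f"
proof -
  have "isCont f r" if r: "r > 0" for r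
  proof -
    have "F integrable_on {r / 2..2 * r}"
      using Fi[of "r / 2" "2 * r"] r by (intro set_borel_integral_eq_integral) auto
    then have cont: "continuous_on {r / 2..2 * r} (\<lambda>x. f (r / 2) + integral {r / 2..x} F)"
      by (intro continuous_intros indefinite_integral_continuous_1)
    have eq: "f x = f (r / 2) + integral {r / 2..x} F" if "x \<in> {r / 2..2 * r}" for x
      using fF[of "r / 2" x] set_borel_integral_eq_integral(2)[OF Fi[of "r / 2" x]] that r by auto
    from continuous_on_eq[OF cont eq[symmetric]] have "continuous_on {r / 2..2 * r} f" by simp
    then show "isCont f r" using r by (intro continuous_on_interior) auto
  qed
  then show ?thesis by (simp add: continuous_at_imp_continuous_on)
qed

lemma profile_increment:
  fixes f F :: "real \<Rightarrow> real"
  assumes Fi: "\<And>a b. 0 < a \<Longrightarrow> a \<le> b \<Longrightarrow> set_integrable lborel {a..b} F"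
    and fF: "\<And>a b. 0 < a \<Longrightarrow> a \<le> b \<Longrightarrow> f b - f a = (LBINT t:{a..b}. F t)"
    and ab: "0 < a" "a \<le> b" "b \<le> c"
  shows "ennreal \<bar>f b - f a\<bar> \<le> (\<integral>\<^sup>+t. ennreal \<bar>F t\<bar> * indicator {a..c} t \<partial>lborel)"
proof -
  have "ennreal \<bar>f b - f a\<bar> = ennreal (norm (\<integral>t. indicator {a..b} t *\<^sub>R F t \<partial>lborel))"
    using fF[OF ab(1,2)] by (simp add: set_lebesgue_integral_def)
  also have "\<dots> \<le> (\<integral>\<^sup>+t. ennreal (norm (indicator {a..b} t *\<^sub>R F t)) \<partial>lborel)"
    using Fi[OF ab(1,2)] unfolding set_integrable_def by (rule integral_norm_bound_ennreal)
  also have "\<dots> \<le> (\<integral>\<^sup>+t. ennreal \<bar>F t\<bar> * indicator {a..c} t \<partial>lborel)"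
    using ab by (intro nn_integral_mono) (auto simp: indicator_def)
  finally show ?thesis .
qed

lemma bregman_real_limit:
  fixes u :: "'a::euclidean_space \<Rightarrow> real" and v :: "nat \<Rightarrow> 'a \<Rightarrow> real"
  assumes lim: "(\<lambda>n. ennreal (1 / e n) * (\<integral>\<^sup>+x. ennreal (norm x powr \<alpha> * \<bar>v n x powr (q - 1) - u x powr (q - 1)\<bar> * \<bar>v n x - u x\<bar>) \<partial>lborel)) \<longlonglongrightarrow> 0"
    and q: "q > 1" and e: "\<And>n. e n > 0" and u0: "AE x in lborel. u x \<ge> 0" and v0: "\<And>n. AE x in lborel. v n x \<ge> 0"
    and i: "\<And>n. integrable lborel (\<lambda>x. norm x powr \<alpha> * ((v n x powr (q - 1) - u x powr (q - 1)) * (v n x - u x)))"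
  shows "(\<lambda>n. (\<integral>x. norm x powr \<alpha> * ((v n x powr (q - 1) - u x powr (q - 1)) * (v n x - u x)) \<partial>lborel) / e n) \<longlonglongrightarrow> 0"
proof -
  let ?b = "\<lambda>n x. norm x powr \<alpha> * ((v n x powr (q - 1) - u x powr (q - 1)) * (v n x - u x))"
  have ae: "AE x in lborel. norm x powr \<alpha> * \<bar>v n x powr (q - 1) - u x powr (q - 1)\<bar> * \<bar>v n x - u x\<bar> = ?b n x \<and> ?b n x \<ge> 0" for n
    using u0 v0[of n]
  proof eventually_elim
    case (elim x)
    show ?case using bregman_bounds(2)[OF q elim] 
      by (metis abs_ge_zero mult.assoc mult_nonneg_nonneg powr_ge_zero)
  qed
  have b0: "(\<integral>x. ?b n x \<partial>lborel) \<ge> 0" for n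
    using ae[of n] by (intro integral_nonneg_AE) auto
  have "(\<integral>\<^sup>+x. ennreal (norm x powr \<alpha> * \<bar>v n x powr (q - 1) - u x powr (q - 1)\<bar> * \<bar>v n x - u x\<bar>) \<partial>lborel)
    = (\<integral>\<^sup>+x. ennreal (?b n x) \<partial>lborel)" for n
    using ae[of n] by (intro nn_integral_cong_AE) auto
  also have "(\<integral>\<^sup>+x. ennreal (?b n x) \<partial>lborel) = ennreal (\<integral>x. ?b n x \<partial>lborel)" for n
    using ae[of n] by (intro nn_integral_eq_integral i) auto
  finally have "ennreal (1 / e n) * (\<integral>\<^sup>+x. ennreal (norm x powr \<alpha> * \<bar>v n x powr (q - 1) - u x powr (q - 1)\<bar> * \<bar>v n x - u x\<bar>) \<partial>lborel)
    = ennreal ((\<integral>x. ?b n x \<partial>lborel) / e n)" for n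
    using e[of n] b0[of n] by (simp add: ennreal_mult[symmetric])
  then have "(\<lambda>n. ennreal ((\<integral>x. ?b n x \<partial>lborel) / e n)) \<longlonglongrightarrow> ennreal 0" using lim by simp
  then show ?thesis by (rule tendsto_ennrealD) (use b0 e in \<open>auto intro!: always_eventually divide_nonneg_pos\<close>)
qed

lemma weighted_power_pos:
  fixes u :: "'a::euclidean_space \<Rightarrow> real"
  assumes i: "integrable lborel (weighted_power \<kappa> r u)" and u0: "AE x in lborel. u x > 0"
  shows "(\<integral>x. weighted_power \<kappa> r u x \<partial>lborel) > 0"
proof -
  have 0: "weighted_power \<kappa> r u x \<ge> 0" for x by (simp add: weighted_power_def)
  have "(\<integral>x. weighted_power \<kappa> r u x \<partial>lborel) \<noteq> 0"
  proof
    assume "(\<integral>x. weighted_power \<kappa> r u x \<partial>lborel) = 0"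
    then have "AE x in lborel. weighted_power \<kappa> r u x = 0"
      using integral_nonneg_eq_0_iff_AE[OF i] 0 by simp
    moreover have "AE x::'a in lborel. x \<noteq> 0" by (rule AE_lborel_singleton)
    ultimately have "AE x::'a in lborel. False" using u0
      by eventually_elim (auto simp: weighted_power_def)
    then have "AE x::'a in lborel. x \<notin> UNIV" by simp
    from AE_not_in_open_imp_empty[OF open_UNIV this] show False by simp
  qed
  moreover have "(\<integral>x. weighted_power \<kappa> r u x \<partial>lborel) \<ge> 0" using 0 by simp
  ultimately show ?thesis by simp
qed

text \<open>
  Here \<open>d\<close>, \<open>a\<close> and \<open>b\<close> are the degrees of homogeneity of \<open>E\<close>, \<open>A\<close> and \<open>B\<close>, and \<open>A - B\<close> is the
  energy.
\<close>

lemma supercritical_contradiction: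
  fixes A B d p q a b :: real
  assumes "A > 0" "B > 0" "p > 0" "q > 0" "q * d > p * a" "b > d"
    and le: "1 / q * (- a * A) \<le> 1 / p * (- d * (A - B)) + 1 / p * (- b * B)"
  shows False
proof -
  have "d * A < d * A + (b - d) * B" using assms by simp
  also have "\<dots> = p * (- (1 / p * (- d * (A - B)) + 1 / p * (- b * B)))" using assms by (simp add: field_simps)
  also have "\<dots> \<le> p * (- (1 / q * (- a * A)))" using le assms by (intro mult_left_mono) auto
  also have "\<dots> = p * a * A / q" by simp
  finally have "q * (d * A) < q * (p * a * A / q)" using assms by (intro mult_strict_left_mono) auto
  then have "(q * d) * A < (p * a) * A" using assms by (simp add: mult.assoc)
  then show False using assms by (simp add: mult_less_cancel_right)
qed

lemma solution_integrable:
  assumes sol: "positive_weak_solution \<gamma> s p q \<alpha> \<beta> u" and p: "p > 1" and q: "q > 1"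
  shows "\<gamma> \<noteq> 0 \<Longrightarrow> integrable lborel (\<lambda>x. norm (weak_grad u x) powr p)"
    and "\<gamma> \<noteq> 1 \<Longrightarrow> integrable (lborel \<Otimes>\<^sub>M lborel) (nonlocal_density s p u)"
    and "integrable lborel (weighted_power \<beta> p u)"
    and "integrable lborel (weighted_power \<alpha> q u)"
proof -
  have "weak_form_defined \<gamma> s p q \<alpha> \<beta> u u" using sol by (simp add: positive_weak_solution_def)
  then show "\<gamma> \<noteq> 0 \<Longrightarrow> integrable lborel (\<lambda>x. norm (weak_grad u x) powr p)"
    "\<gamma> \<noteq> 1 \<Longrightarrow> integrable (lborel \<Otimes>\<^sub>M lborel) (nonlocal_density s p u)"
    "integrable lborel (weighted_power \<beta> p u)" "integrable lborel (weighted_power \<alpha> q u)"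
    using integrand_self[OF p, where u = u] integrand_self(3)[OF q, where u = u] by (auto simp: weak_form_defined_def)
qed

lemma integrable_imp_weighted_norm_finite:
  "integrable lborel (weighted_power \<beta> p v) \<Longrightarrow> weighted_norm_pow p \<beta> v < \<infinity>"
  unfolding integrable_iff_bounded weighted_norm_pow_def weighted_power_def by simp

text \<open>
  The core for \<open>\<delta> = 1 / (4 (j + 1))\<close> and \<open>R = j + 1\<close>, which is \<open>{x. 1 / (j + 1) \<le> |x| \<le> j + 1}\<close>.
\<close>

definition annulus :: "nat \<Rightarrow> 'a::euclidean_space set" where
  "annulus j = cut_off_dilation.core (1 / (4 * (real j + 1))) (real j + 1)"

lemma cut_off_dilation_exhaustion:
  "0 < \<epsilon> \<Longrightarrow> \<epsilon> \<le> 1 / 8 \<Longrightarrow> cut_off_dilation (1 / (4 * (real j + 1))) (real j + 1) \<epsilon>"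
  by unfold_locales (auto simp: field_simps)

lemma annulus_measurable[measurable]: "annulus j \<in> sets borel"
  unfolding annulus_def
  by (rule cut_off_dilation.core_measurable[OF cut_off_dilation_exhaustion[of "1 / 8"]]) auto

lemma annulus_eventually:
  assumes "x \<noteq> 0"
  shows "\<forall>\<^sub>F j in sequentially. x \<in> annulus j"
proof -
  have x: "norm x > 0" using assms by simp
  have "\<forall>\<^sub>F j in sequentially. real j \<ge> max (norm x) (1 / norm x)"
    by (metis eventually_sequentiallyI filterlim_at_top filterlim_real_sequentially)
  then show ?thesis
  proof eventually_elim
    case (elim j)
    have "1 / norm x \<le> real j + 1" "norm x \<le> real j + 1" using elim by auto
    then have "1 / (real j + 1) \<le> norm x" using x by (simp add: field_simps)
    moreover have "annulus j = {x::'a. 4 * (1 / (4 * (real j + 1))) \<le> norm x \<and> norm x \<le> real j + 1}"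
      unfolding annulus_def by (rule cut_off_dilation.core_def[OF cut_off_dilation_exhaustion[of "1 / 8" j]]) auto
    moreover have "4 * (1 / (4 * y)) = 1 / y" for y :: real by simp
    ultimately show ?case using \<open>norm x \<le> real j + 1\<close> by (simp del: distrib_left_numeral)
  qed
qed

lemma exhaustion_limit:
  fixes h :: "'b \<Rightarrow> real"
  assumes h: "integrable M h" and G[measurable]: "\<And>j. G j \<in> sets M"
    and ev: "AE x in M. \<forall>\<^sub>F j in sequentially. x \<in> G j"
  shows "(\<lambda>j. \<integral>x. indicator (G j) x * h x \<partial>M) \<longlonglongrightarrow> (\<integral>x. h x \<partial>M)"
proof (rule integral_dominated_convergence[where w = "\<lambda>x. \<bar>h x\<bar>"])
  show "AE x in M. (\<lambda>j. indicator (G j) x * h x) \<longlonglongrightarrow> h x"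
    using ev
  proof eventually_elim
    case (elim x)
    then have "\<forall>\<^sub>F j in sequentially. h x = indicator (G j) x * h x" by eventually_elim simp
    then show ?case by (rule Lim_transform_eventually[OF tendsto_const])
  qed
  show "(\<lambda>x. indicator (G j) x * h x) \<in> borel_measurable M" for j
    using borel_measurable_integrable[OF h] by measurable
qed (use h in \<open>auto simp: indicator_def\<close>)

lemma annulus_limit:
  fixes h :: "'a::euclidean_space \<Rightarrow> real"
  assumes h: "integrable lborel h"
  shows "(\<lambda>j. \<integral>x. indicator (annulus j) x * h x \<partial>lborel) \<longlonglongrightarrow> (\<integral>x. h x \<partial>lborel)"
proof (rule exhaustion_limit[OF h])
  have "AE x::'a in lborel. x \<noteq> 0" by (rule AE_lborel_singleton)
  then show "AE x::'a in lborel. \<forall>\<^sub>F j in sequentially. x \<in> annulus j"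
    by eventually_elim (rule annulus_eventually)
qed simp

lemma annulus_limit_pair:
  fixes h :: "'a::euclidean_space \<times> 'a \<Rightarrow> real"
  assumes h: "integrable (lborel \<Otimes>\<^sub>M lborel) h"
  shows "(\<lambda>j. \<integral>z. indicator (annulus j \<times> annulus j) z * h z \<partial>(lborel \<Otimes>\<^sub>M lborel)) \<longlonglongrightarrow> (\<integral>z. h z \<partial>(lborel \<Otimes>\<^sub>M lborel))"
proof (rule exhaustion_limit[OF h])
  have "AE z in lborel \<Otimes>\<^sub>M lborel. fst z \<noteq> (0::'a) \<and> snd z \<noteq> (0::'a)"
  proof (rule lborel_pair.AE_pair_measure)
    have "Measurable.pred (borel \<Otimes>\<^sub>M borel) (\<lambda>z. fst z \<noteq> (0::'a) \<and> snd z \<noteq> (0::'a))" by measurable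
    then have "Measurable.pred (lborel \<Otimes>\<^sub>M lborel) (\<lambda>z. fst z \<noteq> (0::'a) \<and> snd z \<noteq> (0::'a))"
      by (simp add: measurable_lborel_pair_iff)
    then show "{z \<in> space (lborel \<Otimes>\<^sub>M lborel). fst z \<noteq> (0::'a) \<and> snd z \<noteq> (0::'a)} \<in> sets (lborel \<Otimes>\<^sub>M lborel)"
      by (simp add: pred_def)
    have a: "AE y::'a in lborel. y \<noteq> 0" by (rule AE_lborel_singleton)
    show "AE x in lborel. AE y in lborel. fst (x, y) \<noteq> (0::'a) \<and> snd (x, y) \<noteq> (0::'a)"
      using a by eventually_elim (use a in simp)
  qed
  then show "AE z in lborel \<Otimes>\<^sub>M lborel. \<forall>\<^sub>F j in sequentially. z \<in> (annulus j :: 'a set) \<times> (annulus j :: 'a set)"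
  proof eventually_elim
    case (elim z)
    from eventually_conj[OF annulus_eventually[OF conjunct1[OF elim]] annulus_eventually[OF conjunct2[OF elim]]]
    show ?case by eventually_elim (auto simp: mem_Times_iff)
  qed
  show "(annulus j :: 'a set) \<times> (annulus j :: 'a set) \<in> sets (lborel \<Otimes>\<^sub>M lborel)" for j by (intro pair_measureI) auto
qed

section \<open>The purely nonlocal problem\<close>

text \<open>
  The cut-off dilations that are exact over \<open>annulus j\<close>, with \<open>\<epsilon> = 1 / (n + 8)\<close>; the shift by 8
  ensures \<open>\<epsilon> \<le> 1/8\<close>.
\<close>

definition dilated :: "nat \<Rightarrow> nat \<Rightarrow> 'a::euclidean_space \<Rightarrow> 'a" where
  "dilated j n = local_dilation (1 / (4 * (real j + 1))) (real j + 1) (1 / (real n + 8))"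

lemma dilated_cut_off: "cut_off_dilation (1 / (4 * (real j + 1))) (real j + 1) (1 / (real n + 8))"
  by (rule cut_off_dilation_exhaustion) (auto simp: field_simps)

lemma step_tendsto_zero: "(\<lambda>n. 1 / (real n + 8)) \<longlonglongrightarrow> 0"
proof -
  have "(\<lambda>n. 1 / real (n + 8)) \<longlonglongrightarrow> 0" by (rule LIMSEQ_ignore_initial_segment[OF lim_1_over_n])
  then show ?thesis by simp
qed

lemma integrable_imp_seminorm_finite:
  assumes "integrable (lborel \<Otimes>\<^sub>M lborel) (nonlocal_density s p v)" "s \<noteq> 1"
  shows "seminorm_pow s p v < \<infinity>"
proof -
  have "seminorm_pow s p v = (\<integral>\<^sup>+z. ennreal (norm (nonlocal_density s p v z)) \<partial>(lborel \<Otimes>\<^sub>M lborel))"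
    unfolding seminorm_pow_def nonlocal_density_def using assms(2)
    by (simp, intro nn_integral_cong) (auto split: prod.split)
  then show ?thesis using assms(1) by (simp add: integrable_iff_bounded)
qed

lemma sol_space_dilated:
  fixes u :: "'a::euclidean_space \<Rightarrow> real"
  assumes u: "u \<in> sol_space 0 s p \<beta>" and s: "s \<noteq> 1" "s * p \<ge> 0"
    and inl: "integrable (lborel \<Otimes>\<^sub>M lborel) (nonlocal_density s p u)"
    and iB: "integrable lborel (weighted_power \<beta> p u)"
  shows "(\<lambda>x. u (dilated j n x)) \<in> sol_space 0 s p \<beta>"
proof -
  let ?v = "\<lambda>x. u (dilated j n x)"
  interpret cut_off_dilation "1 / (4 * (real j + 1))" "real j + 1" "1 / (real n + 8)" by (rule dilated_cut_off)
  have um[measurable]: "u \<in> borel_measurable borel" and rad: "radial u"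
    using u by (auto simp: sol_space_def W_rad_def W_space_def L_weighted_def)
  have vm: "?v \<in> borel_measurable borel" unfolding dilated_def by measurable
  have "weighted_norm_pow p \<beta> ?v < \<infinity>"
    unfolding dilated_def by (rule integrable_imp_weighted_norm_finite weighted_phi(1)[OF um iB order_refl])+
  moreover have "seminorm_pow s p ?v < \<infinity>"
    unfolding dilated_def by (rule integrable_imp_seminorm_finite[OF nonlocal_phi(1)[OF um inl s(2) order_refl] s(1)])
  moreover have "radial ?v"
  proof -
    obtain f0 where f0[measurable]: "f0 \<in> borel_measurable borel" and uf0: "AE x in lborel. u x = f0 (norm x)"
      using rad by (auto simp: radial_def)
    have "AE x in lborel. ?v x = f0 (norm x + 1 / (real n + 8) * cutoff_radius (1 / (4 * (real j + 1))) (real j + 1) (norm x))"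
      using AE_phi[OF uf0] by eventually_elim (simp only: norm_phi dilated_def)
    moreover have "(\<lambda>r. f0 (r + 1 / (real n + 8) * cutoff_radius (1 / (4 * (real j + 1))) (real j + 1) r)) \<in> borel_measurable borel"
      unfolding cutoff_radius_def by measurable
    ultimately show ?thesis unfolding radial_def by (intro bexI)
  qed
  ultimately show ?thesis using vm by (simp add: sol_space_def W_rad_def W_space_def L_weighted_def)
qed

text \<open>
  For fixed \<open>j\<close> the deformation moves only points of a compact annulus. There \<open>F\<close> is integrable and the
  weights are bounded, so that a constant majorant \<open>W\<close> suffices.
\<close>

lemma bregman_dilated:
  fixes u :: "'a::euclidean_space \<Rightarrow> real" and f F :: "real \<Rightarrow> real"
  assumes um[measurable]: "u \<in> borel_measurable borel" and Fm[measurable]: "F \<in> borel_measurable borel"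
    and Fi: "\<And>a b. 0 < a \<Longrightarrow> a \<le> b \<Longrightarrow> set_integrable lborel {a..b} F"
    and fF: "\<And>a b. 0 < a \<Longrightarrow> a \<le> b \<Longrightarrow> f b - f a = (LBINT t:{a..b}. F t)"
    and uf: "AE x in lborel. u x = f (norm x)"
    and fb: "\<And>r. r > 0 \<Longrightarrow> 0 \<le> f r \<and> f r \<le> M" and q: "q > 1" and N\<alpha>: "real DIM('a) + \<alpha> > 0"
  shows "(\<lambda>n. ennreal (1 / (1 / (real n + 8))) * (\<integral>\<^sup>+x. ennreal (norm x powr \<alpha> * \<bar>u (dilated j n x) powr (q - 1) - u x powr (q - 1)\<bar> * \<bar>u (dilated j n x) - u x\<bar>) \<partial>lborel)) \<longlonglongrightarrow> 0"
proof -
  define \<delta> R where "\<delta> = 1 / (4 * (real j + 1))" and "R = real j + 1"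
  have C: "cut_off_dilation \<delta> R (1 / (real n + 8))" for n unfolding \<delta>_def R_def by (rule dilated_cut_off)
  have dil: "dilated j n = local_dilation \<delta> R (1 / (real n + 8))" for n by (simp add: dilated_def \<delta>_def R_def)
  have \<delta>: "\<delta> > 0" "R > 0" "\<delta> \<le> R" using cut_off_dilation.\<delta>[OF C] cut_off_dilation.\<delta>R[OF C] by (auto simp: R_def)
  define k where "k n r = r + 1 / (real n + 8) * cutoff_radius \<delta> R r" for n r
  \<comment> \<open>Points with \<open>\<delta> < |x| < 2 R\<close> move outwards by a factor of at most 2.\<close>
  define F0 where "F0 t = \<bar>F t\<bar> * indicator {\<delta>..4 * R} t" for t
  have fc: "continuous_on {0<..} f" by (rule profile_continuous[OF Fi fF])
  have M0: "M \<ge> 0" using fb[of 1] by simp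
  have [measurable]: "{\<delta>..4 * R} \<in> sets borel" by simp
  show ?thesis
  proof (rule bregman_little_o[where f = f and ?F0.0 = F0 and W = "\<lambda>_. M powr (q - 1)" and k = k])
    show "(\<lambda>x. u (dilated j n x)) \<in> borel_measurable borel" for n
      unfolding dil using cut_off_dilation.phi_measurable[OF C] um by (rule measurable_compose)
    show "F0 \<in> borel_measurable borel" unfolding F0_def[abs_def] by measurable
    show "(\<lambda>n. 1 / (real n + 8)) \<longlonglongrightarrow> 0" by (rule step_tendsto_zero)
    show "AE x in lborel. u (dilated j n x) = f (k n (norm x))" for n
      using cut_off_dilation.AE_phi[OF C uf] unfolding dil k_def cut_off_dilation.norm_phi[OF C] .
    show "r \<le> k n r" "k n r \<le> (1 + 1 / (real n + 8)) * r" if "r > 0" for n r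
    proof -
      show "r \<le> k n r" using cutoff_radius(1)[of \<delta> R r] by (simp add: k_def)
      have "1 / (real n + 8) * cutoff_radius \<delta> R r \<le> 1 / (real n + 8) * r"
        using cutoff_radius(2)[of r \<delta> R] that by (intro mult_left_mono) auto
      then show "k n r \<le> (1 + 1 / (real n + 8)) * r" unfolding k_def distrib_right by simp
    qed
    note k = this
    show "ennreal \<bar>f (k n r) - f r\<bar> \<le> (\<integral>\<^sup>+t. ennreal (F0 t) * indicator {r..(1 + 1 / (real n + 8)) * r} t \<partial>lborel)" if r: "r > 0" for n r
    proof (cases "r \<in> {\<delta><..<2 * R}")
      case True
      have "(1 + 1 / (real n + 8)) * r \<le> 2 * r" using r by (intro mult_right_mono) (auto simp: field_simps)
      then have le: "(1 + 1 / (real n + 8)) * r \<le> 4 * R" using True by auto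
      have "ennreal \<bar>f (k n r) - f r\<bar> \<le> (\<integral>\<^sup>+t. ennreal \<bar>F t\<bar> * indicator {r..(1 + 1 / (real n + 8)) * r} t \<partial>lborel)"
        by (rule profile_increment[OF Fi fF r k[OF r]])
      also have "\<dots> = (\<integral>\<^sup>+t. ennreal (F0 t) * indicator {r..(1 + 1 / (real n + 8)) * r} t \<partial>lborel)"
        using True le by (intro nn_integral_cong) (auto simp: F0_def indicator_def)
      finally show ?thesis .
    next
      case False
      then have "k n r = r" using cutoff_radius(5)[of r \<delta> R] by (simp add: k_def)
      then show ?thesis by simp
    qed
    show "f r powr (q - 1) \<le> M powr (q - 1)" if "r > 0" for r
      using fb[OF that] q by (intro powr_mono2) auto
    show "(\<integral>\<^sup>+t. indicator {0<..} t * ennreal (F0 t * (t powr (real DIM('a) + \<alpha>) * M powr (q - 1))) \<partial>lborel) < \<infinity>"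
    proof -
      let ?K = "(4 * R) powr (real DIM('a) + \<alpha>) * M powr (q - 1)"
      have "(\<integral>\<^sup>+t. indicator {0<..} t * ennreal (F0 t * (t powr (real DIM('a) + \<alpha>) * M powr (q - 1))) \<partial>lborel)
        \<le> (\<integral>\<^sup>+t. ennreal ?K * ennreal (norm (indicator {\<delta>..4 * R} t *\<^sub>R F t)) \<partial>lborel)"
      proof (rule nn_integral_mono)
        fix t
        show "indicator {0<..} t * ennreal (F0 t * (t powr (real DIM('a) + \<alpha>) * M powr (q - 1)))
          \<le> ennreal ?K * ennreal (norm (indicator {\<delta>..4 * R} t *\<^sub>R F t))"
        proof (cases "t \<in> {\<delta>..4 * R}")
          case True
          then have "t powr (real DIM('a) + \<alpha>) * M powr (q - 1) \<le> ?K"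
            using \<delta> N\<alpha> by (intro mult_right_mono powr_mono2) auto
          from mult_right_mono[OF this, of "\<bar>F t\<bar>"] show ?thesis
            using True \<delta> by (auto simp: F0_def ennreal_mult[symmetric] mult.commute intro!: ennreal_leI)
        qed (simp add: F0_def)
      qed
      also have "\<dots> = ennreal ?K * (\<integral>\<^sup>+t. ennreal (norm (indicator {\<delta>..4 * R} t *\<^sub>R F t)) \<partial>lborel)"
        by (rule nn_integral_cmult) measurable
      also have "\<dots> < \<infinity>"
        using Fi[of \<delta> "4 * R"] \<delta> unfolding set_integrable_def integrable_iff_bounded by (auto simp: ennreal_mult_less_top)
      finally show ?thesis .
    qed
  qed (use um uf fb fc q in \<open>auto simp: F0_def field_simps\<close>)
qed

text \<open>
  First \<open>\<epsilon> \<rightarrow> 0\<close> for each annulus, then the annuli exhaust the space. The exponent \<open>K\<close> only has to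
  dominate the three crude exponents.
\<close>

theorem no_nonlocal_solution:
  fixes u :: "'a::euclidean_space \<Rightarrow> real"
  assumes p: "p > 1" and s: "0 < s" "s < 1" "s * p < real DIM('a)"
    and \<alpha>: "\<alpha> > - (s * p)" and \<beta>: "\<beta> > - (s * p)"
    and q: "q > p * (real DIM('a) + \<alpha>) / (real DIM('a) - s * p)"
    and u: "u \<in> X_tilde 0 s p \<beta>" and sol: "positive_weak_solution 0 s p q \<alpha> \<beta> u"
  shows False
proof -
  let ?N = "real DIM('a)" and ?d = "real DIM('a) - s * p"
  have sp: "s * p > 0" using s p by simp
  have d: "?d > 0" using s by simp
  have qd: "q * ?d > p * (?N + \<alpha>)" using q d by (simp add: pos_divide_less_eq)
  have "p * ?d < q * ?d" using qd \<alpha> p mult_strict_left_mono[of ?d "?N + \<alpha>" p] by linarith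
  then have qp: "q > p" using d by (simp add: mult_less_cancel_right)
  then have q1: "q > 1" using p by simp
  have us: "u \<in> sol_space 0 s p \<beta>" and wd: "weakly_differentiable u"
    using u by (auto simp: X_tilde_def)
  obtain M where M: "AE x in lborel. \<bar>u x\<bar> \<le> M" using u by (auto simp: X_tilde_def)
  have um[measurable]: "u \<in> borel_measurable borel" and rad: "radial u"
    using us by (auto simp: sol_space_def W_rad_def W_space_def L_weighted_def)
  have u0: "AE x in lborel. u x > 0" using sol by (simp add: positive_weak_solution_def)
  then have u0': "AE x in lborel. u x \<ge> 0" by eventually_elim simp
  note I = solution_integrable[OF sol p q1]
  have inl: "integrable (lborel \<Otimes>\<^sub>M lborel) (nonlocal_density s p u)" using I(2) by simp
  obtain f F :: "real \<Rightarrow> real" where F: "F \<in> borel_measurable borel"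
    "\<And>a b. 0 < a \<Longrightarrow> a \<le> b \<Longrightarrow> set_integrable lborel {a..b} F"
    "\<And>a b. 0 < a \<Longrightarrow> a \<le> b \<Longrightarrow> f b - f a = (LBINT t:{a..b}. F t)"
    and uf: "AE x in lborel. u x = f (norm x)"
    by (rule radial_profile[OF weak_grad_works[OF wd] rad, where p = 1]) (rule that; assumption)
  have fb: "0 \<le> f r \<and> f r \<le> M" if "r > 0" for r
  proof -
    have "AE x in lborel. f (norm (x::'a)) \<in> {0..M}"
      using uf u0' M by eventually_elim auto
    from AE_radial_closed[OF profile_continuous[OF F(2,3)] closed_atLeastAtMost this that] show ?thesis by simp
  qed
  define A B E where "A = (\<integral>x. weighted_power \<alpha> q u x \<partial>lborel)" and "B = (\<integral>x. weighted_power \<beta> p u x \<partial>lborel)"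
    and "E = (\<integral>z. nonlocal_density s p u z \<partial>(lborel \<Otimes>\<^sub>M lborel))"
  define Ac Bc Ec where "Ac j = (\<integral>x. indicator (annulus j) x * weighted_power \<alpha> q u x \<partial>lborel)"
    and "Bc j = (\<integral>x. indicator (annulus j) x * weighted_power \<beta> p u x \<partial>lborel)"
    and "Ec j = (\<integral>z. indicator (annulus j \<times> annulus j) z * nonlocal_density s p u z \<partial>(lborel \<Otimes>\<^sub>M lborel))" for j
  have en: "energy 0 s p w = (\<integral>z. nonlocal_density s p w z \<partial>(lborel \<Otimes>\<^sub>M lborel))" for w :: "'a \<Rightarrow> real"
    by (simp add: energy_def)
  define K where "K = 3 * ?N + s * p + \<bar>\<alpha>\<bar> + \<bar>\<beta>\<bar>"
  have lims: "Ac \<longlonglongrightarrow> A" "Bc \<longlonglongrightarrow> B" "Ec \<longlonglongrightarrow> E"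
    unfolding Ac_def[abs_def] Bc_def[abs_def] Ec_def[abs_def] A_def B_def E_def
    using annulus_limit[OF I(4)] annulus_limit[OF I(3)] annulus_limit_pair[OF inl] by auto
  have AEB: "A = E + B"
    using test_inequality(1)[OF sol us p q1 _ _ u0' _ _ I(3,4)] inl by (simp add: A_def B_def E_def en)
  have "1 / q * (- (?N + \<alpha>) * Ac j - 8 * K * (A - Ac j))
      \<le> 1 / p * (- ?d * Ec j + 8 * K * (E - Ec j)) + 1 / p * (- (?N + \<beta>) * Bc j + 8 * K * (B - Bc j))" for j
  proof -
    define e where "e n = 1 / (real n + 8)" for n
    define v where "v n x = u (dilated j n x)" for n x
    note C = dilated_cut_off[of j]
    have vs: "v n \<in> sol_space 0 s p \<beta>" for n
      unfolding v_def by (rule sol_space_dilated[OF us _ _ inl I(3)]) (use s sp in auto)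
    have v0: "AE x in lborel. v n x \<ge> 0" for n
      using cut_off_dilation.AE_phi[OF C u0'] by (simp add: v_def dilated_def)
    have KA: "?N + \<bar>\<alpha>\<bar> \<le> K" "?N + \<bar>\<beta>\<bar> \<le> K" "3 * ?N + s * p \<le> K" using sp by (auto simp: K_def)
    note WA = cut_off_dilation.weighted_phi[OF C um I(4) KA(1), folded dilated_def annulus_def v_def e_def, folded A_def Ac_def]
    note WB = cut_off_dilation.weighted_phi[OF C um I(3) KA(2), folded dilated_def annulus_def v_def e_def, folded B_def Bc_def]
    note WE = cut_off_dilation.nonlocal_phi[OF C um inl less_imp_le[OF sp] KA(3), folded dilated_def annulus_def v_def e_def, folded E_def Ec_def]
    note T = test_inequality[OF sol vs p q1 _ _ v0 _ WE(1) WB(1) WA(1), folded A_def B_def, unfolded en, folded E_def]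
    show ?thesis
    proof (rule pohozaev_limit[where e = e and Av = "\<lambda>n. \<integral>x. weighted_power \<alpha> q (v n) x \<partial>lborel"
          and Bv = "\<lambda>n. \<integral>x. weighted_power \<beta> p (v n) x \<partial>lborel"
          and Ev = "\<lambda>n. \<integral>z. nonlocal_density s p (v n) z \<partial>(lborel \<Otimes>\<^sub>M lborel)"
          and Br = "\<lambda>n. \<integral>x. norm x powr \<alpha> * ((v n x powr (q - 1) - u x powr (q - 1)) * (v n x - u x)) \<partial>lborel"])
      show "e n > 0" for n by (simp add: e_def)
      show "e \<longlonglongrightarrow> 0" unfolding e_def[abs_def] by (rule step_tendsto_zero)
      show "p > 0" "q > 0" using p q1 by auto
      fix n
      show "1 / q * ((\<integral>x. weighted_power \<alpha> q (v n) x \<partial>lborel) - (Ac j + (A - Ac j)))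
         - (\<integral>x. norm x powr \<alpha> * ((v n x powr (q - 1) - u x powr (q - 1)) * (v n x - u x)) \<partial>lborel)
        \<le> 1 / p * ((\<integral>z. nonlocal_density s p (v n) z \<partial>(lborel \<Otimes>\<^sub>M lborel)) - (Ec j + (E - Ec j)))
         + 1 / p * ((\<integral>x. weighted_power \<beta> p (v n) x \<partial>lborel) - (Bc j + (B - Bc j)))"
        using T(3)[of n] by simp
      show "(1 + e n) powr - (?N + \<alpha>) * Ac j + (1 + 8 * e n) powr - K * (A - Ac j) \<le> (\<integral>x. weighted_power \<alpha> q (v n) x \<partial>lborel)"
        by (rule WA(3))
      show "(\<integral>x. weighted_power \<beta> p (v n) x \<partial>lborel) \<le> (1 + e n) powr - (?N + \<beta>) * Bc j + (1 + 8 * e n) powr K * (B - Bc j)"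
        by (rule WB(2))
      show "(\<integral>z. nonlocal_density s p (v n) z \<partial>(lborel \<Otimes>\<^sub>M lborel)) \<le> (1 + e n) powr - ?d * Ec j + (1 + 8 * e n) powr K * (E - Ec j)"
        by (rule WE(2))
    next
      show "(\<lambda>n. (\<integral>x. norm x powr \<alpha> * ((v n x powr (q - 1) - u x powr (q - 1)) * (v n x - u x)) \<partial>lborel) / e n) \<longlonglongrightarrow> 0"
      proof (rule bregman_real_limit[OF _ q1 _ u0' v0])
        show "(\<lambda>n. ennreal (1 / e n) * (\<integral>\<^sup>+x. ennreal (norm x powr \<alpha> * \<bar>v n x powr (q - 1) - u x powr (q - 1)\<bar> * \<bar>v n x - u x\<bar>) \<partial>lborel)) \<longlonglongrightarrow> 0"
          unfolding e_def v_def using \<alpha> d by (intro bregman_dilated[OF um F uf fb q1]) auto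
        show "integrable lborel (\<lambda>x. norm x powr \<alpha> * ((v n x powr (q - 1) - u x powr (q - 1)) * (v n x - u x)))" for n
          using T(2)[of n] by simp
      qed (simp add: e_def)
    qed
  qed
  moreover have "(\<lambda>j. 1 / q * (- (?N + \<alpha>) * Ac j - 8 * K * (A - Ac j))) \<longlonglongrightarrow> 1 / q * (- (?N + \<alpha>) * A - 8 * K * (A - A))"
    by (intro tendsto_mult tendsto_diff tendsto_const lims)
  moreover have "(\<lambda>j. 1 / p * (- ?d * Ec j + 8 * K * (E - Ec j)) + 1 / p * (- (?N + \<beta>) * Bc j + 8 * K * (B - Bc j)))
      \<longlonglongrightarrow> 1 / p * (- ?d * E + 8 * K * (E - E)) + 1 / p * (- (?N + \<beta>) * B + 8 * K * (B - B))"
    by (intro tendsto_mult tendsto_diff tendsto_add tendsto_const lims)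
  ultimately have "1 / q * (- (?N + \<alpha>) * A - 8 * K * (A - A))
      \<le> 1 / p * (- ?d * E + 8 * K * (E - E)) + 1 / p * (- (?N + \<beta>) * B + 8 * K * (B - B))"
    by (intro LIMSEQ_le) auto
  then have "1 / q * (- (?N + \<alpha>) * A) \<le> 1 / p * (- ?d * (A - B)) + 1 / p * (- (?N + \<beta>) * B)"
    using AEB by simp
  moreover have "A > 0" "B > 0" unfolding A_def B_def by (rule weighted_power_pos[OF I(4) u0] weighted_power_pos[OF I(3) u0])+
  ultimately show False
    by (intro supercritical_contradiction[where A = A and B = B and d = ?d and a = "?N + \<alpha>" and b = "?N + \<beta>"]) (use p q1 qd \<beta> in auto)
qed

section \<open>Dilations and radial decay\<close>

lemma weighted_power_scale:
  fixes u :: "'a::euclidean_space \<Rightarrow> real"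
  assumes c: "c > 0" and i: "integrable lborel (weighted_power \<kappa> r u)"
  shows "integrable lborel (weighted_power \<kappa> r (\<lambda>x. u (c *\<^sub>R x)))"
    and "(\<integral>x. weighted_power \<kappa> r (\<lambda>x. u (c *\<^sub>R x)) x \<partial>lborel)
      = c powr - (real DIM('a) + \<kappa>) * (\<integral>x. weighted_power \<kappa> r u x \<partial>lborel)"
proof -
  have eq: "weighted_power \<kappa> r (\<lambda>x. u (c *\<^sub>R x)) = (\<lambda>x. c powr - \<kappa> * weighted_power \<kappa> r u (c *\<^sub>R x))"
    using c by (auto simp: weighted_power_def powr_mult powr_minus fun_eq_iff)
  show "integrable lborel (weighted_power \<kappa> r (\<lambda>x. u (c *\<^sub>R x)))"
    unfolding eq by (intro integrable_mult_right integrable_scale i c)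
  show "(\<integral>x. weighted_power \<kappa> r (\<lambda>x. u (c *\<^sub>R x)) x \<partial>lborel)
      = c powr - (real DIM('a) + \<kappa>) * (\<integral>x. weighted_power \<kappa> r u x \<partial>lborel)"
    unfolding eq by (simp add: integral_scale[OF c, of "weighted_power \<kappa> r u"] powr_diff powr_minus field_simps)
qed

lemma nonlocal_density_scale:
  fixes u :: "'a::euclidean_space \<Rightarrow> real"
  assumes c: "c > 0" and i: "integrable (lborel \<Otimes>\<^sub>M lborel) (nonlocal_density s p u)"
  shows "integrable (lborel \<Otimes>\<^sub>M lborel) (nonlocal_density s p (\<lambda>x. u (c *\<^sub>R x)))"
    and "(\<integral>z. nonlocal_density s p (\<lambda>x. u (c *\<^sub>R x)) z \<partial>(lborel \<Otimes>\<^sub>M lborel))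
      = c powr - (real DIM('a) - s * p) * (\<integral>z. nonlocal_density s p u z \<partial>(lborel \<Otimes>\<^sub>M lborel))"
proof -
  let ?S = "real DIM('a) + s * p"
  have eq: "nonlocal_density s p (\<lambda>x. u (c *\<^sub>R x)) = (\<lambda>z. c powr ?S * nonlocal_density s p u (c *\<^sub>R z))"
  proof
    fix z :: "'a \<times> 'a"
    obtain x y where z: "z = (x, y)" by (cases z)
    have "norm (c *\<^sub>R x - c *\<^sub>R y) = c * norm (x - y)" using c by (simp add: scaleR_diff_right[symmetric])
    then show "nonlocal_density s p (\<lambda>x. u (c *\<^sub>R x)) z = c powr ?S * nonlocal_density s p u (c *\<^sub>R z)"
      using c by (simp add: z nonlocal_density_def powr_mult)
  qed
  have i': "integrable lborel (nonlocal_density s p u)" using i by (simp add: lborel_prod)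
  show "integrable (lborel \<Otimes>\<^sub>M lborel) (nonlocal_density s p (\<lambda>x. u (c *\<^sub>R x)))"
    unfolding eq lborel_prod by (intro integrable_mult_right integrable_scale i' c)
  have "c powr ?S * c powr - real DIM('a \<times> 'a) = c powr - (real DIM('a) - s * p)"
    by (simp add: powr_add[symmetric])
  then show "(\<integral>z. nonlocal_density s p (\<lambda>x. u (c *\<^sub>R x)) z \<partial>(lborel \<Otimes>\<^sub>M lborel))
      = c powr - (real DIM('a) - s * p) * (\<integral>z. nonlocal_density s p u z \<partial>(lborel \<Otimes>\<^sub>M lborel))"
    unfolding eq lborel_prod by (simp add: integral_scale[OF c, of "nonlocal_density s p u"] mult.assoc[symmetric])
qed

lemma gradient_power_scale:
  fixes u :: "'a::euclidean_space \<Rightarrow> real"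
  assumes c: "c > 0" and wd: "weakly_differentiable u" and i: "integrable lborel (\<lambda>x. norm (weak_grad u x) powr p)"
  shows "integrable lborel (\<lambda>x. norm (weak_grad (\<lambda>x. u (c *\<^sub>R x)) x) powr p)"
    and "(\<integral>x. norm (weak_grad (\<lambda>x. u (c *\<^sub>R x)) x) powr p \<partial>lborel)
      = c powr - (real DIM('a) - p) * (\<integral>x. norm (weak_grad u x) powr p \<partial>lborel)"
proof -
  note W = weak_grad_scale[OF wd c]
  have [measurable]: "weak_grad (\<lambda>x. u (c *\<^sub>R x)) \<in> borel_measurable borel"
    using has_weak_gradientD(2)[OF weak_grad_works[OF W(1)]] by (rule L1_locD)
  have ae: "AE x in lborel. norm (weak_grad (\<lambda>x. u (c *\<^sub>R x)) x) powr p = c powr p * norm (weak_grad u (c *\<^sub>R x)) powr p"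
    using W(2) by eventually_elim (use c in \<open>simp add: powr_mult\<close>)
  have i2: "integrable lborel (\<lambda>x. c powr p * norm (weak_grad u (c *\<^sub>R x)) powr p)"
    by (intro integrable_mult_right integrable_scale[of "\<lambda>x. norm (weak_grad u x) powr p"] i c)
  have m2: "(\<lambda>x. c powr p * norm (weak_grad u (c *\<^sub>R x)) powr p) \<in> borel_measurable lborel"
    using i2 by (rule borel_measurable_integrable)
  show "integrable lborel (\<lambda>x. norm (weak_grad (\<lambda>x. u (c *\<^sub>R x)) x) powr p)"
  proof (rule integrable_cong_AE_imp[OF i2])
    show "AE x in lborel. c powr p * norm (weak_grad u (c *\<^sub>R x)) powr p = norm (weak_grad (\<lambda>x. u (c *\<^sub>R x)) x) powr p"
      using ae by eventually_elim (rule sym)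
  qed measurable
  have "(\<integral>x. norm (weak_grad (\<lambda>x. u (c *\<^sub>R x)) x) powr p \<partial>lborel) = (\<integral>x. c powr p * norm (weak_grad u (c *\<^sub>R x)) powr p \<partial>lborel)"
    by (rule integral_cong_AE[OF _ m2 ae]) measurable
  also have "\<dots> = c powr p * (c powr - real DIM('a) * (\<integral>x. norm (weak_grad u x) powr p \<partial>lborel))"
    unfolding integral_mult_right_zero integral_scale[OF c, of "\<lambda>x. norm (weak_grad u x) powr p"] real_scaleR_def by (rule refl)
  also have "\<dots> = (c powr p * c powr - real DIM('a)) * (\<integral>x. norm (weak_grad u x) powr p \<partial>lborel)"
    by (rule mult.assoc[symmetric])
  also have "c powr p * c powr - real DIM('a) = c powr - (real DIM('a) - p)"
    unfolding powr_add[symmetric] by simp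
  finally show "(\<integral>x. norm (weak_grad (\<lambda>x. u (c *\<^sub>R x)) x) powr p \<partial>lborel)
      = c powr - (real DIM('a) - p) * (\<integral>x. norm (weak_grad u x) powr p \<partial>lborel)" .
qed

lemma radial_scale:
  assumes "radial u" and c: "c > 0"
  shows "radial (\<lambda>x. u (c *\<^sub>R x))"
proof -
  obtain f0 where f0[measurable]: "f0 \<in> borel_measurable borel" and uf0: "AE x in lborel. u x = f0 (norm x)"
    using assms by (auto simp: radial_def)
  have "AE x in lborel. u (c *\<^sub>R x) = f0 (c * norm x)"
    using AE_scale[OF uf0 c] by eventually_elim (use c in simp)
  moreover have "(\<lambda>r. f0 (c * r)) \<in> borel_measurable borel" by measurable
  ultimately show ?thesis unfolding radial_def by (intro bexI)
qed

lemma sol_space_scale: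
  fixes u :: "'a::euclidean_space \<Rightarrow> real"
  assumes u: "u \<in> sol_space \<gamma> s p \<beta>" and \<gamma>: "\<gamma> \<noteq> 0" and c: "c > 0"
    and wd: "weakly_differentiable u" and iloc: "integrable lborel (\<lambda>x. norm (weak_grad u x) powr p)"
    and iB: "integrable lborel (weighted_power \<beta> p u)"
  shows "(\<lambda>x. u (c *\<^sub>R x)) \<in> sol_space \<gamma> s p \<beta>"
proof -
  have um[measurable]: "u \<in> borel_measurable borel" and rad: "radial u"
    using u \<gamma> by (auto simp: sol_space_def W_rad_def W_space_def L_weighted_def)
  let ?v = "\<lambda>x. u (c *\<^sub>R x)"
  have "seminorm_pow 1 p ?v = (\<integral>\<^sup>+x. ennreal (norm (norm (weak_grad ?v x) powr p)) \<partial>lborel)"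
    unfolding seminorm_pow_def using weak_grad_scale(1)[OF wd c] by (simp only: if_True refl real_norm_def abs_of_nonneg[OF powr_ge_zero])
  also have "\<dots> < \<infinity>"
    using gradient_power_scale(1)[OF c wd iloc] unfolding integrable_iff_bounded by blast
  finally have 1: "seminorm_pow 1 p ?v < \<infinity>" .
  have 2: "?v \<in> borel_measurable borel" by measurable
  have 3: "weighted_norm_pow p \<beta> ?v < \<infinity>"
    by (rule integrable_imp_weighted_norm_finite[OF weighted_power_scale(1)[OF c iB]])
  have "?v \<in> W_rad 1 p \<beta>"
    unfolding W_rad_def W_space_def L_weighted_def using 1 2 3 radial_scale[OF rad c] by blast
  then show ?thesis unfolding sol_space_def using \<gamma> by (simp only: if_False)
qed

lemma nn_integral_powr_at_infinity:
  assumes "e < -1" "r > 0"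
  shows "(\<integral>\<^sup>+t. indicator {r..} t * ennreal (t powr e) \<partial>lborel) = ennreal (- (r powr (e + 1)) / (e + 1))"
proof -
  have "(\<integral>\<^sup>+t. ennreal (indicator {r..} t * t powr e) \<partial>lborel) = ennreal (- (r powr (e + 1)) / (e + 1))"
    using has_integral_powr_to_inf[OF assms] by (intro nn_integral_has_integral_lebesgue) auto
  moreover have "ennreal (indicator {r..} t * t powr e) = indicator {r..} t * ennreal (t powr e)" for t
    by (auto simp: indicator_def)
  ultimately show ?thesis by simp
qed

lemma nn_integral_powr_at_zero:
  assumes "e > -1"
  shows "(\<integral>\<^sup>+t. indicator {0..1} t * ennreal (t powr e) \<partial>lborel) < \<infinity>"
proof -
  have "(\<integral>\<^sup>+t. ennreal (indicator {0..1} t * t powr e) \<partial>lborel) = ennreal (1 powr (e + 1) / (e + 1))"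
    using has_integral_powr_from_0[OF assms, of 1] by (intro nn_integral_has_integral_lebesgue) auto
  moreover have "ennreal (indicator {0..1} t * t powr e) = indicator {0..1} t * ennreal (t powr e)" for t :: real
    by (auto simp: indicator_def)
  ultimately show ?thesis by simp
qed

lemma young_conjugate:
  fixes a b p :: real
  assumes p: "p > 1" and ab: "a \<ge> 0" "b \<ge> 0"
  shows "a * b \<le> a powr p + b powr (p / (p - 1))"
proof -
  have "a * b \<le> a powr p / p + b powr (p / (p - 1)) / (p / (p - 1))"
  proof (rule Youngs_inequality)
    show "p / (p - 1) > 1" using p by simp
    show "1 / p + 1 / (p / (p - 1)) = 1" using p by (simp add: add_divide_distrib[symmetric])
  qed (use p ab in auto)
  also have "a powr p / p \<le> a powr p" using p divide_left_mono[of 1 p "a powr p"] by simp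
  also have "b powr (p / (p - 1)) / (p / (p - 1)) \<le> b powr (p / (p - 1))"
  proof -
    have "b powr (p / (p - 1)) / (p / (p - 1)) = b powr (p / (p - 1)) * (1 - 1 / p)"
      using p by (simp add: field_simps)
    also have "\<dots> \<le> b powr (p / (p - 1)) * 1" using p by (intro mult_left_mono) auto
    finally show ?thesis by simp
  qed
  finally show ?thesis by simp
qed

text \<open>
  A profile bounded below near infinity would make \<open>|x|^\<beta>\<close> integrable there. This is impossible for
  \<open>N + \<beta> > 0\<close>, because the integral over \<open>|x| \<ge> R\<close> would have to shrink when the radius is halved.
\<close>

lemma profile_small_somewhere:
  fixes u :: "'a::euclidean_space \<Rightarrow> real" and f :: "real \<Rightarrow> real"
  assumes i: "integrable lborel (weighted_power \<beta> p u)" and N\<beta>: "real DIM('a) + \<beta> > 0" and p: "p > 0"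
    and uf: "AE x in lborel. u x = f (norm x)" and R: "R > 0" and \<eta>: "\<eta> > 0"
  shows "\<exists>b\<ge>R. f b < \<eta>"
proof (rule ccontr)
  assume neg: "\<not> ?thesis"
  then have fb: "f b \<ge> \<eta>" if "b \<ge> R" for b using that by force
  define h where "h x = (if R \<le> norm x then ennreal (norm x powr \<beta>) else 0)" for x :: 'a
  have h[measurable]: "h \<in> borel_measurable borel" unfolding h_def[abs_def] by measurable
  define Z where "Z = (\<integral>\<^sup>+x. h x \<partial>lborel)"
  have "ennreal (\<eta> powr p) * Z = (\<integral>\<^sup>+x. ennreal (\<eta> powr p) * h x \<partial>lborel)"
    unfolding Z_def by (rule nn_integral_cmult[symmetric]) measurable
  also have "\<dots> \<le> (\<integral>\<^sup>+x. ennreal (norm (weighted_power \<beta> p u x)) \<partial>lborel)"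
  proof (rule nn_integral_mono_AE)
    show "AE x in lborel. ennreal (\<eta> powr p) * h x \<le> ennreal (norm (weighted_power \<beta> p u x))"
      using uf
    proof eventually_elim
      case (elim x)
      show ?case
      proof (cases "R \<le> norm x")
        case True
        have "\<eta> powr p \<le> \<bar>u x\<bar> powr p"
          using fb[OF True] elim \<eta> p by (intro powr_mono2) auto
        then have "\<eta> powr p * norm x powr \<beta> \<le> norm x powr \<beta> * \<bar>u x\<bar> powr p"
          using mult_right_mono[of "\<eta> powr p" "\<bar>u x\<bar> powr p" "norm x powr \<beta>"] by (simp add: mult.commute)
        then show ?thesis using True by (simp add: h_def weighted_power_def ennreal_mult[symmetric] ennreal_leI)
      qed (simp add: h_def)
    qed
  qed
  also have "\<dots> < \<infinity>" using i by (simp add: integrable_iff_bounded)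
  finally have "Z \<noteq> \<infinity>" using \<eta> by (auto simp: ennreal_mult_less_top)
  have "ennreal (2 powr \<beta>) * Z = (\<integral>\<^sup>+x. ennreal (2 powr \<beta>) * h x \<partial>lborel)"
    unfolding Z_def by (rule nn_integral_cmult[symmetric]) measurable
  also have "\<dots> \<le> (\<integral>\<^sup>+x. h (2 *\<^sub>R x) \<partial>lborel)"
    using R by (intro nn_integral_mono) (auto simp: h_def ennreal_mult[symmetric] powr_mult)
  also have "\<dots> = ennreal (2 powr - real DIM('a)) * Z"
    unfolding Z_def by (rule nn_integral_scale) auto
  finally have le: "ennreal (2 powr \<beta>) * Z \<le> ennreal (2 powr - real DIM('a)) * Z" .
  have "Z = 0"
  proof -
    obtain z where z: "Z = ennreal z" "z \<ge> 0" using \<open>Z \<noteq> \<infinity>\<close> by (cases Z) auto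
    have "2 powr \<beta> * z \<le> 2 powr - real DIM('a) * z"
      using le z by (simp add: ennreal_mult[symmetric])
    moreover have "2 powr - real DIM('a) < 2 powr \<beta>" using N\<beta> by (intro powr_less_mono) auto
    ultimately have "z = 0" using z(2) by (simp add: mult_le_cancel_right)
    then show ?thesis using z by simp
  qed
  then have "AE x in lborel. h x = 0" unfolding Z_def by (subst (asm) nn_integral_0_iff_AE) auto
  then have "AE x in lborel. x \<notin> {x::'a. R < norm x}"
    by eventually_elim (use R in \<open>auto simp: h_def split: if_splits\<close>)
  moreover have "open {x::'a. R < norm x}" by (intro open_Collect_less continuous_intros)
  ultimately have "{x::'a. R < norm x} = {}" by (intro AE_not_in_open_imp_empty)
  moreover obtain b :: 'a where "b \<in> Basis" using nonempty_Basis by blast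
  then have "(R + 1) *\<^sub>R b \<in> {x::'a. R < norm x}" using R by simp
  ultimately show False by blast
qed

text \<open>
  The radial lemma. As \<open>f\<close> takes arbitrarily small values at large radii, \<open>f r\<close> is at most the
  integral of \<open>\<bar>F\<bar>\<close> over \<open>{r..}\<close>. Hoelder's inequality would bound this by
  \<open>r^(-(N-p)/p)\<close> times the \<open>L^p\<close> norm of the gradient; Young's inequality, applied after scaling by
  \<open>r^((N-p)/p)\<close>, has the same effect.
\<close>

lemma profile_decay:
  fixes f F :: "real \<Rightarrow> real" and N p :: real
  assumes Fm[measurable]: "F \<in> borel_measurable borel"
    and Fi: "\<And>a b. 0 < a \<Longrightarrow> a \<le> b \<Longrightarrow> set_integrable lborel {a..b} F"
    and fF: "\<And>a b. 0 < a \<Longrightarrow> a \<le> b \<Longrightarrow> f b - f a = (LBINT t:{a..b}. F t)"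
    and p: "p > 1" "p < N"
    and Fp: "(\<integral>\<^sup>+t. indicator {0<..} t * ennreal (t powr (N - 1) * \<bar>F t\<bar> powr p) \<partial>lborel) < \<infinity>"
    and small: "\<And>R \<eta>. R > 0 \<Longrightarrow> \<eta> > 0 \<Longrightarrow> \<exists>b\<ge>R. f b < \<eta>"
  obtains C where "C > 0" "\<And>r. r > 0 \<Longrightarrow> f r \<le> C * r powr - ((N - p) / p)"
proof -
  obtain G where G: "(\<integral>\<^sup>+t. indicator {0<..} t * ennreal (t powr (N - 1) * \<bar>F t\<bar> powr p) \<partial>lborel) = ennreal G" "G \<ge> 0"
    using Fp by (auto simp: less_top_ennreal)
  have [measurable]: "{0::real<..} \<in> sets borel" "{r::real..} \<in> sets borel" for r by simp_all
  define k where "k = (N - p) / p"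
  define e where "e = - (N - 1) / (p - 1)"
  have e: "e < -1" using p by (simp add: e_def field_simps)
  define C where "C = G + (p - 1) / (N - p) + 1"
  have "f r \<le> C * r powr - k" if r: "r > 0" for r
  proof -
    define J where "J = (\<integral>\<^sup>+t. indicator {r..} t * ennreal \<bar>F t\<bar> \<partial>lborel)"
    have "J \<le> (\<integral>\<^sup>+t. ennreal (r powr - k) * (indicator {0<..} t * ennreal (t powr (N - 1) * \<bar>F t\<bar> powr p)
        + ennreal (r powr (k * (p / (p - 1)))) * (indicator {r..} t * ennreal (t powr e))) \<partial>lborel)"
      unfolding J_def
    proof (rule nn_integral_mono)
      fix t
      show "indicator {r..} t * ennreal \<bar>F t\<bar> \<le> ennreal (r powr - k) * (indicator {0<..} t * ennreal (t powr (N - 1) * \<bar>F t\<bar> powr p)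
        + ennreal (r powr (k * (p / (p - 1)))) * (indicator {r..} t * ennreal (t powr e)))"
      proof (cases "r \<le> t")
        case True
        then have t: "t > 0" using r by simp
        let ?a = "\<bar>F t\<bar> * t powr ((N - 1) / p)" and ?b = "r powr k * t powr (- ((N - 1) / p))"
        have "t powr ((N - 1) / p) * t powr (- ((N - 1) / p)) = 1" "r powr - k * r powr k = 1"
          using t r by (simp_all add: powr_add[symmetric])
        moreover have "r powr - k * (?a * ?b) = \<bar>F t\<bar> * (t powr ((N - 1) / p) * t powr (- ((N - 1) / p))) * (r powr - k * r powr k)"
          by (simp only: mult_ac)
        ultimately have "\<bar>F t\<bar> = r powr - k * (?a * ?b)" by simp
        also have "\<dots> \<le> r powr - k * (?a powr p + ?b powr (p / (p - 1)))"
          by (intro mult_left_mono young_conjugate p) auto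
        also have "?a powr p = t powr (N - 1) * \<bar>F t\<bar> powr p"
          using p by (simp add: powr_mult powr_powr)
        also have "?b powr (p / (p - 1)) = r powr (k * (p / (p - 1))) * t powr e"
        proof -
          have "- ((N - 1) / p) * (p / (p - 1)) = e" using p by (simp add: e_def minus_divide_left)
          then show ?thesis by (simp only: powr_mult powr_powr)
        qed
        finally show ?thesis using True t
          by (simp add: ennreal_mult[symmetric] ennreal_plus[symmetric] ennreal_leI del: ennreal_plus)
      qed simp
    qed
    also have "\<dots> = ennreal (r powr - k) * (ennreal G + ennreal (r powr (k * (p / (p - 1)))) * (\<integral>\<^sup>+t. indicator {r..} t * ennreal (t powr e) \<partial>lborel))"
      unfolding G(1)[symmetric] by (subst nn_integral_cmult, measurable, subst nn_integral_add, measurable, subst nn_integral_cmult, measurable)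
    also have "\<dots> = ennreal (r powr - k * (G + (p - 1) / (N - p)))"
    proof -
      have e1: "e + 1 = - (k * (p / (p - 1)))" "- (e + 1) = (N - p) / (p - 1)"
        using p by (simp_all add: e_def k_def field_simps)
      have "r powr (k * (p / (p - 1))) * (- (r powr (e + 1)) / (e + 1)) = 1 / (- (e + 1))"
        unfolding e1(1) using r p by (simp add: powr_minus)
      also have "\<dots> = (p - 1) / (N - p)" unfolding e1(2) by simp
      finally have "ennreal (r powr (k * (p / (p - 1)))) * ennreal (- (r powr (e + 1)) / (e + 1)) = ennreal ((p - 1) / (N - p))"
        using e by (subst ennreal_mult[symmetric]) (auto simp: divide_nonneg_neg)
      then show ?thesis
        using p G(2) by (simp add: nn_integral_powr_at_infinity[OF e r] ennreal_mult ennreal_plus[symmetric] del: ennreal_plus)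
    qed
    also have "\<dots> \<le> ennreal (C * r powr - k)"
      by (intro ennreal_leI) (simp add: C_def mult.commute mult_left_mono)
    finally have J: "J \<le> ennreal (C * r powr - k)" .
    have C0: "C * r powr - k \<ge> 0" using G p by (simp add: C_def)
    show "f r \<le> C * r powr - k"
    proof (rule field_le_epsilon)
      fix \<eta> :: real assume "\<eta> > 0"
      then obtain b where b: "b \<ge> r" "f b < \<eta>" using small[OF r] by blast
      have "ennreal \<bar>f b - f r\<bar> \<le> (\<integral>\<^sup>+t. ennreal \<bar>F t\<bar> * indicator {r..b} t \<partial>lborel)"
        using b r by (intro profile_increment[OF Fi fF]) auto
      also have "\<dots> \<le> J" unfolding J_def by (intro nn_integral_mono) (auto simp: indicator_def)
      also note J
      finally have "\<bar>f b - f r\<bar> \<le> C * r powr - k" using C0 by (simp add: ennreal_le_iff)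
      then show "f r \<le> C * r powr - k + \<eta>" using b by linarith
    qed
  qed
  moreover have "C > 0" using G p by (simp add: C_def add_nonneg_pos)
  ultimately show ?thesis using that by (simp add: k_def)
qed

text \<open>
  After multiplying and dividing by \<open>t^((N-1)/p)\<close>, Young's inequality leaves a power of \<open>t\<close> that is
  integrable at 0 by the first condition on \<open>a\<close>, where the constant \<open>D\<close> is used, and at infinity by the
  second one, where the decay is used. With \<open>a = N + \<alpha>\<close> and \<open>\<kappa> = (q - 1) (N - p) / p\<close>, the second
  condition says that \<open>q\<close> is supercritical.
\<close>

lemma gradient_weight_finite:
  fixes F :: "real \<Rightarrow> real" and N p :: real
  assumes Fm[measurable]: "F \<in> borel_measurable borel"
    and p: "p > 1" and Fp: "(\<integral>\<^sup>+t. indicator {0<..} t * ennreal (t powr (N - 1) * \<bar>F t\<bar> powr p) \<partial>lborel) < \<infinity>"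
    and D: "D \<ge> 0" "D' \<ge> 0" and a: "a * p > N - p" and \<kappa>: "(a - \<kappa>) * p < N - p"
  shows "(\<integral>\<^sup>+t. indicator {0<..} t * ennreal (\<bar>F t\<bar> * (t powr a * min D (D' * (t / 2) powr - \<kappa>))) \<partial>lborel) < \<infinity>"
proof -
  let ?p' = "p / (p - 1)"
  have [measurable]: "{0::real<..} \<in> sets borel" "{r::real..} \<in> sets borel" "{0..r} \<in> sets borel" for r by simp_all
  define a' where "a' = a - (N - 1) / p"
  define K1 K2 where "K1 = D powr ?p'" and "K2 = (D' * 2 powr \<kappa>) powr ?p'"
  have "a' = (a * p - (N - 1)) / p" "a' - \<kappa> = ((a - \<kappa>) * p - (N - 1)) / p"
    using p by (simp_all add: a'_def diff_divide_distrib)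
  then have "a' * ?p' = (a * p - (N - 1)) / (p - 1)" "(a' - \<kappa>) * ?p' = ((a - \<kappa>) * p - (N - 1)) / (p - 1)"
    using p by simp_all
  then have e1: "a' * ?p' > -1" and e2: "(a' - \<kappa>) * ?p' < -1"
    using p a \<kappa> by (simp_all add: pos_less_divide_eq pos_divide_less_eq)
  have "(\<integral>\<^sup>+t. indicator {0<..} t * ennreal (\<bar>F t\<bar> * (t powr a * min D (D' * (t / 2) powr - \<kappa>))) \<partial>lborel)
    \<le> (\<integral>\<^sup>+t. indicator {0<..} t * ennreal (t powr (N - 1) * \<bar>F t\<bar> powr p)
      + (ennreal K1 * (indicator {0..1} t * ennreal (t powr (a' * ?p'))) + ennreal K2 * (indicator {1..} t * ennreal (t powr ((a' - \<kappa>) * ?p')))) \<partial>lborel)"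
  proof (rule nn_integral_mono)
    fix t :: real
    let ?W = "min D (D' * (t / 2) powr - \<kappa>)"
    show "indicator {0<..} t * ennreal (\<bar>F t\<bar> * (t powr a * ?W)) \<le> indicator {0<..} t * ennreal (t powr (N - 1) * \<bar>F t\<bar> powr p)
      + (ennreal K1 * (indicator {0..1} t * ennreal (t powr (a' * ?p'))) + ennreal K2 * (indicator {1..} t * ennreal (t powr ((a' - \<kappa>) * ?p'))))"
    proof (cases "t > 0")
      case t: True
      have W0: "?W \<ge> 0" using D by simp
      have "\<bar>F t\<bar> * (t powr a * ?W) = (\<bar>F t\<bar> * t powr ((N - 1) / p)) * (t powr a' * ?W)"
      proof -
        have "t powr a = t powr ((N - 1) / p) * t powr a'" by (simp add: a'_def powr_add[symmetric])
        then show ?thesis by (simp only: mult_ac)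
      qed
      also have "\<dots> \<le> (\<bar>F t\<bar> * t powr ((N - 1) / p)) powr p + (t powr a' * ?W) powr ?p'"
        using W0 by (intro young_conjugate p) auto
      also have "(\<bar>F t\<bar> * t powr ((N - 1) / p)) powr p = t powr (N - 1) * \<bar>F t\<bar> powr p"
        using p by (simp add: powr_mult powr_powr)
      finally have le: "\<bar>F t\<bar> * (t powr a * ?W) \<le> t powr (N - 1) * \<bar>F t\<bar> powr p + (t powr a' * ?W) powr ?p'" .
      have p'0: "?p' \<ge> 0" using p by simp
      have *: "ennreal ((t powr a' * ?W) powr ?p') \<le> ennreal K1 * (indicator {0..1} t * ennreal (t powr (a' * ?p')))
         + ennreal K2 * (indicator {1..} t * ennreal (t powr ((a' - \<kappa>) * ?p')))"
      proof (cases "t \<le> 1")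
        case True
        have "(t powr a' * ?W) powr ?p' \<le> (t powr a' * D) powr ?p'"
          using W0 p'0 by (intro powr_mono2 mult_left_mono) auto
        also have "\<dots> = K1 * t powr (a' * ?p')" by (simp add: powr_mult powr_powr K1_def)
        finally have "ennreal ((t powr a' * ?W) powr ?p') \<le> ennreal K1 * (indicator {0..1} t * ennreal (t powr (a' * ?p')))"
          using True t by (simp add: ennreal_mult[symmetric] K1_def ennreal_leI)
        then show ?thesis by (rule order_trans) simp
      next
        case False
        have "(t powr a' * ?W) powr ?p' \<le> (t powr a' * (D' * (t / 2) powr - \<kappa>)) powr ?p'"
          using W0 p'0 by (intro powr_mono2 mult_left_mono) auto
        also have "t powr a' * (D' * (t / 2) powr - \<kappa>) = (D' * 2 powr \<kappa>) * t powr (a' - \<kappa>)"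
          using t by (simp add: powr_divide powr_minus powr_diff field_simps)
        also have "\<dots> powr ?p' = K2 * t powr ((a' - \<kappa>) * ?p')" by (simp add: powr_mult powr_powr K2_def)
        finally have "ennreal ((t powr a' * ?W) powr ?p') \<le> ennreal K2 * (indicator {1..} t * ennreal (t powr ((a' - \<kappa>) * ?p')))"
          using False t by (simp add: ennreal_mult[symmetric] K2_def ennreal_leI)
        then show ?thesis by (rule order_trans) simp
      qed
      have "ennreal (\<bar>F t\<bar> * (t powr a * ?W)) \<le> ennreal (t powr (N - 1) * \<bar>F t\<bar> powr p) + ennreal ((t powr a' * ?W) powr ?p')"
        using ennreal_leI[OF le] by (subst (asm) ennreal_plus) auto
      also have "\<dots> \<le> ennreal (t powr (N - 1) * \<bar>F t\<bar> powr p) + (ennreal K1 * (indicator {0..1} t * ennreal (t powr (a' * ?p')))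
         + ennreal K2 * (indicator {1..} t * ennreal (t powr ((a' - \<kappa>) * ?p'))))"
        by (intro add_left_mono *)
      finally show ?thesis using t by simp
    qed simp
  qed
  also have "\<dots> = (\<integral>\<^sup>+t. indicator {0<..} t * ennreal (t powr (N - 1) * \<bar>F t\<bar> powr p) \<partial>lborel)
      + (ennreal K1 * (\<integral>\<^sup>+t. indicator {0..1} t * ennreal (t powr (a' * ?p')) \<partial>lborel)
        + ennreal K2 * (\<integral>\<^sup>+t. indicator {1..} t * ennreal (t powr ((a' - \<kappa>) * ?p')) \<partial>lborel))"
    by (subst nn_integral_add, measurable, subst nn_integral_add, measurable, subst nn_integral_cmult, measurable, subst nn_integral_cmult, measurable)
  also have "\<dots> < \<infinity>"
    using Fp nn_integral_powr_at_zero[OF e1] nn_integral_powr_at_infinity[OF e2, of 1]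
    by (simp add: ennreal_mult_less_top)
  finally show ?thesis .
qed

section \<open>Problems with a local part\<close>

text \<open>
  The local part scales with the exponent \<open>- (N - p)\<close>, the nonlocal one with \<open>- (N - s p)\<close>, which is
  at most the former because \<open>s \<le> 1\<close>.
\<close>

lemma energy_scale_le:
  fixes u :: "'a::euclidean_space \<Rightarrow> real"
  assumes c: "c \<ge> 1" and \<gamma>: "0 < \<gamma>" "\<gamma> \<le> 1" and s: "s \<le> 1" and p: "p > 0"
    and wd: "weakly_differentiable u" and iloc: "integrable lborel (\<lambda>x. norm (weak_grad u x) powr p)"
    and inl: "\<gamma> \<noteq> 1 \<Longrightarrow> integrable (lborel \<Otimes>\<^sub>M lborel) (nonlocal_density s p u)"
  shows "energy \<gamma> s p (\<lambda>x. u (c *\<^sub>R x)) \<le> c powr - (real DIM('a) - p) * energy \<gamma> s p u"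
proof -
  have c0: "c > 0" using c by simp
  let ?d = "c powr - (real DIM('a) - p)"
  let ?N = "\<integral>z. nonlocal_density s p u z \<partial>(lborel \<Otimes>\<^sub>M lborel)"
  have "s * p \<le> 1 * p" using s p by (intro mult_right_mono) auto
  then have le: "c powr - (real DIM('a) - s * p) \<le> ?d" using c by (intro powr_mono) auto
  have N0: "?N \<ge> 0" by (intro integral_nonneg_AE AE_I2) (auto simp: nonlocal_density_def)
  have nl: "(1 - \<gamma>) * (\<integral>z. nonlocal_density s p (\<lambda>x. u (c *\<^sub>R x)) z \<partial>(lborel \<Otimes>\<^sub>M lborel)) \<le> ?d * ((1 - \<gamma>) * ?N)" if "\<gamma> \<noteq> 1"
  proof -
    have "(1 - \<gamma>) * (c powr - (real DIM('a) - s * p) * ?N) \<le> (1 - \<gamma>) * (?d * ?N)"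
      using \<gamma> N0 le by (intro mult_left_mono mult_right_mono) auto
    then show ?thesis unfolding nonlocal_density_scale(2)[OF c0 inl[OF that]] by (simp only: mult.left_commute)
  qed
  show ?thesis
    unfolding energy_def gradient_power_scale(2)[OF c0 wd iloc] using nl \<gamma>
    by (auto simp: distrib_left mult.left_commute)
qed

theorem no_local_solution:
  fixes u :: "'a::euclidean_space \<Rightarrow> real"
  assumes p: "p > 1" "p < real DIM('a)" and \<gamma>: "0 < \<gamma>" "\<gamma> \<le> 1" and s: "s \<le> 1"
    and \<alpha>: "\<alpha> > - (s * p)" and \<beta>: "\<beta> > - (s * p)"
    and q: "q > p * (real DIM('a) + \<alpha>) / (real DIM('a) - p)"
    and u: "u \<in> X_tilde \<gamma> s p \<beta>" and sol: "positive_weak_solution \<gamma> s p q \<alpha> \<beta> u"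
  shows False
proof -
  let ?N = "real DIM('a)" and ?d = "real DIM('a) - p"
  have "s * p \<le> 1 * p" using s p by (intro mult_right_mono) auto
  then have \<alpha>p: "\<alpha> > - p" and \<beta>p: "\<beta> > - p" using \<alpha> \<beta> by auto
  have d: "?d > 0" using p by simp
  have qd: "q * ?d > p * (?N + \<alpha>)" using q d by (simp add: pos_divide_less_eq)
  have "p * ?d < q * ?d" using qd \<alpha>p p mult_strict_left_mono[of ?d "?N + \<alpha>" p] by linarith
  then have qp: "q > p" using d by (simp add: mult_less_cancel_right)
  then have q1: "q > 1" using p by simp
  have us: "u \<in> sol_space \<gamma> s p \<beta>" and wd: "weakly_differentiable u"
    using u by (auto simp: X_tilde_def)
  obtain M where M: "AE x in lborel. \<bar>u x\<bar> \<le> M" using u by (auto simp: X_tilde_def)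
  have um[measurable]: "u \<in> borel_measurable borel" and rad: "radial u"
    using us by (auto simp: sol_space_def W_rad_def W_space_def L_weighted_def split: if_splits)
  have u0: "AE x in lborel. u x > 0" using sol by (simp add: positive_weak_solution_def)
  then have u0': "AE x in lborel. u x \<ge> 0" by eventually_elim simp
  note I = solution_integrable[OF sol p(1) q1]
  have \<gamma>0: "\<gamma> \<noteq> 0" using \<gamma> by simp
  note iloc = I(1)[OF \<gamma>0]
  have gp: "(\<integral>\<^sup>+x. ennreal (norm (weak_grad u x) powr p) \<partial>lborel) < \<infinity>"
    using iloc by (simp add: integrable_iff_bounded)
  obtain f F :: "real \<Rightarrow> real" where F: "F \<in> borel_measurable borel"
    "\<And>a b. 0 < a \<Longrightarrow> a \<le> b \<Longrightarrow> set_integrable lborel {a..b} F"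
    "\<And>a b. 0 < a \<Longrightarrow> a \<le> b \<Longrightarrow> f b - f a = (LBINT t:{a..b}. F t)"
    and uf: "AE x in lborel. u x = f (norm x)"
    and Fp': "p > 0 \<Longrightarrow> (\<integral>\<^sup>+x. ennreal (norm (weak_grad u x) powr p) \<partial>lborel) < \<infinity> \<Longrightarrow>
      (\<integral>\<^sup>+t. indicator {0<..} t * ennreal (t powr (?N - 1) * \<bar>F t\<bar> powr p) \<partial>lborel) < \<infinity>"
    by (rule radial_profile[OF weak_grad_works[OF wd] rad, where p = p]) (rule that; assumption)
  have Fp: "(\<integral>\<^sup>+t. indicator {0<..} t * ennreal (t powr (?N - 1) * \<bar>F t\<bar> powr p) \<partial>lborel) < \<infinity>"
    using p by (intro Fp' gp) simp
  have fc: "continuous_on {0<..} f" by (rule profile_continuous[OF F(2,3)])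
  have fb: "0 \<le> f r \<and> f r \<le> M" if "r > 0" for r
  proof -
    have "AE x in lborel. f (norm (x::'a)) \<in> {0..M}"
      using uf u0' M by eventually_elim auto
    from AE_radial_closed[OF fc closed_atLeastAtMost this that] show ?thesis by simp
  qed
  have small: "\<exists>b\<ge>R. f b < \<eta>" if "R > 0" "\<eta> > 0" for R \<eta>
    using p \<beta>p by (intro profile_small_somewhere[OF I(3) _ _ uf that]) auto
  obtain C where C: "C > 0" "\<And>r. r > 0 \<Longrightarrow> f r \<le> C * r powr - ((?N - p) / p)"
    by (rule profile_decay[OF F p Fp small], assumption+) (rule that; assumption)
  define \<kappa> where "\<kappa> = (q - 1) * ((?N - p) / p)"
  have \<kappa>0: "\<kappa> \<ge> 0" using q1 p by (simp add: \<kappa>_def)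
  have \<kappa>p: "\<kappa> * p = (q - 1) * ?d" using p by (simp add: \<kappa>_def)
  \<comment> \<open>The majorant combines boundedness, used at the origin, with the radial decay, used at infinity.\<close>
  define W where "W r = min (M powr (q - 1)) (C powr (q - 1) * r powr - \<kappa>)" for r
  define e where "e n = 1 / (real n + 8)" for n
  have e: "e n > 0" "e n \<le> 1" for n by (auto simp: e_def field_simps)
  have e0: "e \<longlonglongrightarrow> 0" unfolding e_def[abs_def] by (rule step_tendsto_zero)
  define v where "v n x = u ((1 + e n) *\<^sub>R x)" for n x
  have c1: "1 + e n > 0" "1 + e n \<ge> 1" for n using e[of n] by auto
  have "(?N + \<alpha>) * 1 \<le> (?N + \<alpha>) * p" using p \<alpha>p by (intro mult_left_mono) auto
  then have a1: "(?N + \<alpha>) * p > ?N - p" using \<alpha>p by simp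
  have a2: "(?N + \<alpha> - \<kappa>) * p < ?N - p"
    unfolding left_diff_distrib \<kappa>p using qd by (simp add: algebra_simps)
  have breg: "(\<lambda>n. ennreal (1 / e n) * (\<integral>\<^sup>+x. ennreal (norm x powr \<alpha> * \<bar>v n x powr (q - 1) - u x powr (q - 1)\<bar> * \<bar>v n x - u x\<bar>) \<partial>lborel)) \<longlonglongrightarrow> 0"
  proof (rule bregman_little_o[where f = f and ?F0.0 = "\<lambda>t. \<bar>F t\<bar>" and W = W and k = "\<lambda>n r. (1 + e n) * r"])
    show "v n \<in> borel_measurable borel" for n unfolding v_def[abs_def] by measurable
    show "(\<lambda>t. \<bar>F t\<bar>) \<in> borel_measurable borel" using F(1) by measurable
    show "AE x in lborel. v n x = f ((1 + e n) * norm x)" for n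
      using AE_scale[OF uf c1(1)[of n]] by eventually_elim (use c1(1)[of n] in \<open>simp add: v_def\<close>)
    show "r \<le> (1 + e n) * r" if "r > 0" for n r using that e[of n] by (simp add: algebra_simps)
    show "ennreal \<bar>f ((1 + e n) * r) - f r\<bar> \<le> (\<integral>\<^sup>+t. ennreal \<bar>F t\<bar> * indicator {r..(1 + e n) * r} t \<partial>lborel)" if "r > 0" for n r
      using that e[of n] by (intro profile_increment[OF F(2,3)]) (auto simp: algebra_simps)
    show "f r powr (q - 1) \<le> W r" if r: "r > 0" for r
    proof -
      have "f r powr (q - 1) \<le> M powr (q - 1)" using fb[OF r] q1 by (intro powr_mono2) auto
      moreover have "f r powr (q - 1) \<le> (C * r powr - ((?N - p) / p)) powr (q - 1)"
        using fb[OF r] C(2)[OF r] q1 by (intro powr_mono2) auto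
      moreover have "(C * r powr - ((?N - p) / p)) powr (q - 1) = C powr (q - 1) * r powr - \<kappa>"
      proof -
        have "- ((?N - p) / p) * (q - 1) = - \<kappa>" by (simp add: \<kappa>_def)
        then show ?thesis by (simp only: powr_mult powr_powr)
      qed
      ultimately show ?thesis by (simp add: W_def)
    qed
    show "W t \<le> W r" if "0 < r" "r \<le> t" for r t
      unfolding W_def using that \<kappa>0 by (intro min.mono order_refl mult_left_mono powr_mono2') auto
    show "W \<in> borel_measurable borel" unfolding W_def[abs_def] by measurable
    show "(\<integral>\<^sup>+t. indicator {0<..} t * ennreal (\<bar>F t\<bar> * (t powr (?N + \<alpha>) * W (t / 2))) \<partial>lborel) < \<infinity>"
      unfolding W_def by (rule gradient_weight_finite[OF F(1) p(1) Fp _ _ a1 a2]) auto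
  qed (use um e e0 uf fb fc q1 in auto)
  define A B E where "A = (\<integral>x. weighted_power \<alpha> q u x \<partial>lborel)" and "B = (\<integral>x. weighted_power \<beta> p u x \<partial>lborel)"
    and "E = energy \<gamma> s p u"
  have \<gamma>': "0 \<le> \<gamma>" using \<gamma> by simp
  have AEB: "A = E + B"
    unfolding A_def B_def E_def by (rule test_inequality(1)[OF sol us p(1) q1 \<gamma>' \<gamma>(2) u0' iloc I(2) I(3,4)])
  have vs: "v n \<in> sol_space \<gamma> s p \<beta>" for n
    unfolding v_def[abs_def] by (rule sol_space_scale[OF us \<gamma>0 c1(1) wd iloc I(3)])
  have v0: "AE x in lborel. v n x \<ge> 0" for n
    unfolding v_def by (rule AE_scale[OF u0' c1(1)])
  note SA = weighted_power_scale[OF c1(1) I(4), folded v_def A_def]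
  note SB = weighted_power_scale[OF c1(1) I(3), folded v_def B_def]
  note SL = gradient_power_scale(1)[OF c1(1) wd iloc, folded v_def]
  note SN = nonlocal_density_scale(1)[OF c1(1) I(2), folded v_def]
  have p0: "p > 0" using p by simp
  note SE = energy_scale_le[OF c1(2) \<gamma> s p0 wd iloc I(2), folded v_def E_def]
  note T = test_inequality[OF sol vs p(1) q1 \<gamma>' \<gamma>(2) v0 SL SN SB(1) SA(1), folded A_def B_def E_def]
  have "1 / q * (- (?N + \<alpha>) * A - 8 * 0 * 0) \<le> 1 / p * (- ?d * E + 8 * 0 * 0) + 1 / p * (- (?N + \<beta>) * B + 8 * 0 * 0)"
  proof (rule pohozaev_limit[where e = e and Av = "\<lambda>n. \<integral>x. weighted_power \<alpha> q (v n) x \<partial>lborel"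
        and Bv = "\<lambda>n. \<integral>x. weighted_power \<beta> p (v n) x \<partial>lborel" and Ev = "\<lambda>n. energy \<gamma> s p (v n)"
        and Br = "\<lambda>n. \<integral>x. norm x powr \<alpha> * ((v n x powr (q - 1) - u x powr (q - 1)) * (v n x - u x)) \<partial>lborel"])
    show "e n > 0" for n by (rule e)
    show "e \<longlonglongrightarrow> 0" by (rule e0)
    show "p > 0" "q > 0" using p q1 by auto
    fix n
    show "1 / q * ((\<integral>x. weighted_power \<alpha> q (v n) x \<partial>lborel) - (A + 0))
         - (\<integral>x. norm x powr \<alpha> * ((v n x powr (q - 1) - u x powr (q - 1)) * (v n x - u x)) \<partial>lborel)
        \<le> 1 / p * (energy \<gamma> s p (v n) - (E + 0)) + 1 / p * ((\<integral>x. weighted_power \<beta> p (v n) x \<partial>lborel) - (B + 0))"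
      using T(3)[of n] by simp
    show "(1 + e n) powr - (?N + \<alpha>) * A + (1 + 8 * e n) powr - 0 * 0 \<le> (\<integral>x. weighted_power \<alpha> q (v n) x \<partial>lborel)"
      unfolding SA(2) by simp
    show "(\<integral>x. weighted_power \<beta> p (v n) x \<partial>lborel) \<le> (1 + e n) powr - (?N + \<beta>) * B + (1 + 8 * e n) powr 0 * 0"
      unfolding SB(2) by simp
    show "energy \<gamma> s p (v n) \<le> (1 + e n) powr - ?d * E + (1 + 8 * e n) powr 0 * 0"
      using SE[of n] by simp
  next
    show "(\<lambda>n. (\<integral>x. norm x powr \<alpha> * ((v n x powr (q - 1) - u x powr (q - 1)) * (v n x - u x)) \<partial>lborel) / e n) \<longlonglongrightarrow> 0"
      by (rule bregman_real_limit[OF breg q1 e(1) u0' v0 T(2)])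
  qed
  then have "1 / q * (- (?N + \<alpha>) * A) \<le> 1 / p * (- ?d * (A - B)) + 1 / p * (- (?N + \<beta>) * B)"
    using AEB by simp
  moreover have "A > 0" "B > 0" unfolding A_def B_def by (rule weighted_power_pos[OF I(4) u0] weighted_power_pos[OF I(3) u0])+
  ultimately show False
    by (intro supercritical_contradiction[where A = A and B = B and d = ?d and a = "?N + \<alpha>" and b = "?N + \<beta>"])
      (use p q1 qd \<beta>p in auto)
qed

theorem theorem1p3:
  fixes p \<gamma> s \<alpha> \<beta> q :: real
  assumes "p > 1"
    and "0 \<le> \<gamma>" and "\<gamma> \<le> 1"
    and "\<gamma> < 1 \<Longrightarrow> 0 < s \<and> s < 1"
    and "\<gamma> = 1 \<Longrightarrow> s = 1"
    and "1 / p < s" and "s < real DIM('a::euclidean_space) / p"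
    and "\<alpha> > - s * p" and "\<beta> > - s * p"
    and "ereal q > critical_exponent (real DIM('a)) \<gamma> s p \<alpha>"
  shows "\<not> (\<exists>u :: 'a \<Rightarrow> real. u \<in> X_tilde \<gamma> s p \<beta> \<and> positive_weak_solution \<gamma> s p q \<alpha> \<beta> u)"
proof (rule notI, elim exE conjE)
  fix u :: "'a \<Rightarrow> real"
  assume u: "u \<in> X_tilde \<gamma> s p \<beta>" and sol: "positive_weak_solution \<gamma> s p q \<alpha> \<beta> u"
  have ab: "\<alpha> > - (s * p)" "\<beta> > - (s * p)" using assms by simp_all
  show False
  proof (cases "\<gamma> = 0")
    case True
    have sp: "s * p < real DIM('a)" using assms(1,7) by (simp add: pos_less_divide_eq)
    then have "q > p * (real DIM('a) + \<alpha>) / (real DIM('a) - s * p)"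
      using assms(10) True by (simp add: critical_exponent_def Let_def)
    then show False
      using no_nonlocal_solution[OF assms(1) _ _ sp ab, of q u] u sol assms(4) True by simp
  next
    case False
    then have \<gamma>: "0 < \<gamma>" using assms(2) by simp
    have d: "real DIM('a) - p > 0"
      using assms(10) False by (auto simp: critical_exponent_def Let_def split: if_splits)
    then have "q > p * (real DIM('a) + \<alpha>) / (real DIM('a) - p)"
      using assms(10) False by (simp add: critical_exponent_def Let_def)
    moreover have "s \<le> 1" using assms(3,4,5) by (cases "\<gamma> = 1") auto
    ultimately show False
      using no_local_solution[OF assms(1) _ \<gamma> assms(3) _ ab _ u sol] d by simp
  qed
qed

end
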